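(* Let $\Gamma<\mathrm{PSL}(2,\mathbb{C})$ be a cofinite Kleinian group, let $\Gamma_1\vartriangleleft\Gamma$ be a normal subgroup of finite index $n$, let $\chi$ be a finite-dimensional unitary representation of $\Gamma_1$ in $V$, and let $\psi=U^{\chi}$ be the representation of $\Gamma$ in $V^n$ induced from $\chi$. Let $\mathfrak{S}(s,\Gamma_1,\chi)$ and $\mathfrak{S}(s,\Gamma,\psi)$ be the automorphic scattering matrices, and put $$\phi_{\Gamma_1}(s)=\det\mathfrak{S}(s,\Gamma_1,\chi),\qquad \phi_{\Gamma}(s)=\det\mathfrak{S}(s,\Gamma,\psi).$$ Then for all regular $s\in\mathbb{C}$, $$\phi_{\Gamma_1}(s)=\phi_{\Gamma}(s).$$
   Context: A Kleinian group is a discrete subgroup of $\mathrm{PSL}(2,\mathbb{C})$, acting on hyperbolic three-space $\mathbb{H}^3=\{z+rj: z\in\mathbb{C},\ r>0\}$; it is cofinite if it has a fundamental domain of finite hyperbolic volume. For $P=z+rj$ write $r(P)=r$. $V$ is a finite-dimensional complex inner product space. A point $s$ is regular if it is not a pole of the meromorphic functions involved. Induced representation. Let $\alpha_1,\dots,\alpha_n$ be a complete set of representatives of the right cosets $\Gamma_1\backslash\Gamma$. Set $\overline{\chi}(\gamma)=\chi(\gamma)$ for $\gamma\in\Gamma_1$ and $\overline{\chi}(\gamma)=0$ for $\gamma\notin\Gamma_1$. Then $\psi(\gamma)\big(\bigoplus_{i=1}^n v_i\big)=\bigoplus_{i=1}^n\sum_{j=1}^n\overline{\chi}(\alpha_i\gamma\alpha_j^{-1})v_j$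 for $\gamma\in\Gamma$, $v_i\in V$. Cusps. Let $G$ be a cofinite Kleinian group. For $\zeta\in\mathbb{P}^1(\mathbb{C})$ (the boundary of $\mathbb{H}^3$) let $G_\zeta$ be the stabilizer of $\zeta$ in $G$ and $G'_\zeta$ the maximal torsion-free parabolic subgroup of $G_\zeta$; $\zeta$ is a cusp of $G$ if $G'_\zeta$ is free abelian of rank two. Fix representatives $\zeta_1,\dots,\zeta_\kappa$ of the finitely many $G$-equivalence classes of cusps, and write $G_\alpha=G_{\zeta_\alpha}$, $G'_\alpha=G'_{\zeta_\alpha}$. For each $\alpha$ fix $B_\alpha\in\mathrm{PSL}(2,\mathbb{C})$, a lattice $\Lambda_\alpha=\mathbb{Z}\oplus\mathbb{Z}\tau_\alpha$ with $\operatorname{Im}\tau_\alpha>0$, and a root of unity $\epsilon_\alpha$ of order $1,2,3,4$ or $6$, such that $\zeta_\alpha=B_\alpha^{-1}\infty$, $$B_\alpha G'_\alpha B_\alpha^{-1}=\left\{\begin{pmatrix}1&b\\0&1\end{pmatrix}: b\in\Lambda_\alpha\right\},$$ $$B_\alpha G_\alpha B_\alpha^{-1}=\left\{\begin{pmatrix}\epsilon&\epsilon b\\0&\epsilon^{-1}\end{pmatrix}: b\in\Lambda_\alpha,\ \epsilon\text{ a power of }\epsilon_\alpha\right\}/\{\pm I\}.$$ Let $|\Lambda_\alpha|$ be the Euclidean area of a fundamental domain of $\Lambda_\alpha$. Scattering matrix (standard definition). Let $\rho$ be a unitary representation of $G$ in a finite-dimensional complex inner product space $W$. For each cusp let $W_\alpha=\{w\in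 W:\rho(\gamma)w=w\ \forall\gamma\in G_\alpha\}$, $k_\alpha=\dim W_\alpha$, and let $(w_{\alpha l})_{l=1}^{k_\alpha}$ be an orthonormal basis of $W_\alpha$. For $\operatorname{Re}(s)>1$ the Eisenstein series are $$E_{\alpha l}(P,s)=\sum_{M\in G_\alpha\backslash G} r(B_\alpha MP)^{1+s}\,\rho(M)^{*}w_{\alpha l},$$ and they continue meromorphically to $s\in\mathbb{C}$. With $\mathrm{Pr}_\beta$ the orthogonal projection of $W$ onto $W_\beta$, their constant terms are $$\frac{1}{|\Lambda_\beta|}\int_{\mathbb{C}/\Lambda_\beta}\mathrm{Pr}_\beta\,E_{\alpha l}\big(B_\beta^{-1}(z+rj),s\big)\,dx\,dy=\delta_{\alpha\beta}\,r^{1+s}w_{\alpha l}+r^{1-s}\sum_{m=1}^{k_\beta}\mathfrak{S}_{\alpha l,\beta m}(s)\,w_{\beta m}\qquad(z=x+iy).$$ The matrix $\mathfrak{S}(s,G,\rho)=(\mathfrak{S}_{\alpha l,\beta m}(s))$, of size $\sum_\alpha k_\alpha$, is the automorphic scattering matrix; cusps with $W_\alpha=0$ are omitted (an empty determinant is $1$).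
   Formalization: The choices of B_α for Γ and Γ1 are assumed compatible (equal heights at Γ-equivalent cusps), since independent choices rescale φ and make the claim false; lattices ω(Z⊕Zτ) and all rotations of order 1,2,3,4,6 are allowed so that such choices always exist. *)

theory Defs
  imports
    "Jordan_Normal_Form.Determinant"
    "HOL-Algebra.Algebra"
    "HOL-Complex_Analysis.Complex_Analysis"
begin

section \<open>Finite-dimensional complex inner product spaces\<close>

text \<open>The real inner product required by the superclass is the real part of the Hermitian one, so
  that norm, topology, sums and integrals are those of the library. The zero space is allowed.\<close>

class fd_complex_inner = real_inner +
  fixes scaleC :: "complex \<Rightarrow> 'a \<Rightarrow> 'a" (infixr \<open>*\<^sub>C\<close> 75)
    and cinner :: "'a \<Rightarrow> 'a \<Rightarrow> complex"
  assumes scaleC_add_right: "c *\<^sub>C (x + y) = c *\<^sub>C x + c *\<^sub>C y"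
    and scaleC_add_left: "(c + d) *\<^sub>C x = c *\<^sub>C x + d *\<^sub>C x"
    and scaleC_scaleC: "c *\<^sub>C (d *\<^sub>C x) = (c * d) *\<^sub>C x"
    and scaleC_of_real: "complex_of_real a *\<^sub>C x = a *\<^sub>R x"
    and cinner_add_left: "cinner (x + y) z = cinner x z + cinner y z"
    and cinner_scaleC_left: "cinner (c *\<^sub>C x) y = c * cinner x y"
    and cinner_commute: "cinner x y = cnj (cinner y x)"
    and inner_eq_Re_cinner: "inner x y = Re (cinner x y)"
    and fd_complex: "\<exists>B. finite B \<and> (\<forall>x. \<exists>c. x = (\<Sum>b\<in>B. c b *\<^sub>C b))"

instantiation Finite_Cartesian_Product.vec :: (fd_complex_inner, finite) fd_complex_inner
begin

definition scaleC_vec :: "complex \<Rightarrow> 'a ^ 'b \<Rightarrow> 'a ^ 'b" where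
  "scaleC_vec c x = (\<chi> i. c *\<^sub>C vec_nth x i)"

definition cinner_vec :: "'a ^ 'b \<Rightarrow> 'a ^ 'b \<Rightarrow> complex" where
  "cinner_vec x y = (\<Sum>i\<in>UNIV. cinner (vec_nth x i) (vec_nth y i))"

instance
proof
  fix c d :: complex and a :: real and x y z :: "'a ^ 'b"
  show "c *\<^sub>C (x + y) = c *\<^sub>C x + c *\<^sub>C y"
    by (simp add: scaleC_vec_def vec_eq_iff scaleC_add_right)
  show "(c + d) *\<^sub>C x = c *\<^sub>C x + d *\<^sub>C x"
    by (simp add: scaleC_vec_def vec_eq_iff scaleC_add_left)
  show "c *\<^sub>C (d *\<^sub>C x) = (c * d) *\<^sub>C x"
    by (simp add: scaleC_vec_def vec_eq_iff scaleC_scaleC)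
  show "complex_of_real a *\<^sub>C x = a *\<^sub>R x"
    by (simp add: scaleC_vec_def vec_eq_iff scaleC_of_real)
  show "cinner (x + y) z = cinner x z + cinner y z"
    by (simp add: cinner_vec_def cinner_add_left sum.distrib)
  show "cinner (c *\<^sub>C x) y = c * cinner x y"
    by (simp add: cinner_vec_def scaleC_vec_def cinner_scaleC_left sum_distrib_left)
  show "cinner x y = cnj (cinner y x)"
    unfolding cinner_vec_def cnj_sum by (intro sum.cong refl cinner_commute)
  show "inner x y = Re (cinner x y)"
    by (simp add: cinner_vec_def inner_vec_def inner_eq_Re_cinner)
next
  obtain B :: "'a set" where B: "finite B" "\<And>x. \<exists>c. x = (\<Sum>b\<in>B. c b *\<^sub>C b)"
    using fd_complex by blast
  then obtain k where k: "\<And>x. x = (\<Sum>b\<in>B. k x b *\<^sub>C b)" by metis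
  have zero: "c *\<^sub>C (0::'a) = 0" for c
    using scaleC_add_right[of c 0 0] by simp
  define e :: "'b \<times> 'a \<Rightarrow> 'a ^ 'b" where "e p = axis (fst p) (snd p)" for p
  have "\<exists>c. x = (\<Sum>v\<in>e ` (UNIV \<times> (B - {0})). c v *\<^sub>C v)" for x :: "'a ^ 'b"
  proof -
    have inj: "inj_on e (UNIV \<times> (B - {0}))"
      by (auto simp: inj_on_def e_def axis_eq_axis)
    define c where "c v = (case inv_into (UNIV \<times> (B - {0})) e v of (i, b) \<Rightarrow> k (vec_nth x i) b)" for v
    have "(\<Sum>v\<in>e ` (UNIV \<times> (B - {0})). c v *\<^sub>C v)
          = (\<Sum>p\<in>UNIV \<times> (B - {0}). k (vec_nth x (fst p)) (snd p) *\<^sub>C e p)"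
      unfolding sum.reindex[OF inj] o_def
      by (intro sum.cong refl) (simp add: c_def inv_into_f_f[OF inj] split: prod.splits)
    also have "\<dots> = (\<Sum>i\<in>UNIV. \<Sum>b\<in>B - {0}. k (vec_nth x i) b *\<^sub>C e (i, b))"
      by (simp add: sum.cartesian_product case_prod_beta)
    also have "\<dots> = x"
    proof (rule vec_eq_iff[THEN iffD2], rule allI)
      fix j
      have "vec_nth (\<Sum>i\<in>UNIV. \<Sum>b\<in>B - {0}. k (vec_nth x i) b *\<^sub>C e (i, b)) j
          = (\<Sum>i\<in>UNIV. if i = j then \<Sum>b\<in>B - {0}. k (vec_nth x i) b *\<^sub>C b else 0)"
        unfolding sum_component
        by (intro sum.cong refl) (auto simp: e_def scaleC_vec_def axis_def zero)
      also have "\<dots> = (\<Sum>b\<in>B - {0}. k (vec_nth x j) b *\<^sub>C b)" by simp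
      also have "\<dots> = (\<Sum>b\<in>B. k (vec_nth x j) b *\<^sub>C b)"
        using B(1) by (intro sum.mono_neutral_left) (auto simp: zero)
      finally show "vec_nth (\<Sum>i\<in>UNIV. \<Sum>b\<in>B - {0}. k (vec_nth x i) b *\<^sub>C e (i, b)) j = vec_nth x j"
        using k by simp
    qed
    finally show ?thesis by metis
  qed
  moreover have "finite (e ` (UNIV \<times> (B - {0})))" using B(1) by simp
  ultimately show "\<exists>B::('a ^ 'b) set. finite B \<and> (\<forall>x. \<exists>c. x = (\<Sum>b\<in>B. c b *\<^sub>C b))"
    by blast
qed

end

definition cadjoint :: "('a::fd_complex_inner \<Rightarrow> 'a) \<Rightarrow> 'a \<Rightarrow> 'a" where
  "cadjoint f = (THE g. \<forall>x y. cinner (f x) y = cinner x (g y))"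

definition orth_proj :: "'a::fd_complex_inner set \<Rightarrow> 'a \<Rightarrow> 'a" where
  "orth_proj U v = (THE p. p \<in> U \<and> (\<forall>u\<in>U. cinner (v - p) u = 0))"

definition orthonormal_basis :: "'a::fd_complex_inner set \<Rightarrow> nat \<Rightarrow> (nat \<Rightarrow> 'a) \<Rightarrow> bool" where
  "orthonormal_basis U k w \<longleftrightarrow>
     (\<forall>l<k. w l \<in> U) \<and>
     (\<forall>l<k. \<forall>m<k. cinner (w l) (w m) = (if l = m then 1 else 0)) \<and>
     (\<forall>u\<in>U. \<exists>c. u = (\<Sum>l<k. c l *\<^sub>C w l))"

section \<open>PSL(2,C) and its actions\<close>

type_synonym cmat2 = "complex ^ 2 ^ 2"
type_synonym psl = "cmat2 set"

definition mat2 :: "complex \<Rightarrow> complex \<Rightarrow> complex \<Rightarrow> complex \<Rightarrow> cmat2" where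
  "mat2 a b c d = vector [vector [a, b], vector [c, d]]"

definition entry :: "cmat2 \<Rightarrow> 2 \<Rightarrow> 2 \<Rightarrow> complex" where
  "entry A i j = vec_nth (vec_nth A i) j"

definition SL2C :: "cmat2 monoid" where
  "SL2C = \<lparr>carrier = {A. Determinants.det A = 1}, monoid.mult = (**), one = Finite_Cartesian_Product.mat 1\<rparr>"

definition PSL2C :: "psl monoid" where
  "PSL2C = SL2C Mod {Finite_Cartesian_Product.mat 1, - Finite_Cartesian_Product.mat 1}"

text \<open>The class of \<open>A\<close> in \<open>PSL2C\<close>, which is the coset \<open>{A, -A}\<close>.\<close>

definition psl_class :: "cmat2 \<Rightarrow> psl" where
  "psl_class A = {A, - A}"

abbreviation psl_mult :: "psl \<Rightarrow> psl \<Rightarrow> psl" (infixl \<open>\<otimes>\<^sub>P\<close> 70) where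
  "g \<otimes>\<^sub>P h \<equiv> g \<otimes>\<^bsub>PSL2C\<^esub> h"

abbreviation psl_inv :: "psl \<Rightarrow> psl" where
  "psl_inv g \<equiv> inv\<^bsub>PSL2C\<^esub> g"

abbreviation subgrp :: "psl set \<Rightarrow> psl monoid" where
  "subgrp G \<equiv> PSL2C\<lparr>carrier := G\<rparr>"

text \<open>The point \<open>z + rj\<close> of hyperbolic space is the pair \<open>(z, r)\<close>.\<close>

type_synonym hpoint = "complex \<times> real"

definition H3 :: "hpoint set" where
  "H3 = {P. snd P > 0}"

definition mat_act :: "cmat2 \<Rightarrow> hpoint \<Rightarrow> hpoint" where
  "mat_act A P =
     (let a = entry A 1 1; b = entry A 1 2; c = entry A 2 1; d = entry A 2 2; z = fst P; r = snd P;
          D = (cmod (c * z + d))\<^sup>2 + (cmod c)\<^sup>2 * r\<^sup>2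
      in (((a * z + b) * cnj (c * z + d) + a * cnj c * of_real (r\<^sup>2)) / of_real D, r / D))"

text \<open>Both representatives \<open>A\<close> and \<open>-A\<close> of a class act in the same way.\<close>

definition act :: "psl \<Rightarrow> hpoint \<Rightarrow> hpoint" where
  "act g P = the_elem ((\<lambda>A. mat_act A P) ` g)"

text \<open>The boundary \<open>P\<^sup>1(C)\<close> is \<open>complex option\<close>, with \<open>None\<close> as the point at infinity.\<close>

definition mat_bact :: "cmat2 \<Rightarrow> complex option \<Rightarrow> complex option" where
  "mat_bact A \<zeta> =
     (let a = entry A 1 1; b = entry A 1 2; c = entry A 2 1; d = entry A 2 2
      in case \<zeta> of
           None \<Rightarrow> if c = 0 then None else Some (a / c)
         | Some z \<Rightarrow> if c * z + d = 0 then None else Some ((a * z + b) / (c * z + d)))"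

definition bact :: "psl \<Rightarrow> complex option \<Rightarrow> complex option" where
  "bact g \<zeta> = the_elem ((\<lambda>A. mat_bact A \<zeta>) ` g)"

section \<open>Cofinite Kleinian groups and their cusps\<close>

text \<open>The projection from SL(2,C) to PSL(2,C) is a two-sheeted covering, so a subgroup of PSL(2,C) is
  discrete exactly when its full preimage \<open>\<Union>G\<close> in SL(2,C) is.\<close>

definition kleinian :: "psl set \<Rightarrow> bool" where
  "kleinian G \<longleftrightarrow> subgroup G PSL2C \<and> discrete (\<Union>G)"

definition hyp_volume :: "hpoint measure" where
  "hyp_volume = density lborel (\<lambda>P. if P \<in> H3 then ennreal (1 / snd P ^ 3) else 0)"

definition fundamental_domain :: "psl set \<Rightarrow> hpoint set \<Rightarrow> bool" where
  "fundamental_domain G F \<longleftrightarrow>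
     closedin (top_of_set H3) F \<and>
     (\<forall>P\<in>H3. \<exists>g\<in>G. act g P \<in> F) \<and>
     (\<forall>P\<in>interior F. \<forall>g\<in>G. act g P \<in> interior F \<longrightarrow> act g P = P) \<and>
     emeasure hyp_volume (frontier F) = 0"

definition cofinite_kleinian :: "psl set \<Rightarrow> bool" where
  "cofinite_kleinian G \<longleftrightarrow>
     kleinian G \<and> (\<exists>F. fundamental_domain G F \<and> emeasure hyp_volume F < \<infinity>)"

definition stab :: "psl set \<Rightarrow> complex option \<Rightarrow> psl set" where
  "stab G \<zeta> = {g \<in> G. bact g \<zeta> = \<zeta>}"

definition parabolic :: "psl \<Rightarrow> bool" where
  "parabolic g \<longleftrightarrow> g \<in> carrier PSL2C \<and> g \<noteq> \<one>\<^bsub>PSL2C\<^esub> \<and> (\<exists>A\<in>g. Determinants.trace A = 2)"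

text \<open>The largest torsion-free parabolic subgroup of the stabilizer, as the union of all of them.\<close>

definition parabolic_stab :: "psl set \<Rightarrow> complex option \<Rightarrow> psl set" where
  "parabolic_stab G \<zeta> =
     \<Union>{H. subgroup H PSL2C \<and> H \<subseteq> stab G \<zeta> \<and>
          (\<forall>h\<in>H. h \<noteq> \<one>\<^bsub>PSL2C\<^esub> \<longrightarrow> parabolic h \<and> (\<forall>k>0. h [^]\<^bsub>PSL2C\<^esub> (k::nat) \<noteq> \<one>\<^bsub>PSL2C\<^esub>))}"

definition cusp :: "psl set \<Rightarrow> complex option \<Rightarrow> bool" where
  "cusp G \<zeta> \<longleftrightarrow> subgrp (parabolic_stab G \<zeta>) \<cong> free_Abelian_group {..<2::nat}"

text \<open>For each \<open>a < num_cusps\<close>: the representative \<open>\<zeta>\<^sub>a\<close>, the element \<open>B\<^sub>a\<close>, the numbers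
  \<open>\<omega>\<^sub>a\<close> and \<open>\<tau>\<^sub>a\<close> that give the lattice, and the root of unity \<open>\<epsilon>\<^sub>a\<close>.\<close>

record cusp_data =
  num_cusps :: nat
  vertex :: "nat \<Rightarrow> complex option"
  chart :: "nat \<Rightarrow> psl"
  scale :: "nat \<Rightarrow> complex"
  modulus :: "nat \<Rightarrow> complex"
  rot :: "nat \<Rightarrow> complex"

text \<open>The lattice is \<open>\<omega>(\<int> \<oplus> \<int>\<tau>)\<close>; the usual normalization is \<open>\<omega> = 1\<close>. The factor is kept because the
  scattering determinant depends on the scale of the charts (replacing \<open>B\<^sub>a\<close> by a chart with heights
  multiplied by \<open>t\<close> multiplies it by \<open>t\<close> to the power \<open>2 s k\<^sub>a\<close>), and a group and a subgroup of
  finite index need not admit charts of equal scale that are both normalized to \<open>\<omega> = 1\<close>.\<close>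

definition cusp_lattice :: "cusp_data \<Rightarrow> nat \<Rightarrow> complex set" where
  "cusp_lattice C a =
     {scale C a * (of_int m + of_int n * modulus C a) | m n. True}"

definition lattice_cell :: "cusp_data \<Rightarrow> nat \<Rightarrow> complex set" where
  "lattice_cell C a =
     {scale C a * (of_real x + of_real y * modulus C a) | x y. x \<in> {0..1} \<and> y \<in> {0..1}}"

definition lattice_area :: "cusp_data \<Rightarrow> nat \<Rightarrow> real" where
  "lattice_area C a = measure lborel (lattice_cell C a)"

text \<open>\<open>\<epsilon>\<close> acts on the plane as the rotation \<open>z \<mapsto> \<epsilon>\<^sup>2 z\<close>. The order 1, 2, 3, 4 or 6 is that of the
  rotation; rotations of order 4 and 6 need \<open>\<epsilon>\<close> of order 8 and 12.\<close>

definition cusp_rotation :: "complex \<Rightarrow> bool" where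
  "cusp_rotation \<epsilon> \<longleftrightarrow>
     (\<exists>q\<in>{1, 2, 3, 4, 6::nat}. (\<epsilon>\<^sup>2) ^ q = 1 \<and> (\<forall>j. 0 < j \<and> j < q \<longrightarrow> (\<epsilon>\<^sup>2) ^ j \<noteq> 1))"

definition cusp_data_for :: "psl set \<Rightarrow> cusp_data \<Rightarrow> bool" where
  "cusp_data_for G C \<longleftrightarrow>
     (\<forall>a<num_cusps C. cusp G (vertex C a)) \<and>
     (\<forall>\<zeta>. cusp G \<zeta> \<longrightarrow> (\<exists>!a. a < num_cusps C \<and> (\<exists>g\<in>G. bact g (vertex C a) = \<zeta>))) \<and>
     (\<forall>a<num_cusps C.
        chart C a \<in> carrier PSL2C \<and>
        vertex C a = bact (psl_inv (chart C a)) None \<and>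
        scale C a \<noteq> 0 \<and> Im (modulus C a) > 0 \<and> cusp_rotation (rot C a) \<and>
        (\<lambda>g. chart C a \<otimes>\<^sub>P g \<otimes>\<^sub>P psl_inv (chart C a)) ` parabolic_stab G (vertex C a)
          = {psl_class (mat2 1 b 0 1) | b. b \<in> cusp_lattice C a} \<and>
        (\<lambda>g. chart C a \<otimes>\<^sub>P g \<otimes>\<^sub>P psl_inv (chart C a)) ` stab G (vertex C a)
          = {psl_class (mat2 \<epsilon> (\<epsilon> * b) 0 (inverse \<epsilon>)) | \<epsilon> b.
               b \<in> cusp_lattice C a \<and> (\<exists>j::nat. \<epsilon> = rot C a ^ j)})"

text \<open>Charts of the two groups at cusps identified by \<open>\<gamma> \<in> G\<close> measure the same height.\<close>

definition compatible_charts :: "psl set \<Rightarrow> cusp_data \<Rightarrow> cusp_data \<Rightarrow> bool" where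
  "compatible_charts G C C1 \<longleftrightarrow>
     (\<forall>a<num_cusps C. \<forall>b<num_cusps C1. \<forall>\<gamma>\<in>G. bact \<gamma> (vertex C1 b) = vertex C a \<longrightarrow>
        (\<forall>P\<in>H3. snd (act (chart C1 b) P) = snd (act (chart C a \<otimes>\<^sub>P \<gamma>) P)))"

section \<open>Unitary and induced representations\<close>

definition unitary_rep :: "psl set \<Rightarrow> (psl \<Rightarrow> 'v::fd_complex_inner \<Rightarrow> 'v) \<Rightarrow> bool" where
  "unitary_rep G \<rho> \<longleftrightarrow>
     (\<forall>g\<in>G. (\<forall>u v. \<rho> g (u + v) = \<rho> g u + \<rho> g v) \<and> (\<forall>c v. \<rho> g (c *\<^sub>C v) = c *\<^sub>C \<rho> g v) \<and>
             bij (\<rho> g) \<and> (\<forall>u v. cinner (\<rho> g u) (\<rho> g v) = cinner u v)) \<and>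
     (\<forall>g\<in>G. \<forall>h\<in>G. \<rho> (g \<otimes>\<^sub>P h) = \<rho> g \<circ> \<rho> h)"

definition coset_reps :: "psl set \<Rightarrow> psl set \<Rightarrow> ('n::finite \<Rightarrow> psl) \<Rightarrow> bool" where
  "coset_reps \<Gamma> \<Gamma>1 \<alpha> \<longleftrightarrow>
     range \<alpha> \<subseteq> \<Gamma> \<and> bij_betw (\<lambda>i. \<Gamma>1 #>\<^bsub>subgrp \<Gamma>\<^esub> \<alpha> i) UNIV (rcosets\<^bsub>subgrp \<Gamma>\<^esub> \<Gamma>1)"

definition ext_zero :: "psl set \<Rightarrow> (psl \<Rightarrow> 'v::fd_complex_inner \<Rightarrow> 'v) \<Rightarrow> psl \<Rightarrow> 'v \<Rightarrow> 'v" where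
  "ext_zero \<Gamma>1 chi g v = (if g \<in> \<Gamma>1 then chi g v else 0)"

definition induced_rep ::
  "psl set \<Rightarrow> (psl \<Rightarrow> 'v::fd_complex_inner \<Rightarrow> 'v) \<Rightarrow> ('n::finite \<Rightarrow> psl) \<Rightarrow> psl \<Rightarrow> 'v ^ 'n \<Rightarrow> 'v ^ 'n" where
  "induced_rep \<Gamma>1 chi \<alpha> g v =
     (\<chi> i. \<Sum>j\<in>UNIV. ext_zero \<Gamma>1 chi (\<alpha> i \<otimes>\<^sub>P g \<otimes>\<^sub>P psl_inv (\<alpha> j)) (vec_nth v j))"

section \<open>Eisenstein series and the scattering matrix\<close>

definition fixed_space ::
  "psl set \<Rightarrow> cusp_data \<Rightarrow> (psl \<Rightarrow> 'v::fd_complex_inner \<Rightarrow> 'v) \<Rightarrow> nat \<Rightarrow> 'v set" where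
  "fixed_space G C \<rho> a = {v. \<forall>g\<in>stab G (vertex C a). \<rho> g v = v}"

text \<open>The summand depends only on the coset \<open>G\<^sub>a M\<close>, because \<open>w\<close> is fixed by \<open>G\<^sub>a\<close>.\<close>

definition eisenstein_series ::
  "psl set \<Rightarrow> cusp_data \<Rightarrow> (psl \<Rightarrow> 'v::fd_complex_inner \<Rightarrow> 'v) \<Rightarrow> nat \<Rightarrow> 'v \<Rightarrow>
   (hpoint \<Rightarrow> complex \<Rightarrow> 'v) \<Rightarrow> bool" where
  "eisenstein_series G C \<rho> a w E \<longleftrightarrow>
     (\<forall>P\<in>H3. \<forall>s. Re s > 1 \<longrightarrow>
        ((\<lambda>K. the_elem ((\<lambda>M. (complex_of_real (snd (act (chart C a \<otimes>\<^sub>P M) P)) powr (1 + s))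
                                *\<^sub>C cadjoint (\<rho> M) w) ` K))
           has_sum E P s) (rcosets\<^bsub>subgrp G\<^esub> (stab G (vertex C a))))"

text \<open>The entry \<open>S a l b m\<close> is a meromorphic function on the whole plane, and is determined by the
  constant terms of the Eisenstein series on the half-plane where these converge.\<close>

definition scattering_matrix ::
  "psl set \<Rightarrow> cusp_data \<Rightarrow> (psl \<Rightarrow> 'v::fd_complex_inner \<Rightarrow> 'v) \<Rightarrow> (nat \<Rightarrow> nat) \<Rightarrow>
   (nat \<Rightarrow> nat \<Rightarrow> 'v) \<Rightarrow> (nat \<Rightarrow> nat \<Rightarrow> nat \<Rightarrow> nat \<Rightarrow> complex \<Rightarrow> complex) \<Rightarrow> bool" where
  "scattering_matrix G C \<rho> k w S \<longleftrightarrow>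
     (\<forall>a<num_cusps C. orthonormal_basis (fixed_space G C \<rho> a) (k a) (w a)) \<and>
     (\<forall>a<num_cusps C. \<forall>l<k a. \<forall>b<num_cusps C. \<forall>m<k b. S a l b m meromorphic_on UNIV) \<and>
     (\<exists>E. (\<forall>a<num_cusps C. \<forall>l<k a. eisenstein_series G C \<rho> a (w a l) (E a l)) \<and>
          (\<forall>a<num_cusps C. \<forall>l<k a. \<forall>b<num_cusps C. \<forall>r>0. \<forall>s. Re s > 1 \<longrightarrow>
             (let f = (\<lambda>z. orth_proj (fixed_space G C \<rho> b)
                             (E a l (act (psl_inv (chart C b)) (z, r)) s))
              in f integrable_on lattice_cell C b \<and>
                 (1 / lattice_area C b) *\<^sub>R integral (lattice_cell C b) f
                 = (if a = b then (complex_of_real r powr (1 + s)) *\<^sub>C w a l else 0)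
                   + (complex_of_real r powr (1 - s)) *\<^sub>C (\<Sum>m<k b. S a l b m s *\<^sub>C w b m))))"

definition scattering_index :: "cusp_data \<Rightarrow> (nat \<Rightarrow> nat) \<Rightarrow> (nat \<times> nat) list" where
  "scattering_index C k = concat (map (\<lambda>a. map (Pair a) [0..<k a]) [0..<num_cusps C])"

definition scattering_det ::
  "cusp_data \<Rightarrow> (nat \<Rightarrow> nat) \<Rightarrow> (nat \<Rightarrow> nat \<Rightarrow> nat \<Rightarrow> nat \<Rightarrow> complex \<Rightarrow> complex) \<Rightarrow> complex \<Rightarrow> complex" where
  "scattering_det C k S s =
     (let I = scattering_index C k
      in Determinant.det (Matrix.mat (length I) (length I)
           (\<lambda>(i, j). S (fst (I ! i)) (snd (I ! i)) (fst (I ! j)) (snd (I ! j)) s)))"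

text \<open>The meromorphic function \<open>\<phi> = det S\<close>: \<open>remove_sings\<close> gives it its analytic value wherever it has
  no pole, also at points where individual entries of \<open>S\<close> are singular.\<close>

definition scattering_phi ::
  "cusp_data \<Rightarrow> (nat \<Rightarrow> nat) \<Rightarrow> (nat \<Rightarrow> nat \<Rightarrow> nat \<Rightarrow> nat \<Rightarrow> complex \<Rightarrow> complex) \<Rightarrow> complex \<Rightarrow> complex" where
  "scattering_phi C k S = remove_sings (scattering_det C k S)"

end

theory Submission
  imports Defs
begin

text \<open>A vector of \<open>V\<^sup>n\<close> is the same as a function on \<open>\<Gamma>\<close> with values in \<open>V\<close> that is
  \<open>\<Gamma>1\<close>-equivariant on the left, with \<open>\<Gamma>\<close> acting by right translation. As \<open>\<Gamma>\<close> is the disjoint union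
  of the double cosets \<open>\<Gamma>1 \<gamma>\<^sub>b\<inverse> \<Gamma>\<^sub>a\<close>, where \<open>b\<close> runs over the cusps of \<open>\<Gamma>1\<close> above \<open>a\<close> and
  \<open>\<gamma>\<^sub>b\<close> maps \<open>b\<close> to \<open>a\<close>, evaluation at the \<open>\<gamma>\<^sub>b\<inverse>\<close> identifies the space fixed by \<open>\<Gamma>\<^sub>a\<close> with the
  sum of the spaces fixed by the \<open>\<Gamma>1\<^sub>b\<close>. The same decomposition writes the components of the
  Eisenstein series of \<open>\<Gamma>\<close> as sums of Eisenstein series of \<open>\<Gamma>1\<close>.

  Taking constant terms, with the mean over a period lattice shown not to depend on the lattice,
  gives \<open>r\<^sup>1\<^sup>+\<^sup>s I + r\<^sup>1\<^sup>-\<^sup>s S = A (r\<^sup>1\<^sup>+\<^sup>s I + r\<^sup>1\<^sup>-\<^sup>s S1) B\<close> for all \<open>r > 0\<close>, where \<open>A\<close> and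
  \<open>B\<close> are constant matrices. Hence \<open>A B = I\<close> and \<open>S = A S1 B\<close>. Lifting vectors from \<open>\<Gamma>1\<close> to \<open>\<Gamma>\<close>
  gives a left inverse of \<open>A\<close>, so \<open>A\<close> is square and the determinants agree for \<open>Re s > 1\<close>. By the
  identity theorem they agree everywhere.\<close>

section \<open>Means of doubly periodic functions\<close>

text \<open>Evaluation at the \<open>\<gamma>\<^sub>b\<inverse>\<close> is in general not isometric:
  in the inner product of \<open>V\<^sup>n\<close> the component at \<open>b\<close> counts once for
  every coset of \<open>\<Gamma>1\<close> in its double coset. So \<open>B\<close> is not simply the
  adjoint of \<open>A\<close>; it carries the weights \<open>coset_count\<close>. No norm is
  computed for \<open>A B = I\<close>, which is just the coefficient of
  \<open>r\<^sup>1\<^sup>+\<^sup>s\<close>. The obstacle is that the lattices at a cusp of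
  \<open>\<Gamma>\<close> and at a cusp of \<open>\<Gamma>1\<close> above it differ. The sum over
  all representatives is periodic for the lattice of \<open>\<Gamma>\<close>, but a single summand
  is only known to be invariant under the multiples by the index \<open>N\<close>, because
  \<open>N\<close>-th powers lie in \<open>\<Gamma>1\<close> and \<open>\<Gamma>1\<close> is normal.
  The same multiples show that both groups have their cusps at the same points, on which the double
  coset decomposition rests. Compatible charts make \<open>r\<close> the same variable on both
  sides; other charts would bring powers of scale factors into the identity.\<close>

lemma integral_periodic_shift:
  fixes g :: "real \<Rightarrow> complex"
  assumes cont: "continuous_on UNIV g" and per: "\<And>x. g (x + 1) = g x"
  shows "integral {0..1} (\<lambda>x. g (x + c)) = integral {0..1} g"
proof -
  have nat: "g (x + of_nat k) = g x" for x k
  proof (induction k)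
    case (Suc k)
    then show ?case using per[of "x + of_nat k"] by (simp add: algebra_simps)
  qed simp
  have int: "g (x + of_int k) = g x" for x k
  proof (cases "k \<ge> 0")
    case True
    then show ?thesis using nat[of x "nat k"] by simp
  next
    case False
    then show ?thesis using nat[of "x + of_int k" "nat (-k)"] by simp
  qed
  define d where "d = frac c"
  have d: "0 \<le> d" "d \<le> 1" by (simp_all add: d_def less_imp_le frac_lt_1)
  have sub: "g integrable_on {a..b}" for a b
    by (rule integrable_continuous_real) (rule continuous_on_subset[OF cont], simp)
  have shift: "integral {a..b} (\<lambda>x. g (x + e)) = integral {a + e..b + e} g" for a b e
    using integral_shift_real_ivl[of "a + e" e "b + e" g] by simp
  have "g (x + c) = g (x + d)" for x
    using int[of "x + d" "\<lfloor>c\<rfloor>"] by (simp add: d_def frac_def)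
  then have "integral {0..1} (\<lambda>x. g (x + c)) = integral {d..1 + d} g"
    using shift[of 0 1 d] by simp
  also have "\<dots> = integral {d..1} g + integral {1..1 + d} g"
    using d by (intro Henstock_Kurzweil_Integration.integral_combine[symmetric] sub) auto
  also have "integral {1..1 + d} g = integral {0..d} g"
    using shift[of 0 d 1] per by (simp add: add.commute)
  also have "integral {d..1} g + integral {0..d} g = integral {0..1} g"
    using Henstock_Kurzweil_Integration.integral_combine[of 0 d 1 g] d sub by (simp add: add.commute)
  finally show ?thesis .
qed

text \<open>The average over a period cell, taken in coordinates on the unit square. No area factor
  appears, and the dependence on the basis is visible until \<open>torus_mean_unique\<close> removes
  it for periodic functions.\<close>

definition torus_mean :: "complex \<Rightarrow> complex \<Rightarrow> (complex \<Rightarrow> complex) \<Rightarrow> complex" where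
  "torus_mean p q f = integral (cbox (0, 0) (1, 1)) (\<lambda>t. f (fst t *\<^sub>R p + snd t *\<^sub>R q))"

lemma torus_mean_integrable:
  fixes f :: "complex \<Rightarrow> complex"
  assumes "continuous_on UNIV f"
  shows "(\<lambda>t. f (fst t *\<^sub>R p + snd t *\<^sub>R q)) integrable_on cbox (0, 0) (1, 1 :: real)"
  by (intro Henstock_Kurzweil_Integration.integrable_continuous continuous_on_compose2[OF assms] continuous_intros) auto

lemma torus_mean_const [simp]: "torus_mean p q (\<lambda>_. c) = c"
  by (simp add: torus_mean_def content_Pair)

lemma torus_mean_sum:
  assumes "finite I" "\<And>i. i \<in> I \<Longrightarrow> continuous_on UNIV (f i)"
  shows "torus_mean p q (\<lambda>z. \<Sum>i\<in>I. f i z) = (\<Sum>i\<in>I. torus_mean p q (f i))"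
  unfolding torus_mean_def
  by (rule integral_sum[OF assms(1)]) (rule torus_mean_integrable[OF assms(2)])

lemma torus_mean_mult: "torus_mean p q (\<lambda>z. c * f z) = c * torus_mean p q f"
  by (simp add: torus_mean_def)

lemma torus_mean_iterated:
  assumes cont: "continuous_on UNIV f"
  shows "torus_mean p q f = integral {0..1} (\<lambda>x. integral {0..1} (\<lambda>y. f (x *\<^sub>R p + y *\<^sub>R q)))"
proof -
  have "continuous_on (cbox (0, 0) (1, 1)) (\<lambda>(x::real, y::real). f (x *\<^sub>R p + y *\<^sub>R q))"
    unfolding case_prod_beta
    by (intro continuous_on_compose2[OF cont] continuous_intros) auto
  from integral_prod_continuous[OF this]
  show ?thesis by (simp add: torus_mean_def case_prod_beta')
qed

lemma torus_mean_iterated':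
  assumes cont: "continuous_on UNIV f"
  shows "torus_mean p q f = integral {0..1} (\<lambda>y. integral {0..1} (\<lambda>x. f (x *\<^sub>R p + y *\<^sub>R q)))"
proof -
  have "continuous_on (cbox (0, 0) (1, 1)) (\<lambda>(x::real, y::real). f (x *\<^sub>R p + y *\<^sub>R q))"
    unfolding case_prod_beta
    by (intro continuous_on_compose2[OF cont] continuous_intros) auto
  from integral_swap_continuous[OF this]
  show ?thesis unfolding torus_mean_iterated[OF cont] by simp
qed

lemma torus_mean_translate:
  assumes cont: "continuous_on UNIV f"
    and per: "\<And>z. f (z + p) = f z" "\<And>z. f (z + q) = f z"
    and basis: "Im (cnj p * q) \<noteq> 0"
  shows "torus_mean p q (\<lambda>z. f (z + t)) = torus_mean p q f"
proof -
  have shift_cont: "continuous_on UNIV (\<lambda>z. f (z + c))" for c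
    by (intro continuous_on_compose2[OF cont] continuous_intros) auto
  have 1: "torus_mean p q (\<lambda>z. f (z + a *\<^sub>R p)) = torus_mean p q f" if cont: "continuous_on UNIV f"
    and per: "\<And>z. f (z + p) = f z" for a f
  proof -
    have per': "f (p + z) = f z" for z using per[of z] by (simp add: add.commute)
    have c: "continuous_on UNIV (\<lambda>z. f (z + a *\<^sub>R p))"
      by (intro continuous_on_compose2[OF cont] continuous_intros) auto
    have "integral {0..1} (\<lambda>x. f (x *\<^sub>R p + y *\<^sub>R q + a *\<^sub>R p)) = integral {0..1} (\<lambda>x. f (x *\<^sub>R p + y *\<^sub>R q))" for y
    proof -
      have "continuous_on UNIV (\<lambda>x. f (x *\<^sub>R p + y *\<^sub>R q))"
        by (intro continuous_on_compose2[OF cont] continuous_intros) auto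
      from integral_periodic_shift[OF this, of a] show ?thesis
        by (simp add: scaleR_add_left add_ac per')
    qed
    then show ?thesis
      by (simp add: torus_mean_iterated'[OF cont] torus_mean_iterated'[OF c])
  qed
  have 2: "torus_mean p q (\<lambda>z. f (z + a *\<^sub>R q)) = torus_mean p q f" if cont: "continuous_on UNIV f"
    and per: "\<And>z. f (z + q) = f z" for a f
  proof -
    have per': "f (q + z) = f z" for z using per[of z] by (simp add: add.commute)
    have c: "continuous_on UNIV (\<lambda>z. f (z + a *\<^sub>R q))"
      by (intro continuous_on_compose2[OF cont] continuous_intros) auto
    have "integral {0..1} (\<lambda>y. f (x *\<^sub>R p + y *\<^sub>R q + a *\<^sub>R q)) = integral {0..1} (\<lambda>y. f (x *\<^sub>R p + y *\<^sub>R q))" for x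
    proof -
      have "continuous_on UNIV (\<lambda>y. f (x *\<^sub>R p + y *\<^sub>R q))"
        by (intro continuous_on_compose2[OF cont] continuous_intros) auto
      from integral_periodic_shift[OF this, of a] show ?thesis
        by (simp add: scaleR_add_left add_ac per')
    qed
    then show ?thesis
      by (simp add: torus_mean_iterated[OF cont] torus_mean_iterated[OF c])
  qed
  \<comment> \<open>\<open>D\<close> is the determinant of \<open>p\<close> and \<open>q\<close> as
    real vectors, and \<open>a\<close>, \<open>b\<close> are the coordinates of \<open>t\<close> by
    Cramer's rule; the shift by \<open>t\<close> is then made one coordinate at a time.\<close>
  define D where "D = Im (cnj p * q)"
  define a b where "a = Im (cnj t * q) / D" and "b = Im (cnj p * t) / D"
  have D: "D = Re p * Im q - Im p * Re q" by (simp add: D_def algebra_simps)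
  have D0: "D \<noteq> 0" using basis by (simp add: D_def)
  have t: "t = a *\<^sub>R p + b *\<^sub>R q"
    using D0 by (simp add: complex_eq_iff a_def b_def divide_simps) (simp add: D algebra_simps)
  have "torus_mean p q (\<lambda>z. f (z + t)) = torus_mean p q (\<lambda>z. f (z + a *\<^sub>R p + b *\<^sub>R q))"
    by (simp add: t add.assoc)
  also have "\<dots> = torus_mean p q (\<lambda>z. f (z + b *\<^sub>R q))"
    using 1[OF shift_cont[of "b *\<^sub>R q"], of a] per(1)
    by (metis (no_types, lifting) ab_semigroup_add_class.add_ac(1) add.commute)
  also have "\<dots> = torus_mean p q f"
    by (rule 2[OF cont per(2)])
  finally show ?thesis .
qed

text \<open>Both sides equal the double mean of \<open>f (z + t)\<close>, taken over \<open>z\<close> in one cell and \<open>t\<close> in the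
  other.\<close>

lemma torus_mean_unique:
  assumes cont: "continuous_on UNIV f"
    and per: "\<And>z. f (z + p) = f z" "\<And>z. f (z + q) = f z" "Im (cnj p * q) \<noteq> 0"
    and per': "\<And>z. f (z + p') = f z" "\<And>z. f (z + q') = f z" "Im (cnj p' * q') \<noteq> 0"
  shows "torus_mean p q f = torus_mean p' q' f"
proof -
  have "torus_mean p q f = torus_mean p' q' (\<lambda>t. torus_mean p q (\<lambda>z. f (z + t)))"
    by (simp add: torus_mean_translate[OF cont per])
  also have "\<dots> = torus_mean p q (\<lambda>z. torus_mean p' q' (\<lambda>t. f (t + z)))"
    unfolding torus_mean_def add.commute[of _ "fst _ *\<^sub>R p' + _"]
    by (rule integral_swap_continuous)
       (unfold case_prod_beta, intro continuous_on_compose2[OF cont] continuous_intros, auto)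
  also have "\<dots> = torus_mean p' q' f"
    by (simp add: torus_mean_translate[OF cont per'])
  finally show ?thesis .
qed

lemma Im_of_real_mult: "Im (of_real r * z) = r * Im z"
  by simp

text \<open>The substitution carries the basis \<open>p\<close>, \<open>q\<close> to
  \<open>u * p\<close>, \<open>u * q\<close>, and \<open>z \<mapsto> f (z + c)\<close> has these
  periods as well as \<open>p'\<close>, \<open>q'\<close>, so that uniqueness of the mean applies.
  This compares means in charts that differ by such a map, over lattices that need not
  correspond.\<close>

lemma torus_mean_affine:
  assumes cont: "continuous_on UNIV f" and u: "u \<noteq> 0"
    and per: "\<And>z. f (u * (z + p) + c) = f (u * z + c)" "\<And>z. f (u * (z + q) + c) = f (u * z + c)"
      "Im (cnj p * q) \<noteq> 0"
    and per': "\<And>z. f (z + p') = f z" "\<And>z. f (z + q') = f z" "Im (cnj p' * q') \<noteq> 0"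
  shows "torus_mean p q (\<lambda>z. f (u * z + c)) = torus_mean p' q' f"
proof -
  have shift: "f (z + u * t + c) = f (z + c)" if "\<And>z. f (u * (z + t) + c) = f (u * z + c)" for t z
    using that[of "z / u"] u by (simp add: algebra_simps)
  have cont': "continuous_on UNIV (\<lambda>z. f (z + c))"
    by (intro continuous_on_compose2[OF cont] continuous_intros) auto
  have "cnj (u * p) * (u * q) = of_real ((cmod u)\<^sup>2) * (cnj p * q)"
    unfolding complex_norm_square by (simp add: algebra_simps)
  then have "Im (cnj (u * p) * (u * q)) = (cmod u)\<^sup>2 * Im (cnj p * q)" by (simp only: Im_of_real_mult)
  then have basis: "Im (cnj (u * p) * (u * q)) \<noteq> 0" using per(3) u by simp
  have per'_c: "f (z + p' + c) = f (z + c)" "f (z + q' + c) = f (z + c)" for z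
    using per'(1,2)[of "z + c"] by (simp_all add: algebra_simps)
  have "torus_mean p q (\<lambda>z. f (u * z + c)) = torus_mean (u * p) (u * q) (\<lambda>z. f (z + c))"
    by (simp add: torus_mean_def algebra_simps)
  also have "\<dots> = torus_mean p' q' (\<lambda>z. f (z + c))"
    by (rule torus_mean_unique[OF cont']) (use shift per per'_c per' basis in auto)
  also have "\<dots> = torus_mean p' q' f" by (rule torus_mean_translate[OF cont per'])
  finally show ?thesis .
qed

abbreviation "cusp_mean C a \<equiv> torus_mean (scale C a) (scale C a * modulus C a)"

section \<open>Lattice cells, real coordinates and area\<close>

lemma integral_transfer:
  fixes h :: "'a::euclidean_space \<Rightarrow> 'b::euclidean_space" and f :: "'b \<Rightarrow> 'c::banach"
  assumes inv: "\<And>x. g (h x) = x" "\<And>y. h (g y) = y" and cont: "\<And>x. continuous (at x) h"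
    and box: "\<And>u v. h ` cbox u v = cbox (h u) (h v)"
    and content: "\<And>u v. content (h ` cbox u v) = content (cbox u v)"
    and int: "f integrable_on h ` S" and bdd: "bounded S"
  shows "integral S (\<lambda>x. f (h x)) = integral (h ` S) f"
proof -
  obtain a b where S: "S \<subseteq> cbox a b" using bounded_subset_cbox_symmetric[OF bdd] by blast
  then have S': "h ` S \<subseteq> cbox (h a) (h b)" using box by blast
  have gbox: "g ` cbox u v = cbox (g u) (g v)" for u v
  proof -
    have "cbox u v = h ` cbox (g u) (g v)" by (simp add: box inv)
    then show ?thesis by (simp add: image_image inv)
  qed
  have "(f has_integral integral (h ` S) f) (h ` S)" using int by (rule integrable_integral)
  then have "((\<lambda>y. if y \<in> h ` S then f y else 0) has_integral integral (h ` S) f) (cbox (h a) (h b))"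
    using has_integral_restrict[OF S'] by blast
  from has_integral_twiddle[of 1 g h, OF _ _ _ cont _ _ _ this]
  have "((\<lambda>x. if h x \<in> h ` S then f (h x) else 0) has_integral integral (h ` S) f) (g ` cbox (h a) (h b))"
    using inv box gbox content by auto
  moreover have "h x \<in> h ` S \<longleftrightarrow> x \<in> S" for x using inv by (metis imageE image_eqI)
  ultimately have "((\<lambda>x. if x \<in> S then f (h x) else 0) has_integral integral (h ` S) f) (cbox a b)"
    by (simp add: gbox inv)
  then show ?thesis using has_integral_restrict[OF S] by (metis integral_unique)
qed

lemma ex_index2: "(\<exists>i::2. P i) \<longleftrightarrow> P 1 \<or> P 2"
  by (metis exhaust_2)

definition real2_complex :: "real ^ 2 \<Rightarrow> complex" where
  "real2_complex v = Complex (vec_nth v 1) (vec_nth v 2)"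

definition complex_real2 :: "complex \<Rightarrow> real ^ 2" where
  "complex_real2 z = vector [Re z, Im z]"

lemma complex_real2_inverse [simp]: "real2_complex (complex_real2 z) = z"
  by (simp add: real2_complex_def complex_real2_def complex_eq_iff)

lemma real2_complex_inverse [simp]: "complex_real2 (real2_complex v) = v"
  by (simp add: real2_complex_def complex_real2_def vec_eq_iff forall_2)

lemma complex_real2_nth [simp]: "vec_nth (complex_real2 z) 1 = Re z" "vec_nth (complex_real2 z) 2 = Im z"
  by (simp_all add: complex_real2_def)

lemma Re_Im_real2_complex [simp]: "Re (real2_complex v) = vec_nth v 1" "Im (real2_complex v) = vec_nth v 2"
  by (simp_all add: real2_complex_def)

lemma image_eqI_inverse:
  assumes "\<And>x. g (h x) = x" "\<And>y. h (g y) = y" "\<And>x. h x \<in> B \<longleftrightarrow> x \<in> A"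
  shows "h ` A = B"
  using assms by (metis (no_types, lifting) image_eqI image_subsetI subsetI subset_antisym)

lemma linear_complex_real2: "linear complex_real2"
  by (rule linearI) (simp_all add: vec_eq_iff forall_2)

lemma linear_real2_complex: "linear real2_complex"
  by (rule linearI) (simp_all add: real2_complex_def complex_eq_iff)

lemma integral_complex_real2:
  fixes f :: "complex \<Rightarrow> 'c::banach"
  assumes int: "f integrable_on S" and bdd: "bounded S"
  shows "integral (complex_real2 ` S) (\<lambda>v. f (real2_complex v)) = integral S f"
proof -
  have S: "real2_complex ` complex_real2 ` S = S" by (simp add: image_image)
  have box: "real2_complex ` cbox u v = cbox (real2_complex u) (real2_complex v)" for u v
    by (rule image_eqI_inverse[where g = complex_real2])
      (auto simp: mem_box_cart in_cbox_complex_iff forall_2)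
  have "integral (complex_real2 ` S) (\<lambda>v. f (real2_complex v))
      = integral (real2_complex ` complex_real2 ` S) f"
  proof (rule integral_transfer[where g = complex_real2])
    show "content (real2_complex ` cbox u v) = content (cbox u v)" for u v
      unfolding box by (auto simp: content_cbox_if_cart content_cbox_if interval_eq_empty_cart
          box_eq_empty Basis_complex_def prod_2 UNIV_2 not_less forall_2 ex_index2)
    show "bounded (complex_real2 ` S)"
      by (rule bounded_linear_image[OF bdd]) (simp add: linear_complex_real2 linear_conv_bounded_linear[symmetric])
    show "continuous (at x) real2_complex" for x
      by (simp add: linear_continuous_at linear_real2_complex linear_conv_bounded_linear[symmetric])
  qed (use int box S in auto)
  then show ?thesis by (simp add: S)
qed

definition pair_real2 :: "real \<times> real \<Rightarrow> real ^ 2" where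
  "pair_real2 t = vector [fst t, snd t]"

lemma pair_real2_nth [simp]: "vec_nth (pair_real2 z) 1 = fst z" "vec_nth (pair_real2 z) 2 = snd z"
  by (simp_all add: pair_real2_def)

lemma integral_pair_real2:
  fixes f :: "real ^ 2 \<Rightarrow> 'c::banach"
  assumes int: "f integrable_on cbox 0 1"
  shows "integral (cbox (0, 0) (1, 1)) (\<lambda>t. f (pair_real2 t)) = integral (cbox 0 1) f"
proof -
  let ?g = "\<lambda>v :: real ^ 2. (vec_nth v 1, vec_nth v 2)"
  have box: "pair_real2 ` cbox u v = cbox (pair_real2 u) (pair_real2 v)" for u v
    by (rule image_eqI_inverse[where g = ?g])
      (auto simp: vec_eq_iff mem_box_cart forall_2 cbox_Pair_iff[of _ _ "fst u" "snd u" "fst v" "snd v", simplified] prod_eq_iff split_paired_all)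
  have unit: "pair_real2 (0, 0) = 0" "pair_real2 (1, 1) = 1" by (simp_all add: vec_eq_iff forall_2)
  have "linear pair_real2" by (rule linearI) (simp_all add: vec_eq_iff forall_2)
  then have cont: "continuous (at x) pair_real2" for x
    by (simp add: linear_continuous_at linear_conv_bounded_linear[symmetric])
  have cnt: "content (pair_real2 ` cbox u v) = content (cbox u v)" for u v
    unfolding box
    by (cases u, cases v) (auto simp: content_Pair content_cbox_if_cart interval_eq_empty_cart
          prod_2 UNIV_2 not_less forall_2 ex_index2)
  show ?thesis
    using integral_transfer[where g = ?g and h = pair_real2 and f = f and S = "cbox (0,0) (1,1)"]
      int box unit cont cnt by (simp add: vec_eq_iff forall_2)
qed

text \<open>The cell is the image of the unit square under a linear map, whose determinant scales
  every integral. The function 1 shows that this factor is the area, and the independence of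
  \<open>p\<close> and \<open>q\<close> that it is not 0.\<close>

lemma integral_parallelogram:
  fixes p q :: complex and f :: "complex \<Rightarrow> complex"
  defines "S \<equiv> {x *\<^sub>R p + y *\<^sub>R q | x y. x \<in> {0..1} \<and> y \<in> {0..1}}"
  assumes cont: "continuous_on UNIV f" and basis: "Im (cnj p * q) \<noteq> 0"
  shows "integral S f = measure lborel S *\<^sub>R torus_mean p q f" "measure lborel S \<noteq> 0"
proof -
  define g :: "real ^ 2 \<Rightarrow> real ^ 2" where "g v = complex_real2 (vec_nth v 1 *\<^sub>R p + vec_nth v 2 *\<^sub>R q)" for v
  let ?d = "\<bar>Determinants.det (matrix g)\<bar>"
  have lin: "linear g"
    by (rule linearI) (simp_all add: g_def vec_eq_iff forall_2 algebra_simps)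
  have gS: "g ` cbox 0 1 = complex_real2 ` S"
    unfolding g_def S_def 
  proof (intro Set.set_eqI iffI)
    fix v assume "v \<in> complex_real2 ` {x *\<^sub>R p + y *\<^sub>R q | x y. x \<in> {0..1} \<and> y \<in> {0..1}}"
    then obtain x y where v: "v = complex_real2 (x *\<^sub>R p + y *\<^sub>R q)" "x \<in> {0..1}" "y \<in> {0..1}" by blast
    show "v \<in> (\<lambda>v :: real ^ 2. complex_real2 (vec_nth v 1 *\<^sub>R p + vec_nth v 2 *\<^sub>R q)) ` cbox 0 1"
      by (rule image_eqI[of _ _ "pair_real2 (x, y)"]) (use v in \<open>simp_all add: mem_box_cart forall_2\<close>)
  qed (auto simp: mem_box_cart forall_2 intro!: imageI, blast)
  have S_eq: "S = real2_complex ` g ` cbox 0 1"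
    unfolding gS by (simp add: image_image)
  have compact: "compact S"
    unfolding S_eq
    by (intro compact_continuous_image linear_continuous_on linear_real2_complex lin compact_cbox
        linear_conv_bounded_linear[THEN iffD1])
  have abs: "(F \<circ> g) absolutely_integrable_on cbox 0 1" if "continuous_on UNIV F" for F :: "real ^ 2 \<Rightarrow> real ^ 2"
    unfolding o_def
    by (intro absolutely_integrable_continuous continuous_on_compose2[OF that] linear_continuous_on
      lin linear_conv_bounded_linear[THEN iffD1]) auto
  have int_S: "h integrable_on S" if "continuous_on UNIV h" for h :: "complex \<Rightarrow> complex"
    using compact borel_integrable_compact[OF compact continuous_on_subset[OF that]]
    by (metis integrable_on_indicator set_borel_integral_eq_integral(1) set_integrable_def top_greatest)
  have main: "integral S h = ?d *\<^sub>R torus_mean p q h" if h: "continuous_on UNIV h" for h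
  proof -
    \<comment> \<open>The linear substitution rule is applied to functions from
      \<open>real ^ 2\<close> to \<open>real ^ 2\<close>, so the values of \<open>h\<close> are put
      into real coordinates as well.\<close>
    let ?F = "\<lambda>v. complex_real2 (h (real2_complex v))"
    have cF: "continuous_on UNIV ?F"
      by (intro continuous_on_compose2[OF linear_continuous_on[of complex_real2]] continuous_on_compose2[OF h] linear_continuous_on
           linear_conv_bounded_linear[THEN iffD1] linear_real2_complex linear_complex_real2) auto
    have cFi: "continuous_on UNIV (\<lambda>v. h (real2_complex v))"
      by (intro continuous_on_compose2[OF h] linear_continuous_on
           linear_conv_bounded_linear[THEN iffD1] linear_real2_complex) auto
    have bl: "bounded_linear real2_complex"
      using linear_real2_complex by (simp add: linear_conv_bounded_linear)
    have absF: "?F absolutely_integrable_on g ` cbox 0 1"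
      using absolutely_integrable_on_linear_image[OF lin] abs[OF cF] by blast
    have "integral S h = integral (g ` cbox 0 1) (\<lambda>v. h (real2_complex v))"
      unfolding gS by (rule integral_complex_real2[symmetric]) (use int_S[OF h] compact compact_imp_bounded in auto)
    also have "\<dots> = integral (g ` cbox 0 1) (real2_complex \<circ> ?F)" by (simp add: o_def)
    also have "\<dots> = real2_complex (integral (g ` cbox 0 1) ?F)"
      by (rule integral_linear[OF _ bl]) (use absF in \<open>simp add: absolutely_integrable_on_def\<close>)
    also have "integral (g ` cbox 0 1) ?F = ?d *\<^sub>R integral (cbox 0 1) (?F \<circ> g)"
      by (rule integral_change_of_variables_linear[OF lin]) (use abs[OF cF] in blast)
    also have "real2_complex \<dots> = ?d *\<^sub>R real2_complex (integral (cbox 0 1) (?F \<circ> g))"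
      by (rule linear_scale[OF linear_real2_complex])
    also have "real2_complex (integral (cbox 0 1) (?F \<circ> g)) = integral (cbox 0 1) (real2_complex \<circ> (?F \<circ> g))"
      by (rule integral_linear[OF _ bl, symmetric]) (use abs[OF cF] in \<open>simp add: absolutely_integrable_on_def\<close>)
    also have "\<dots> = integral (cbox 0 1) (\<lambda>v. h (real2_complex (g v)))" by (simp add: o_def)
    also have "\<dots> = integral (cbox (0, 0) (1, 1)) (\<lambda>t. h (real2_complex (g (pair_real2 t))))"
      by (rule integral_pair_real2[symmetric], rule Henstock_Kurzweil_Integration.integrable_continuous,
          rule continuous_on_compose2[OF cFi]) 
        (use lin in \<open>auto intro: linear_continuous_on simp: linear_conv_bounded_linear\<close>)
    also have "\<dots> = torus_mean p q h" by (simp add: torus_mean_def g_def)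
    finally show ?thesis .
  qed
  have meas: "measure lborel S = measure lebesgue S"
    using compact by (simp add: borel_compact)
  have "integral S (complex_of_real \<circ> (\<lambda>_. 1)) = complex_of_real (integral S (\<lambda>_. 1))"
    by (rule integral_linear[OF integrable_on_const[OF lmeasurable_compact[OF compact]] bounded_linear_of_real])
  then have "complex_of_real (measure lebesgue S) = integral S (\<lambda>_. 1)"
    by (simp only: lmeasure_integral[OF lmeasurable_compact[OF compact]] o_def of_real_1)
  also have "\<dots> = complex_of_real ?d" by (simp add: main scaleR_conv_of_real)
  finally have d: "measure lborel S = ?d" using meas by (metis of_real_eq_iff)
  show "integral S f = measure lborel S *\<^sub>R torus_mean p q f"
    unfolding d by (rule main[OF cont])
  have "inj g"
  proof (rule linear_injective_0[OF lin, THEN iffD2], intro allI impI)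
    fix v assume "g v = 0"
    then have e: "vec_nth v 1 * Re p + vec_nth v 2 * Re q = 0" "vec_nth v 1 * Im p + vec_nth v 2 * Im q = 0"
      by (auto simp: g_def vec_eq_iff forall_2)
    have D: "Re p * Im q - Im p * Re q \<noteq> 0" using basis by (simp add: algebra_simps)
    have "vec_nth v 1 * (Re p * Im q - Im p * Re q)
        = (vec_nth v 1 * Re p + vec_nth v 2 * Re q) * Im q - (vec_nth v 1 * Im p + vec_nth v 2 * Im q) * Re q"
      "vec_nth v 2 * (Re p * Im q - Im p * Re q)
        = (vec_nth v 1 * Im p + vec_nth v 2 * Im q) * Re p - (vec_nth v 1 * Re p + vec_nth v 2 * Re q) * Im p"
      by (simp_all add: algebra_simps)
    then have "vec_nth v 1 * (Re p * Im q - Im p * Re q) = 0" "vec_nth v 2 * (Re p * Im q - Im p * Re q) = 0"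
      unfolding e by simp_all
    with D show "v = 0" by (simp add: vec_eq_iff forall_2)
  qed
  then show "measure lborel S \<noteq> 0"
    unfolding d using det_nz_iff_inj[OF lin] by simp
qed

section \<open>PSL(2,C) and its actions\<close>

abbreviation "I2 \<equiv> Finite_Cartesian_Product.mat 1 :: cmat2"

lemma cmat2_eq_iff: "A = B \<longleftrightarrow> entry A 1 1 = entry B 1 1 \<and> entry A 1 2 = entry B 1 2
    \<and> entry A 2 1 = entry B 2 1 \<and> entry A 2 2 = entry B 2 2"
  by (auto simp: entry_def vec_eq_iff forall_2)

lemma entry_mult: "entry (A ** B) i j = entry A i 1 * entry B 1 j + entry A i 2 * entry B 2 j"
  by (simp add: entry_def matrix_matrix_mult_def sum_2)

lemma entry_uminus [simp]: "entry (- A) i j = - entry A i j"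
  by (simp add: entry_def)

lemma entry_mat2 [simp]:
  "entry (mat2 a b c d) 1 1 = a" "entry (mat2 a b c d) 1 2 = b"
  "entry (mat2 a b c d) 2 1 = c" "entry (mat2 a b c d) 2 2 = d"
  by (simp_all add: entry_def mat2_def)

lemma entry_I2 [simp]:
  "entry I2 1 1 = 1" "entry I2 1 2 = 0" "entry I2 2 1 = 0" "entry I2 2 2 = 1"
  by (simp_all add: entry_def Finite_Cartesian_Product.mat_def)

lemma det_cmat2: "Determinants.det A = entry A 1 1 * entry A 2 2 - entry A 1 2 * entry A 2 1"
  by (simp add: entry_def det_2)

lemma cmat2_uminus_mult: "(- A :: cmat2) ** (B :: cmat2) = - (A ** B)" "(A :: cmat2) ** (- B :: cmat2) = - (A ** B)"
  by (simp_all add: cmat2_eq_iff entry_mult)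

lemma det_cmat2_uminus [simp]: "Determinants.det (- A :: cmat2) = Determinants.det A"
  by (simp add: det_cmat2)

lemma group_SL2C: "group SL2C"
proof (rule groupI)
  fix A assume "A \<in> carrier SL2C"
  then have "Determinants.det A = 1" by (simp add: SL2C_def)
  then have "mat2 (entry A 2 2) (- entry A 1 2) (- entry A 2 1) (entry A 1 1) ** A = I2"
      "Determinants.det (mat2 (entry A 2 2) (- entry A 1 2) (- entry A 2 1) (entry A 1 1)) = 1"
    by (simp_all add: cmat2_eq_iff entry_mult det_cmat2 algebra_simps)
  then show "\<exists>B\<in>carrier SL2C. B \<otimes>\<^bsub>SL2C\<^esub> A = \<one>\<^bsub>SL2C\<^esub>"
    by (auto simp: SL2C_def)
qed (auto simp: SL2C_def det_mul matrix_mul_assoc)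

lemma center_normal: "{I2, - I2} \<lhd> SL2C"
proof -
  interpret group SL2C by (rule group_SL2C)
  have m: "A \<otimes>\<^bsub>SL2C\<^esub> B = A ** B" for A B by (simp add: SL2C_def)
  have o: "\<one>\<^bsub>SL2C\<^esub> = I2" by (simp add: SL2C_def)
  have sub: "subgroup {I2, - I2} SL2C"
  proof (rule subgroupI)
    fix A assume "A \<in> {I2, - I2}"
    then have "A \<in> carrier SL2C" "A ** A = I2"
      by (auto simp: cmat2_uminus_mult SL2C_def)
    then have "inv\<^bsub>SL2C\<^esub> A = A" by (intro inv_equality) (auto simp: m o)
    then show "inv\<^bsub>SL2C\<^esub> A \<in> {I2, - I2}" using \<open>A \<in> {I2, - I2}\<close> by simp
  qed (auto simp: m cmat2_uminus_mult, auto simp: SL2C_def)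
  have "A \<otimes>\<^bsub>SL2C\<^esub> h \<otimes>\<^bsub>SL2C\<^esub> inv\<^bsub>SL2C\<^esub> A \<in> {I2, - I2}" if A: "A \<in> carrier SL2C" and "h \<in> {I2, - I2}" for A h
  proof -
    have "A ** inv\<^bsub>SL2C\<^esub> A = I2" using r_inv[OF A] by (simp add: m o)
    then show ?thesis using that by (auto simp: m cmat2_uminus_mult)
  qed
  then show ?thesis using sub normal_inv_iff by blast
qed

lemma group_PSL2C: "group PSL2C"
  unfolding PSL2C_def by (rule normal.factorgroup_is_group[OF center_normal])

interpretation PSL: group PSL2C by (rule group_PSL2C)

lemma carrier_PSL2C: "carrier PSL2C = {psl_class A | A. Determinants.det A = 1}"
  by (auto simp: PSL2C_def FactGroup_def RCOSETS_def r_coset_def SL2C_def psl_class_def cmat2_uminus_mult)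

lemma PSL2C_E:
  assumes "g \<in> carrier PSL2C"
  obtains A where "g = psl_class A" "Determinants.det A = 1"
  using assms by (auto simp: carrier_PSL2C)

lemma psl_class_in_carrier [simp]: "Determinants.det A = 1 \<Longrightarrow> psl_class A \<in> carrier PSL2C"
  by (auto simp: carrier_PSL2C)

lemma psl_class_mult: "psl_class A \<otimes>\<^sub>P psl_class B = psl_class (A ** B)"
  by (auto simp: PSL2C_def FactGroup_def set_mult_def SL2C_def psl_class_def cmat2_uminus_mult)

lemma psl_one: "\<one>\<^bsub>PSL2C\<^esub> = psl_class I2"
  by (simp add: PSL2C_def FactGroup_def psl_class_def)

lemma psl_class_eq_iff: "psl_class A = psl_class B \<longleftrightarrow> A = B \<or> A = - B"
  by (auto simp: psl_class_def doubleton_eq_iff)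

text \<open>For \<open>P = (z, r)\<close> this is the Hermitian form whose matrix has the rows
  \<open>(|z|^2 + r^2, z)\<close> and \<open>(cnj z, 1)\<close>, evaluated at the row vectors
  \<open>(u, v)\<close> and \<open>(x, y)\<close>. Its determinant is \<open>r^2\<close>.\<close>

definition herm :: "hpoint \<Rightarrow> complex \<Rightarrow> complex \<Rightarrow> complex \<Rightarrow> complex \<Rightarrow> complex" where
  "herm P u v x y = (u * fst P + v) * cnj (x * fst P + y) + u * cnj x * (of_real (snd P))\<^sup>2"

lemma herm_diag: "herm P c d c d = of_real ((cmod (c * fst P + d))\<^sup>2 + (cmod c)\<^sup>2 * (snd P)\<^sup>2)"
  unfolding herm_def of_real_add of_real_mult complex_norm_square by simp

lemma mat_act_herm:
  "mat_act A P = (herm P (entry A 1 1) (entry A 1 2) (entry A 2 1) (entry A 2 2)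
        / herm P (entry A 2 1) (entry A 2 2) (entry A 2 1) (entry A 2 2),
      snd P / Re (herm P (entry A 2 1) (entry A 2 2) (entry A 2 1) (entry A 2 2)))"
  by (simp add: mat_act_def Let_def herm_diag) (simp add: herm_def)

lemma herm_diag_pos:
  assumes "snd P > 0" "c \<noteq> 0 \<or> d \<noteq> 0"
  shows "Re (herm P c d c d) > 0"
  using assms unfolding herm_diag
  by (cases "c = 0") (auto intro!: add_nonneg_pos)

text \<open>A Gram determinant: the determinant \<open>r^2\<close> of the form times the squared
  modulus of the determinant of the two rows.\<close>

lemma herm_det: "herm P a b a b * herm P c d c d - herm P a b c d * herm P c d a b
    = (of_real (snd P))\<^sup>2 * ((a * d - b * c) * cnj (a * d - b * c))"
  by (simp add: herm_def algebra_simps power2_eq_square)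

lemma herm_sym: "herm P x y u v = cnj (herm P u v x y)"
  by (simp add: herm_def algebra_simps)

lemma row_nonzero: "Determinants.det A = 1 \<Longrightarrow> entry A 2 1 \<noteq> 0 \<or> entry A 2 2 \<noteq> 0"
  by (auto simp: det_cmat2)

lemma mat_act_H3: "P \<in> H3 \<Longrightarrow> Determinants.det A = 1 \<Longrightarrow> mat_act A P \<in> H3"
  using herm_diag_pos row_nonzero by (simp add: mat_act_herm H3_def)

text \<open>A point determines the positive Hermitian form \<open>herm\<close> up to scale, and matrices act on these
  forms by substitution.\<close>

lemma herm_mat_act:
  assumes P: "P \<in> H3" and det: "Determinants.det B = 1"
  shows "herm (mat_act B P) u v x y
    = herm P (u * entry B 1 1 + v * entry B 2 1) (u * entry B 1 2 + v * entry B 2 2)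
             (x * entry B 1 1 + y * entry B 2 1) (x * entry B 1 2 + y * entry B 2 2)
      / herm P (entry B 2 1) (entry B 2 2) (entry B 2 1) (entry B 2 2)"
proof -
  define p q c d where e: "p = entry B 1 1" "q = entry B 1 2" "c = entry B 2 1" "d = entry B 2 2"
  define D where "D = herm P c d c d"
  have D: "D = of_real (Re D)" by (simp add: D_def herm_diag)
  have "Re D > 0" using P det unfolding D_def e by (intro herm_diag_pos row_nonzero) (auto simp: H3_def)
  then have D0: "D \<noteq> 0" by auto
  have cD: "cnj D = D" by (metis D complex_cnj_complex_of_real)
  have Q: "mat_act B P = (herm P p q c d / D, snd P / Re D)"
    by (simp add: mat_act_herm e D_def)
  have "p * d - q * c = 1" using det by (simp add: det_cmat2 e)
  with herm_det[of P p q c d] have "herm P p q p q * D - herm P p q c d * herm P c d p q = (of_real (snd P))\<^sup>2"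
    by (simp add: D_def)
  then have "herm P p q p q * D = herm P p q c d * herm P c d p q + (of_real (snd P))\<^sup>2"
    by (simp add: algebra_simps)
  \<comment> \<open>The right side is \<open>|Z|^2 + R^2\<close> for the image point
    \<open>(Z, R)\<close>, the top left entry of the matrix of its form; determinant 1 turns it into
    a value of the form of \<open>P\<close>.\<close>
  then have pq: "herm P p q p q / D = herm P p q c d * herm P c d p q / D\<^sup>2 + (of_real (snd P))\<^sup>2 / D\<^sup>2"
    using D0 by (simp add: field_simps power2_eq_square)
  have "herm (mat_act B P) u v x y = u * cnj x * (herm P p q p q / D) + u * cnj y * (herm P p q c d / D)
      + v * cnj x * (herm P c d p q / D) + v * cnj y * (D / D)"
    unfolding pq Q herm_def[of "(herm P p q c d / D, snd P / Re D)"] fst_conv snd_conv of_real_divide D[symmetric]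
    using D0 by (simp add: herm_sym[of P c d p q] cD field_simps power2_eq_square)
  also have "\<dots> = (u * cnj x * herm P p q p q + u * cnj y * herm P p q c d
      + v * cnj x * herm P c d p q + v * cnj y * D) / D"
    by (simp add: add_divide_distrib)
  also have "u * cnj x * herm P p q p q + u * cnj y * herm P p q c d
      + v * cnj x * herm P c d p q + v * cnj y * D
     = herm P (u * p + v * c) (u * q + v * d) (x * p + y * c) (x * q + y * d)"
    by (simp add: herm_def D_def algebra_simps)
  finally show ?thesis by (simp add: e D_def)
qed

lemma mat_act_mult:
  assumes P: "P \<in> H3" and det: "Determinants.det A = 1" "Determinants.det B = 1"
  shows "mat_act (A ** B) P = mat_act A (mat_act B P)"
proof -
  define D where "D = herm P (entry B 2 1) (entry B 2 2) (entry B 2 1) (entry B 2 2)"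
  have "Re D > 0" using P det unfolding D_def by (intro herm_diag_pos row_nonzero) (auto simp: H3_def)
  moreover have "Re (x / D) = Re x / Re D" for x
    by (metis D_def Re_complex_of_real Re_divide_of_real herm_diag)
  moreover have "snd (mat_act B P) = snd P / Re D" by (simp add: mat_act_herm D_def)
  moreover have "D \<noteq> 0" using \<open>Re D > 0\<close> by auto
  ultimately show ?thesis
    unfolding mat_act_herm[of "A ** B"] mat_act_herm[of A] herm_mat_act[OF P det(2)] D_def[symmetric]
    by (simp only: entry_mult prod.inject) simp
qed

lemma mat_act_uminus: "mat_act (- A) P = mat_act A P"
proof -
  have "herm P (- u) (- v) (- x) (- y) = herm P u v x y" for u v x y
    by (simp add: herm_def algebra_simps)
  then show ?thesis by (simp add: mat_act_herm)
qed

lemma act_psl_class [simp]: "act (psl_class A) P = mat_act A P"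
  by (simp add: act_def psl_class_def mat_act_uminus)

lemma act_mult: "\<lbrakk>g \<in> carrier PSL2C; h \<in> carrier PSL2C; P \<in> H3\<rbrakk> \<Longrightarrow> act (g \<otimes>\<^sub>P h) P = act g (act h P)"
  by (auto elim!: PSL2C_E simp: psl_class_mult mat_act_mult)

lemma act_one [simp]: "act \<one>\<^bsub>PSL2C\<^esub> P = P"
  by (simp add: psl_one mat_act_herm herm_def)

lemma act_H3 [simp]: "\<lbrakk>g \<in> carrier PSL2C; P \<in> H3\<rbrakk> \<Longrightarrow> act g P \<in> H3"
  by (auto elim!: PSL2C_E simp: mat_act_H3)

text \<open>Homogeneous coordinates on the boundary. The action becomes linear in them, so the
  composition law needs no cases at infinity.\<close>

definition proj_pt :: "complex \<Rightarrow> complex \<Rightarrow> complex option" where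
  "proj_pt x y = (if y = 0 then None else Some (x / y))"

lemma mat_bact_proj_pt:
  assumes "x \<noteq> 0 \<or> y \<noteq> 0"
  shows "mat_bact A (proj_pt x y) = proj_pt (entry A 1 1 * x + entry A 1 2 * y) (entry A 2 1 * x + entry A 2 2 * y)"
proof (cases "y = 0")
  case True
  then show ?thesis using assms by (simp add: mat_bact_def proj_pt_def Let_def)
next
  case False
  have "a * (x / y) + b = (a * x + b * y) / y" for a b using False by (simp add: field_simps)
  then show ?thesis using False by (simp add: mat_bact_def proj_pt_def Let_def)
qed

lemma proj_pt_surj: obtains x y where "\<zeta> = proj_pt x y" "x \<noteq> 0 \<or> y \<noteq> 0"
proof (cases \<zeta>)
  case None
  then show ?thesis using that[of 1 0] by (simp add: proj_pt_def)
next
  case (Some z)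
  then show ?thesis using that[of z 1] by (simp add: proj_pt_def)
qed

lemma mat_bact_mult:
  assumes det: "Determinants.det B = 1"
  shows "mat_bact (A ** B) \<zeta> = mat_bact A (mat_bact B \<zeta>)"
proof -
  obtain x y where z: "\<zeta> = proj_pt x y" "x \<noteq> 0 \<or> y \<noteq> 0" by (rule proj_pt_surj)
  let ?x = "entry B 1 1 * x + entry B 1 2 * y" and ?y = "entry B 2 1 * x + entry B 2 2 * y"
  have "entry B 2 2 * ?x - entry B 1 2 * ?y = Determinants.det B * x"
      "entry B 1 1 * ?y - entry B 2 1 * ?x = Determinants.det B * y"
    by (simp_all add: det_cmat2 algebra_simps)
  then have "?x \<noteq> 0 \<or> ?y \<noteq> 0" using z det by auto
  from mat_bact_proj_pt[OF this, of A] show ?thesis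
    unfolding z(1) mat_bact_proj_pt[OF z(2)] by (simp add: entry_mult algebra_simps)
qed

lemma mat_bact_uminus: "mat_bact (- A) \<zeta> = mat_bact A \<zeta>"
proof -
  obtain x y where z: "\<zeta> = proj_pt x y" "x \<noteq> 0 \<or> y \<noteq> 0" by (rule proj_pt_surj)
  have "proj_pt (- a) (- b) = proj_pt a b" for a b by (simp add: proj_pt_def)
  from this[of "entry A 1 1 * x + entry A 1 2 * y" "entry A 2 1 * x + entry A 2 2 * y"] show ?thesis
    unfolding z(1) mat_bact_proj_pt[OF z(2)] by (simp add: algebra_simps)
qed

lemma bact_psl_class [simp]: "bact (psl_class A) \<zeta> = mat_bact A \<zeta>"
  by (simp add: bact_def psl_class_def mat_bact_uminus)

lemma bact_mult: "\<lbrakk>g \<in> carrier PSL2C; h \<in> carrier PSL2C\<rbrakk> \<Longrightarrow> bact (g \<otimes>\<^sub>P h) \<zeta> = bact g (bact h \<zeta>)"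
  by (auto elim!: PSL2C_E simp: psl_class_mult mat_bact_mult)

lemma bact_one [simp]: "bact \<one>\<^bsub>PSL2C\<^esub> \<zeta> = \<zeta>"
  by (cases \<zeta>) (simp_all add: psl_one mat_bact_def)

lemma bact_inv_iff:
  assumes "g \<in> carrier PSL2C"
  shows "bact (psl_inv g) \<zeta> = \<xi> \<longleftrightarrow> \<zeta> = bact g \<xi>"
proof -
  have "bact (psl_inv g) (bact g \<xi>) = \<xi>" "bact g (bact (psl_inv g) \<zeta>) = \<zeta>"
    using assms by (simp_all add: bact_mult[symmetric])
  then show ?thesis by auto
qed

lemma act_upper:
  assumes "cmod \<epsilon> = 1"
  shows "act (psl_class (mat2 \<epsilon> (\<epsilon> * b) 0 (inverse \<epsilon>))) (z, r) = (\<epsilon>\<^sup>2 * z + \<epsilon>\<^sup>2 * b, r)"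
proof -
  have e: "inverse (cnj \<epsilon>) = \<epsilon>"
    using assms by (metis complex_norm_square inverse_unique mult.commute of_real_1 one_power2)
  have "cmod (inverse \<epsilon>) = 1" using assms by (simp add: norm_inverse)
  then show ?thesis
    by (simp add: mat_act_def Let_def, subst e) (simp add: power2_eq_square algebra_simps)
qed

lemma act_translation: "act (psl_class (mat2 1 b 0 1)) (z, r) = (z + b, r)"
  using act_upper[of 1 b z r] by simp

text \<open>The image of \<open>(z, r)\<close> has height
  \<open>r / (|c z + d|^2 + |c|^2 r^2)\<close>, where \<open>c\<close>, \<open>d\<close> is the
  lower row. The points over \<open>z = 0\<close> with \<open>r = 1\<close> and \<open>r = 2\<close>
  already force \<open>c = 0\<close> and \<open>|d| = 1\<close>, which leaves a Euclidean motion of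
  the plane.\<close>

lemma height_preserving_affine:
  assumes g: "g \<in> carrier PSL2C" and h: "\<And>P. P \<in> H3 \<Longrightarrow> snd (act g P) = snd P"
  obtains u c where "cmod u = 1" "\<And>z r. r > 0 \<Longrightarrow> act g (z, r) = (u * z + c, r)"
proof -
  from g obtain A where A: "g = psl_class A" "Determinants.det A = 1" by (rule PSL2C_E)
  define c d where e: "c = entry A 2 1" "d = entry A 2 2"
  have *: "(cmod (c * z + d))\<^sup>2 + (cmod c)\<^sup>2 * r\<^sup>2 = 1" if "r > 0" for z r
  proof -
    have "r / ((cmod (c * z + d))\<^sup>2 + (cmod c)\<^sup>2 * r\<^sup>2) = r"
      using h[of "(z, r)"] that by (simp add: H3_def A mat_act_def Let_def e)
    moreover from this have "(cmod (c * z + d))\<^sup>2 + (cmod c)\<^sup>2 * r\<^sup>2 \<noteq> 0"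
      using that by (metis div_by_0 less_irrefl)
    ultimately have "r = r * ((cmod (c * z + d))\<^sup>2 + (cmod c)\<^sup>2 * r\<^sup>2)"
      by (metis nonzero_eq_divide_eq)
    with that show ?thesis by simp
  qed
  have "(cmod d)\<^sup>2 + (cmod c)\<^sup>2 = 1" "(cmod d)\<^sup>2 + (cmod c)\<^sup>2 * 4 = 1" using *[of 1 0] *[of 2 0] by simp_all
  then have "(cmod c)\<^sup>2 = 0" by linarith
  then have c: "c = 0" by simp
  with *[of 1 0] have d: "(cmod d)\<^sup>2 = 1" by simp
  then have d1: "cmod d = 1" by (simp add: abs_square_eq_1)
  have "entry A 1 1 * d = 1" using A c by (simp add: det_cmat2 e)
  then have "cmod (entry A 1 1) = 1" using d1 by (metis mult.right_neutral norm_mult norm_one)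
  moreover have "act g (z, r) = (entry A 1 1 * cnj d * z + entry A 1 2 * cnj d, r)" for z r
    using c d e d1 by (simp add: A mat_act_def Let_def algebra_simps)
  ultimately show ?thesis
    using that[of "entry A 1 1 * cnj d" "entry A 1 2 * cnj d"] d1 by (simp add: norm_mult)
qed

section \<open>Sublattices\<close>

lemma int_subgroup_cyclic:
  fixes K :: "int set"
  assumes add: "\<And>x y. x \<in> K \<Longrightarrow> y \<in> K \<Longrightarrow> x - y \<in> K" and n: "n \<in> K" "n > 0"
  obtains d where "d > 0" "d \<in> K" "\<And>x. x \<in> K \<Longrightarrow> d dvd x"
proof -
  define d where "d = int (LEAST m. m > 0 \<and> int m \<in> K)"
  have ex: "nat n > 0 \<and> int (nat n) \<in> K" using n by simp
  have d: "d > 0" "d \<in> K" using LeastI[where P = "\<lambda>m. m > 0 \<and> int m \<in> K", OF ex] by (auto simp: d_def)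
  have zero: "0 \<in> K" using add[OF n(1) n(1)] by simp
  have mult: "of_nat j * d \<in> K \<and> - (of_nat j * d) \<in> K" for j
  proof (induction j)
    case (Suc j)
    then have "of_nat j * d - (0 - d) \<in> K" "- (of_nat j * d) - d \<in> K"
      using add zero d(2) by blast+
    moreover have "of_nat (Suc j) * d = of_nat j * d - (0 - d)" "- (of_nat (Suc j) * d) = - (of_nat j * d) - d"
      by (simp_all add: algebra_simps)
    ultimately show ?case by (simp only:)
  qed (simp add: zero)
  have mult': "j * d \<in> K" for j using mult[of "nat j"] mult[of "nat (- j)"] by (cases "j \<ge> 0") auto
  have "d dvd x" if "x \<in> K" for x
  proof (rule ccontr)
    assume "\<not> d dvd x"
    then have "x mod d \<noteq> 0" by auto
    then have m: "x mod d > 0" "x mod d < d" using d pos_mod_bound[of d x] pos_mod_sign[of d x] by linarith+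
    have "x - x div d * d \<in> K" by (rule add[OF that mult'])
    then have "x mod d \<in> K" by (simp add: minus_div_mult_eq_mod)
    then have "nat (x mod d) > 0 \<and> int (nat (x mod d)) \<in> K" using m by simp
    then have "(LEAST m. m > 0 \<and> int m \<in> K) \<le> nat (x mod d)" by (rule Least_le)
    then show False using m by (simp add: d_def)
  qed
  with d that show ?thesis by blast
qed

lemma lattice_indep:
  fixes p q :: complex
  assumes basis: "Im (cnj p * q) \<noteq> 0"
    and eq: "of_int m * p + of_int k * q = of_int m' * p + of_int k' * q"
  shows "m = m' \<and> k = k'"
proof -
  have D: "Im (cnj p * q) = Re p * Im q - Im p * Re q" by simp
  have "Re (of_int (m - m') * p + of_int (k - k') * q) = 0" "Im (of_int (m - m') * p + of_int (k - k') * q) = 0"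
    using eq by (simp_all add: complex_eq_iff algebra_simps)
  then have "of_int (m - m') * Re p + of_int (k - k') * Re q = 0" "of_int (m - m') * Im p + of_int (k - k') * Im q = 0"
    by simp_all
  moreover have "of_int (m - m') * Im (cnj p * q)
      = (of_int (m - m') * Re p + of_int (k - k') * Re q) * Im q - (of_int (m - m') * Im p + of_int (k - k') * Im q) * Re q"
    "of_int (k - k') * Im (cnj p * q)
      = (of_int (m - m') * Im p + of_int (k - k') * Im q) * Re p - (of_int (m - m') * Re p + of_int (k - k') * Re q) * Im p"
    unfolding D by (simp_all add: algebra_simps)
  ultimately have "of_int (m - m') * Im (cnj p * q) = 0" "of_int (k - k') * Im (cnj p * q) = 0"
    by simp_all
  then show ?thesis using basis by simp
qed

text \<open>The basis is the Hermite normal form of the generators.\<close>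

lemma finite_index_sublattice_basis:
  fixes A :: "complex set" and p q :: complex and n :: nat
  assumes diff: "\<And>x y. x \<in> A \<Longrightarrow> y \<in> A \<Longrightarrow> x - y \<in> A"
    and sub: "\<And>x. x \<in> A \<Longrightarrow> \<exists>m k. x = of_int m * p + of_int k * q"
    and sup: "of_nat n * p \<in> A" "of_nat n * q \<in> A" "n > 0"
    and basis: "Im (cnj p * q) \<noteq> 0"
  obtains p' q' where "A = {of_int m * p' + of_int k * q' | m k. True}" "Im (cnj p' * q') \<noteq> 0"
proof -
  \<comment> \<open>\<open>K\<close> is the projection of \<open>A\<close> to the coordinate of
    \<open>q\<close>, and \<open>M\<close> its intersection with the multiples of \<open>p\<close>.
    Their generators \<open>d\<close> and \<open>e\<close> become the diagonal of the normal form.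
    Both are nonzero since \<open>n\<close> lies in \<open>K\<close> and in
    \<open>M\<close>.\<close>
  define K where "K = {k. \<exists>m. of_int m * p + of_int k * q \<in> A}"
  define M where "M = {m. of_int m * p \<in> A}"
  have "\<And>x y. x \<in> K \<Longrightarrow> y \<in> K \<Longrightarrow> x - y \<in> K"
  proof -
    fix x y assume "x \<in> K" "y \<in> K"
    then obtain m m' where "of_int m * p + of_int x * q \<in> A" "of_int m' * p + of_int y * q \<in> A" by (auto simp: K_def)
    from diff[OF this] have "of_int (m - m') * p + of_int (x - y) * q \<in> A" by (simp add: algebra_simps)
    then show "x - y \<in> K" unfolding K_def by blast
  qed
  moreover have "int n \<in> K" unfolding K_def using sup by (intro CollectI exI[of _ 0]) simp
  ultimately obtain d where d: "d > 0" "d \<in> K" "\<And>x. x \<in> K \<Longrightarrow> d dvd x"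
    using sup(3) int_subgroup_cyclic by (metis of_nat_0_less_iff)
  have "\<And>x y. x \<in> M \<Longrightarrow> y \<in> M \<Longrightarrow> x - y \<in> M"
    unfolding M_def using diff by (auto simp: left_diff_distrib)
  moreover have "int n \<in> M" unfolding M_def using sup by simp
  ultimately obtain e where e: "e > 0" "e \<in> M" "\<And>x. x \<in> M \<Longrightarrow> e dvd x"
    using sup(3) int_subgroup_cyclic by (metis of_nat_0_less_iff)
  obtain m0 where m0: "of_int m0 * p + of_int d * q \<in> A" using d(2) by (auto simp: K_def)
  define p' q' where "p' = of_int e * p" and "q' = of_int m0 * p + of_int d * q"
  have A: "p' \<in> A" "q' \<in> A" using m0 e(2) by (simp_all add: p'_def q'_def M_def)
  have zero: "0 \<in> A" using diff[OF A(1) A(1)] by simp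
  have neg: "- x \<in> A" if "x \<in> A" for x using diff[OF zero that] by simp
  have add: "x + y \<in> A" if "x \<in> A" "y \<in> A" for x y using diff[OF that(1) neg[OF that(2)]] by simp
  have nmul: "of_nat j * x \<in> A" if "x \<in> A" for j x
    by (induction j) (auto simp: zero add that algebra_simps)
  have mul: "of_int j * x \<in> A" if "x \<in> A" for j x
    using nmul[OF that, of "nat j"] neg[OF nmul[OF that, of "nat (- j)"]] by (cases "j \<ge> 0") auto
  have "A = {of_int m * p' + of_int k * q' | m k. True}"
  proof (intro Set.set_eqI iffI)
    fix x assume x: "x \<in> A"
    then obtain m k where mk: "x = of_int m * p + of_int k * q" using sub by blast
    then have "k \<in> K" using x by (auto simp: K_def)
    then obtain t where t: "k = d * t" using d(3) by blast
    have "x - of_int t * q' \<in> A" by (intro diff x mul A)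
    moreover have "x - of_int t * q' = of_int (m - t * m0) * p" by (simp add: mk t q'_def algebra_simps)
    ultimately have "m - t * m0 \<in> M" by (simp add: M_def)
    then obtain u where "m - t * m0 = e * u" using e(3) by blast
    then have "x = of_int u * p' + of_int t * q'"
      using \<open>x - of_int t * q' = of_int (m - t * m0) * p\<close> by (simp add: p'_def algebra_simps)
    then show "x \<in> {of_int m * p' + of_int k * q' | m k. True}" by blast
  qed (auto intro: add mul A)
  moreover have "Im (cnj p' * q') = of_int (e * d) * Im (cnj p * q)"
    by (simp add: p'_def q'_def algebra_simps)
  then have "Im (cnj p' * q') \<noteq> 0" using e(1) d(1) basis by simp
  ultimately show ?thesis using that by blast
qed

text \<open>The set \<open>A\<close> lies in the lattice of \<open>p / n\<close> and
  \<open>q / n\<close> and contains the \<open>n\<close>-fold multiples of these, so the case of a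
  sublattice applies to this finer lattice.\<close>

lemma finite_index_superlattice_basis:
  fixes A :: "complex set" and p q :: complex and n :: nat
  assumes diff: "\<And>x y. x \<in> A \<Longrightarrow> y \<in> A \<Longrightarrow> x - y \<in> A"
    and sub: "\<And>x. x \<in> A \<Longrightarrow> \<exists>m k. of_nat n * x = of_int m * p + of_int k * q"
    and sup: "p \<in> A" "q \<in> A" "n > 0"
    and basis: "Im (cnj p * q) \<noteq> 0"
  obtains p' q' where "A = {of_int m * p' + of_int k * q' | m k. True}" "Im (cnj p' * q') \<noteq> 0"
proof (rule finite_index_sublattice_basis[where A = A and p = "p / of_nat n" and q = "q / of_nat n" and n = n])
  show "\<exists>m k. x = of_int m * (p / of_nat n) + of_int k * (q / of_nat n)" if x: "x \<in> A" for x
  proof -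
    obtain m k where "of_nat n * x = of_int m * p + of_int k * q" using sub[OF x] by blast
    then have "x = of_int m * (p / of_nat n) + of_int k * (q / of_nat n)"
      using sup(3) by (simp add: field_simps)
    then show ?thesis by blast
  qed
  have "cnj (p / of_nat n) * (q / of_nat n) = cnj p * q / of_real (real (n * n))" by simp
  then show "Im (cnj (p / of_nat n) * (q / of_nat n)) \<noteq> 0"
    using basis sup(3) by (simp only: Im_divide_of_real) simp
qed (use assms that in auto)

lemma iso_free_Abelian_group_rank2:
  fixes f :: "int \<times> int \<Rightarrow> 'a"
  assumes carrier: "carrier G = range f"
    and mult: "\<And>x y. f x \<otimes>\<^bsub>G\<^esub> f y = f (x + y)"
    and inj: "inj f"
  shows "G \<cong> free_Abelian_group {..<2::nat}"
proof -
  define h where "h x = f (Poly_Mapping.lookup x 0, Poly_Mapping.lookup x 1)" for x :: "nat \<Rightarrow>\<^sub>0 int"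
  have "h \<in> iso (free_Abelian_group {..<2}) G"
  proof (rule isoI)
    show "h \<in> hom (free_Abelian_group {..<2}) G"
      by (rule homI) (simp_all add: h_def carrier mult lookup_add)
    show "bij_betw h (carrier (free_Abelian_group {..<2})) (carrier G)"
    proof (rule bij_betw_imageI)
      show "inj_on h (carrier (free_Abelian_group {..<2}))"
      proof (rule inj_onI, rule poly_mapping_eqI)
        fix x y :: "nat \<Rightarrow>\<^sub>0 int" and k
        assume xy: "x \<in> carrier (free_Abelian_group {..<2})" "y \<in> carrier (free_Abelian_group {..<2})" "h x = h y"
        show "Poly_Mapping.lookup x k = Poly_Mapping.lookup y k"
        proof (cases "k < 2")
          case True
          then have "k = 0 \<or> k = 1" by auto
          then show ?thesis using injD[OF inj xy(3)[unfolded h_def]] by auto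
        next
          case False
          then have "k \<notin> Poly_Mapping.keys x" "k \<notin> Poly_Mapping.keys y" using xy by auto
          then show ?thesis by (simp add: in_keys_iff)
        qed
      qed
      show "h ` carrier (free_Abelian_group {..<2}) = carrier G"
      proof (intro equalityI subsetI)
        fix g assume "g \<in> carrier G"
        then obtain m k where g: "g = f (m, k)" by (auto simp: carrier)
        let ?x = "Poly_Mapping.single 0 m + Poly_Mapping.single 1 k :: nat \<Rightarrow>\<^sub>0 int"
        have "Poly_Mapping.keys ?x \<subseteq> {..<2}"
          using Poly_Mapping.keys_add[of "Poly_Mapping.single 0 m" "Poly_Mapping.single (1::nat) k"]
          by (auto split: if_splits)
        moreover have "h ?x = g" by (simp add: h_def g lookup_add lookup_single)
        ultimately show "g \<in> h ` carrier (free_Abelian_group {..<2})" by force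
      qed (auto simp: h_def carrier)
    qed
  qed
  then have "free_Abelian_group {..<2::nat} \<cong> G" by (auto simp: is_iso_def)
  then show ?thesis by (rule group.iso_sym[OF group_free_Abelian_group])
qed

section \<open>Translations at a cusp\<close>

lemma PSL_cancel:
  assumes "x \<in> carrier PSL2C" "y \<in> carrier PSL2C"
  shows "psl_inv x \<otimes>\<^sub>P (x \<otimes>\<^sub>P y) = y" "x \<otimes>\<^sub>P (psl_inv x \<otimes>\<^sub>P y) = y"
  using assms by (simp_all add: PSL.m_assoc[symmetric])

lemmas PSL_word = PSL.m_assoc PSL.inv_mult_group PSL_cancel

definition transl :: "complex \<Rightarrow> psl" where
  "transl b = psl_class (mat2 1 b 0 1)"

lemma transl_in [simp]: "transl b \<in> carrier PSL2C"
  by (simp add: transl_def det_cmat2)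

lemma transl_add: "transl a \<otimes>\<^sub>P transl b = transl (a + b)"
  by (simp add: transl_def psl_class_mult psl_class_eq_iff cmat2_eq_iff entry_mult add.commute)

lemma transl_0: "transl 0 = \<one>\<^bsub>PSL2C\<^esub>"
  by (simp add: transl_def psl_one psl_class_eq_iff cmat2_eq_iff)

lemma transl_inj: "transl a = transl b \<longleftrightarrow> a = b"
  by (auto simp: transl_def psl_class_eq_iff cmat2_eq_iff)

definition conj_transl :: "psl \<Rightarrow> complex \<Rightarrow> psl" where
  "conj_transl B b = psl_inv B \<otimes>\<^sub>P transl b \<otimes>\<^sub>P B"

text \<open>The translations in \<open>G\<close> at the point that \<open>B\<close> sends to
  infinity, in the coordinates of \<open>B\<close>. Nothing is assumed about this point, so
  translations can be compared before it is known to be a cusp.\<close>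

definition transl_set :: "psl set \<Rightarrow> psl \<Rightarrow> complex set" where
  "transl_set G B = {b. conj_transl B b \<in> G}"

context
  fixes B assumes B: "B \<in> carrier PSL2C"
begin

lemma conj_transl_in [simp]: "conj_transl B b \<in> carrier PSL2C"
  using B by (simp add: conj_transl_def)

lemma conj_transl_add: "conj_transl B a \<otimes>\<^sub>P conj_transl B b = conj_transl B (a + b)"
  using B by (simp add: conj_transl_def PSL_word transl_add[symmetric])

lemma conj_transl_0: "conj_transl B 0 = \<one>\<^bsub>PSL2C\<^esub>"
  using B by (simp add: conj_transl_def transl_0)

lemma conj_transl_cancel: "B \<otimes>\<^sub>P conj_transl B b \<otimes>\<^sub>P psl_inv B = transl b"
  using B by (simp add: conj_transl_def PSL_word)

lemma conj_transl_inj: "conj_transl B a = conj_transl B b \<longleftrightarrow> a = b"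
  by (metis conj_transl_cancel transl_inj)

lemma conj_transl_inv: "psl_inv (conj_transl B b) = conj_transl B (- b)"
  by (rule PSL.inv_equality) (simp_all add: conj_transl_add conj_transl_0)

lemma conj_transl_pow: "conj_transl B b [^]\<^bsub>PSL2C\<^esub> (k::nat) = conj_transl B (of_nat k * b)"
  by (induction k) (simp_all add: conj_transl_0 conj_transl_add algebra_simps)

lemma bact_transl: "bact (transl b) None = None"
  by (simp add: transl_def mat_bact_def)

lemma bact_conj_transl: "bact (conj_transl B b) (bact (psl_inv B) None) = bact (psl_inv B) None"
  using B by (simp add: bact_mult[symmetric] conj_transl_def PSL_word)
    (simp add: bact_mult bact_transl)

lemma parabolic_conj_transl: "b \<noteq> 0 \<Longrightarrow> parabolic (conj_transl B b)"
proof -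
  assume b: "b \<noteq> 0"
  obtain R where R: "B = psl_class R" "Determinants.det R = 1" using B by (rule PSL2C_E)
  obtain Y where Y: "psl_inv B = psl_class Y" "Determinants.det Y = 1" using B PSL.inv_closed PSL2C_E by metis
  have "psl_class Y \<otimes>\<^sub>P psl_class R = \<one>\<^bsub>PSL2C\<^esub>"
    using PSL.l_inv[OF B] Y(1) R(1) by metis
  then have "psl_class (Y ** R) = psl_class I2"
    by (simp add: psl_class_mult psl_one)
  \<comment> \<open>The chosen representative \<open>Y\<close> of the inverse class is inverse to
    \<open>R\<close> only up to sign. Hence the trace is 2 either for the product
    \<open>Y ** T ** R\<close> or for its negative, and the class contains both.\<close>
  then have YX: "Y ** R = I2 \<or> Y ** R = - I2" by (simp add: psl_class_eq_iff)
  define T where "T = mat2 1 b 0 1"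
  have "Determinants.trace (Y ** T ** R) = Determinants.trace (R ** Y ** T)"
    by (metis matrix_mul_assoc trace_mul_sym)
  moreover have "R ** Y = I2 \<or> R ** Y = - I2"
    using YX matrix_left_right_inverse[of Y R] matrix_left_right_inverse[of "- Y" R]
    by (metis cmat2_uminus_mult(1) cmat2_uminus_mult(2) minus_minus)
  moreover have "Determinants.trace T = 2" "Determinants.trace (- T) = - 2"
    by (simp_all add: Determinants.trace_def T_def sum_2 flip: entry_def)
  ultimately have "Determinants.trace (Y ** T ** R) = 2 \<or> Determinants.trace (- (Y ** T ** R)) = 2"
    by (auto simp: cmat2_uminus_mult Determinants.trace_def sum_negf)
  moreover have "conj_transl B b = psl_class (Y ** T ** R)"
    by (simp add: conj_transl_def transl_def R Y[unfolded R] psl_class_mult T_def)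
  ultimately have "\<exists>A\<in>conj_transl B b. Determinants.trace A = 2"
    by (auto simp: psl_class_def)
  then show ?thesis using b conj_transl_inj[of b 0] by (simp add: parabolic_def conj_transl_0)
qed

text \<open>Conjugation by \<open>B\<close> moves the fixed point to infinity and makes the matrix
  upper triangular. The diagonal entries then have product 1 and sum 2, so both are 1.\<close>

lemma parabolic_fixing_imp_conj_transl:
  assumes h: "parabolic h" and fixed: "bact h (bact (psl_inv B) None) = bact (psl_inv B) None"
  obtains b where "h = conj_transl B b"
proof -
  have hc: "h \<in> carrier PSL2C" using h by (simp add: parabolic_def)
  obtain A where A: "A \<in> h" "Determinants.trace A = 2" using h by (auto simp: parabolic_def)
  have hA: "h = psl_class A" "Determinants.det A = 1"
    using A hc by (auto elim!: PSL2C_E simp: psl_class_def)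
  obtain R where R: "B = psl_class R" "Determinants.det R = 1" using B by (rule PSL2C_E)
  then have "invertible R" by (simp add: invertible_det_nz)
  then obtain Y where Y: "R ** Y = I2" "Y ** R = I2" by (auto simp: invertible_def)
  have detY: "Determinants.det Y = 1" using Y R by (metis det_I det_mul mult_1)
  have invB: "psl_inv B = psl_class Y"
    by (rule PSL.inv_equality) (simp_all add: R Y detY psl_class_mult psl_one)
  define M where "M = R ** A ** Y"
  have M: "B \<otimes>\<^sub>P h \<otimes>\<^sub>P psl_inv B = psl_class M"
    by (simp add: invB) (simp add: R hA psl_class_mult M_def)
  have "Determinants.det M = 1" by (simp add: M_def det_mul R hA detY)
  moreover have "Determinants.trace M = 2"
    using A(2) by (metis M_def Y(2) matrix_mul_assoc matrix_mul_rid trace_mul_sym)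
  moreover have "mat_bact M None = None"
  proof -
    have "bact (B \<otimes>\<^sub>P h \<otimes>\<^sub>P psl_inv B) None = bact B (bact h (bact (psl_inv B) None))"
      using B hc by (simp add: bact_mult)
    also have "\<dots> = None" using B by (simp add: fixed) (simp add: bact_mult[symmetric])
    finally show ?thesis by (simp add: M)
  qed
  then have c: "entry M 2 1 = 0" by (simp add: mat_bact_def Let_def split: if_splits)
  ultimately have *: "entry M 1 1 * entry M 2 2 = 1" "entry M 1 1 + entry M 2 2 = 2"
    by (simp_all add: det_cmat2 Determinants.trace_def sum_2 flip: entry_def)
  then have "entry M 2 2 = 2 - entry M 1 1" by (simp add: algebra_simps)
  with *(1) have "(entry M 1 1 - 1)\<^sup>2 = 0" by (simp add: power2_eq_square algebra_simps)
  then have "entry M 1 1 = 1" by simp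
  then have "M = mat2 1 (entry M 1 2) 0 1" using *(1) c by (simp add: cmat2_eq_iff)
  then have "B \<otimes>\<^sub>P h \<otimes>\<^sub>P psl_inv B = transl (entry M 1 2)" by (simp add: M transl_def)
  moreover have "psl_inv B \<otimes>\<^sub>P (B \<otimes>\<^sub>P h \<otimes>\<^sub>P psl_inv B) \<otimes>\<^sub>P B = h"
    using B hc by (simp add: PSL_word)
  ultimately have "h = conj_transl B (entry M 1 2)" by (simp add: conj_transl_def)
  then show ?thesis by (rule that)
qed

text \<open>The union that defines \<open>parabolic_stab\<close> has a largest member: each group in
  it consists of conjugated translations, and all conjugated translations in \<open>G\<close>
  together form a torsion-free parabolic group.\<close>

lemma parabolic_stab_eq:
  assumes G: "subgroup G PSL2C"
  shows "parabolic_stab G (bact (psl_inv B) None) = conj_transl B ` transl_set G B"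
proof (intro equalityI subsetI)
  fix h assume "h \<in> parabolic_stab G (bact (psl_inv B) None)"
  then obtain H where H: "h \<in> H" "H \<subseteq> stab G (bact (psl_inv B) None)"
    "h \<noteq> \<one>\<^bsub>PSL2C\<^esub> \<longrightarrow> parabolic h"
    by (auto simp: parabolic_stab_def)
  have "\<exists>b. h = conj_transl B b"
  proof (cases "h = \<one>\<^bsub>PSL2C\<^esub>")
    case True
    then show ?thesis using conj_transl_0 by metis
  next
    case False
    with H have "parabolic h" "bact h (bact (psl_inv B) None) = bact (psl_inv B) None"
      by (auto simp: stab_def)
    then show ?thesis using parabolic_fixing_imp_conj_transl by metis
  qed
  then show "h \<in> conj_transl B ` transl_set G B" using H by (auto simp: transl_set_def stab_def)
next
  fix h assume h: "h \<in> conj_transl B ` transl_set G B"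
  let ?H = "conj_transl B ` transl_set G B"
  have one: "0 \<in> transl_set G B"
    using subgroup.one_closed[OF G] by (simp add: transl_set_def conj_transl_0)
  have "subgroup ?H PSL2C"
  proof (rule PSL.subgroupI)
    fix x assume "x \<in> ?H"
    then obtain a where a: "x = conj_transl B a" "conj_transl B a \<in> G" by (auto simp: transl_set_def)
    have "conj_transl B (- a) \<in> G" using subgroup.m_inv_closed[OF G a(2)] by (simp add: conj_transl_inv)
    then show "psl_inv x \<in> ?H" by (auto simp: a(1) conj_transl_inv transl_set_def)
    fix y assume "y \<in> ?H"
    then obtain b where b: "y = conj_transl B b" "conj_transl B b \<in> G" by (auto simp: transl_set_def)
    have "conj_transl B (a + b) \<in> G"
      using subgroup.m_closed[OF G a(2) b(2)] by (simp add: conj_transl_add)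
    then show "x \<otimes>\<^sub>P y \<in> ?H" by (auto simp: a(1) b(1) conj_transl_add transl_set_def)
  qed (use one in auto)
  moreover have "?H \<subseteq> stab G (bact (psl_inv B) None)"
    by (auto simp: stab_def bact_conj_transl transl_set_def)
  moreover have "parabolic x \<and> (\<forall>k>0. x [^]\<^bsub>PSL2C\<^esub> (k::nat) \<noteq> \<one>\<^bsub>PSL2C\<^esub>)"
    if x: "x \<in> ?H" "x \<noteq> \<one>\<^bsub>PSL2C\<^esub>" for x
  proof -
    obtain a where a: "x = conj_transl B a" using x(1) by blast
    then have "a \<noteq> 0" using x(2) conj_transl_0 by auto
    moreover have "x [^]\<^bsub>PSL2C\<^esub> (k::nat) = \<one>\<^bsub>PSL2C\<^esub> \<longleftrightarrow> of_nat k * a = 0" for k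
      using conj_transl_inj[of "of_nat k * a" 0] by (simp add: a conj_transl_pow conj_transl_0)
    ultimately show ?thesis using parabolic_conj_transl by (simp add: a)
  qed
  ultimately show "h \<in> parabolic_stab G (bact (psl_inv B) None)"
    unfolding parabolic_stab_def using h by blast
qed

text \<open>Recognizes a cusp from its translations alone: a basis parametrizes the parabolic
  stabilizer by pairs of integers, injectively by \<open>lattice_indep\<close>.\<close>

lemma cusp_if_transl_lattice:
  assumes G: "subgroup G PSL2C" and L: "transl_set G B = {of_int m * p + of_int k * q | m k. True}"
    and basis: "Im (cnj p * q) \<noteq> 0"
  shows "cusp G (bact (psl_inv B) None)"
  unfolding cusp_def
proof (rule iso_free_Abelian_group_rank2)
  let ?f = "\<lambda>t. conj_transl B (of_int (fst t) * p + of_int (snd t) * q)"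
  show "carrier (subgrp (parabolic_stab G (bact (psl_inv B) None))) = range ?f"
    unfolding parabolic_stab_eq[OF G] L by (auto intro: range_eqI[of _ _ "(_, _)"])
  show "inj ?f"
    using lattice_indep[OF basis] by (auto simp: inj_def conj_transl_inj prod_eq_iff)
  show "?f x \<otimes>\<^bsub>subgrp (parabolic_stab G (bact (psl_inv B) None))\<^esub> ?f y = ?f (x + y)" for x y
    by (simp add: conj_transl_add algebra_simps)
qed

lemma transl_set_diff:
  assumes G: "subgroup G PSL2C" and ab: "a \<in> transl_set G B" "b \<in> transl_set G B"
  shows "a - b \<in> transl_set G B"
proof -
  have "conj_transl B a \<otimes>\<^sub>P psl_inv (conj_transl B b) \<in> G"
    using ab G by (intro subgroup.m_closed subgroup.m_inv_closed) (auto simp: transl_set_def)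
  then show ?thesis by (simp add: transl_set_def conj_transl_inv conj_transl_add)
qed

end

lemma cusp_data_forD:
  assumes "cusp_data_for G C" "a < num_cusps C"
  shows "cusp G (vertex C a)" (is ?g1) and "chart C a \<in> carrier PSL2C" (is ?g2) and "vertex C a = bact (psl_inv (chart C a)) None" (is ?g3)
    and "scale C a \<noteq> 0" (is ?g4) and "Im (modulus C a) > 0" (is ?g5) and "cusp_rotation (rot C a)" (is ?g6)
    and "(\<lambda>g. chart C a \<otimes>\<^sub>P g \<otimes>\<^sub>P psl_inv (chart C a)) ` parabolic_stab G (vertex C a)
          = {psl_class (mat2 1 b 0 1) | b. b \<in> cusp_lattice C a}" (is ?g7)
    and "(\<lambda>g. chart C a \<otimes>\<^sub>P g \<otimes>\<^sub>P psl_inv (chart C a)) ` stab G (vertex C a)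
          = {psl_class (mat2 \<epsilon> (\<epsilon> * b) 0 (inverse \<epsilon>)) | \<epsilon> b.
               b \<in> cusp_lattice C a \<and> (\<exists>j::nat. \<epsilon> = rot C a ^ j)}" (is ?g8)
proof -
  note * = assms(1)[unfolded cusp_data_for_def]
  note 1 = *[THEN conjunct1, THEN spec, THEN mp, OF assms(2)]
  note 2 = *[THEN conjunct2, THEN conjunct2, THEN spec, THEN mp, OF assms(2)]
  show ?g1 by (rule 1)
  show ?g2 ?g3 ?g4 ?g5 ?g6 ?g7 ?g8 using 2 by - (elim conjE, assumption)+
qed

lemma transl_set_chart:
  assumes G: "subgroup G PSL2C" and C: "cusp_data_for G C" "a < num_cusps C"
  shows "transl_set G (chart C a) = cusp_lattice C a"
proof -
  note D = cusp_data_forD[OF C]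
  have "transl ` transl_set G (chart C a) = transl ` cusp_lattice C a"
    using D(7) unfolding D(3) parabolic_stab_eq[OF D(2) G] image_image conj_transl_cancel[OF D(2)]
    by (auto simp: transl_def)
  then show ?thesis using transl_inj by (meson inj_image_eq_iff injI)
qed

lemma cusp_lattice_basis:
  assumes "cusp_data_for G C" "a < num_cusps C"
  defines "p \<equiv> scale C a" and "q \<equiv> scale C a * modulus C a"
  shows "cusp_lattice C a = {of_int m * p + of_int k * q | m k. True}" "Im (cnj p * q) \<noteq> 0"
proof -
  show "cusp_lattice C a = {of_int m * p + of_int k * q | m k. True}"
    by (simp add: cusp_lattice_def p_def q_def algebra_simps)
  have "cnj p * q = of_real ((cmod p)\<^sup>2) * modulus C a"
    unfolding complex_norm_square by (simp add: p_def q_def)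
  then show "Im (cnj p * q) \<noteq> 0"
    using cusp_data_forD(4,5)[OF assms(1,2)] by (simp add: p_def)
qed

lemma stab_affine:
  assumes C: "cusp_data_for G C" "a < num_cusps C" and G: "subgroup G PSL2C" and d: "\<delta> \<in> stab G (vertex C a)"
  obtains u c where "cmod u = 1"
    "\<And>z r. act (chart C a \<otimes>\<^sub>P \<delta> \<otimes>\<^sub>P psl_inv (chart C a)) (z, r) = (u * z + c, r)"
proof -
  note D = cusp_data_forD[OF C]
  obtain \<epsilon> b j where e: "chart C a \<otimes>\<^sub>P \<delta> \<otimes>\<^sub>P psl_inv (chart C a) = psl_class (mat2 \<epsilon> (\<epsilon> * b) 0 (inverse \<epsilon>))"
    "\<epsilon> = rot C a ^ (j::nat)" using imageI[OF d, of "\<lambda>g. chart C a \<otimes>\<^sub>P g \<otimes>\<^sub>P psl_inv (chart C a)"]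
    unfolding D(8) by blast
  obtain q where q: "q \<in> {1,2,3,4,6::nat}" "((rot C a)\<^sup>2) ^ q = 1" using D(6) unfolding cusp_rotation_def by blast
  have "cmod (rot C a) ^ (2 * q) = 1"
    using q(2) by (metis norm_one norm_power power_mult)
  then have "cmod (rot C a) = 1"
    using q(1) power_eq_imp_eq_base[of "cmod (rot C a)" "2 * q" 1] by auto
  then have "cmod \<epsilon> = 1" by (simp add: e norm_power)
  then show ?thesis using that[of "\<epsilon>\<^sup>2" "\<epsilon>\<^sup>2 * b"] act_upper by (simp add: e(1) norm_power)
qed

text \<open>In the chart the stabilizer acts by Euclidean motions that keep \<open>r\<close>.
  Together with the invariance of the vector this makes the summand of an Eisenstein series depend
  only on the coset.\<close>

lemma stab_height:
  assumes C: "cusp_data_for G C" "a < num_cusps C" and G: "subgroup G PSL2C" and d: "\<delta> \<in> stab G (vertex C a)"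
    and P: "P \<in> H3"
  shows "snd (act (chart C a \<otimes>\<^sub>P \<delta>) P) = snd (act (chart C a) P)"
proof -
  note D = cusp_data_forD[OF C]
  have dc: "\<delta> \<in> carrier PSL2C" using d subgroup.subset[OF G] by (auto simp: stab_def)
  obtain u c where u: "\<And>z r. act (chart C a \<otimes>\<^sub>P \<delta> \<otimes>\<^sub>P psl_inv (chart C a)) (z, r) = (u * z + c, r)"
    using stab_affine[OF C G d] by metis
  have "chart C a \<otimes>\<^sub>P \<delta> = (chart C a \<otimes>\<^sub>P \<delta> \<otimes>\<^sub>P psl_inv (chart C a)) \<otimes>\<^sub>P chart C a"
    using D(2) dc by (simp add: PSL_word)
  then have "act (chart C a \<otimes>\<^sub>P \<delta>) P = act (chart C a \<otimes>\<^sub>P \<delta> \<otimes>\<^sub>P psl_inv (chart C a)) (act (chart C a) P)"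
    using D(2) dc P by (metis act_mult PSL.m_closed PSL.inv_closed)
  then show ?thesis using u by (metis prod.collapse snd_conv)
qed

section \<open>Inner products and unitary representations\<close>

lemma scaleC_zero [simp]: "c *\<^sub>C (0 :: 'a::fd_complex_inner) = 0"
  using scaleC_add_right[of c "0::'a" 0] by simp

lemma scaleC_zero_left [simp]: "0 *\<^sub>C (x :: 'a::fd_complex_inner) = 0"
  using scaleC_of_real[of 0 x] by simp

lemma scaleC_sum_right: "c *\<^sub>C (\<Sum>i\<in>I. f i) = (\<Sum>i\<in>I. c *\<^sub>C (f i :: 'a::fd_complex_inner))"
  by (induction I rule: infinite_finite_induct) (simp_all add: scaleC_add_right)

lemma scaleC_minus_one: "(- 1) *\<^sub>C (x :: 'a::fd_complex_inner) = - x"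
  using scaleC_of_real[of "- 1" x] by simp

lemma cinner_zero_left [simp]: "cinner (0 :: 'a::fd_complex_inner) y = 0"
  using cinner_scaleC_left[of 0 "0::'a" y] by simp

lemma cinner_zero_right [simp]: "cinner (x :: 'a::fd_complex_inner) 0 = 0"
  using cinner_commute[of x "0::'a"] by simp

lemma cinner_add_right: "cinner (x :: 'a::fd_complex_inner) (y + z) = cinner x y + cinner x z"
  using cinner_commute[of x "y + z"] cinner_commute[of x y] cinner_commute[of x z]
  by (simp add: cinner_add_left)

lemma cinner_scaleC_right: "cinner (x :: 'a::fd_complex_inner) (c *\<^sub>C y) = cnj c * cinner x y"
  using cinner_commute[of x "c *\<^sub>C y"] cinner_commute[of x y] by (simp add: cinner_scaleC_left)

lemma cinner_scaleR_left: "cinner (a *\<^sub>R x :: 'a::fd_complex_inner) y = of_real a * cinner x y"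
  by (simp add: cinner_scaleC_left flip: scaleC_of_real)

lemma cinner_minus_left: "cinner (- x :: 'a::fd_complex_inner) y = - cinner x y"
  using cinner_scaleC_left[of "- 1" x y] by (simp add: scaleC_minus_one)

lemma cinner_diff_left: "cinner (x - y :: 'a::fd_complex_inner) z = cinner x z - cinner y z"
  using cinner_add_left[of x "- y" z] by (simp add: cinner_minus_left)

lemma cinner_sum_left: "cinner (\<Sum>i\<in>I. f i :: 'a::fd_complex_inner) y = (\<Sum>i\<in>I. cinner (f i) y)"
  by (induction I rule: infinite_finite_induct) (simp_all add: cinner_add_left)

lemma cinner_sum_right: "cinner (x :: 'a::fd_complex_inner) (\<Sum>i\<in>I. f i) = (\<Sum>i\<in>I. cinner x (f i))"
  by (induction I rule: infinite_finite_induct) (simp_all add: cinner_add_right)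

lemma cinner_eq_zero: "cinner x x = 0 \<Longrightarrow> (x :: 'a::fd_complex_inner) = 0"
  using inner_eq_Re_cinner[of x x] by simp

lemma cinner_ext: "(\<And>y. cinner y u = cinner y v) \<Longrightarrow> (u :: 'a::fd_complex_inner) = v"
proof -
  assume *: "\<And>y. cinner y u = cinner y v"
  have "cinner (u - v) (u - v) = cinner (u - v) u - cinner (u - v) v"
    using cinner_add_right[of "u - v" "u - v" v] by simp
  then show "u = v" using * cinner_eq_zero[of "u - v"] by simp
qed

lemma Im_cinner: "Im (cinner x y) = inner x (\<i> *\<^sub>C y)" for x :: "'a::fd_complex_inner"
  by (simp add: inner_eq_Re_cinner cinner_scaleC_right)

lemma bounded_linear_cinner_left: "bounded_linear (\<lambda>x :: 'a::fd_complex_inner. cinner x y)"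
proof -
  have "cinner x y = of_real (inner x y) + of_real (inner x (\<i> *\<^sub>C y)) * \<i>" for x :: 'a
    by (simp add: complex_eq_iff inner_eq_Re_cinner Im_cinner)
  then show ?thesis
    by (simp only:) (intro bounded_linear_add bounded_linear_mult_const
      bounded_linear_compose[OF bounded_linear_of_real] bounded_linear_inner_left)
qed

lemma norm_scaleC: "norm (c *\<^sub>C x :: 'a::fd_complex_inner) = cmod c * norm x"
proof -
  have "cinner (c *\<^sub>C x) (c *\<^sub>C x) = of_real ((cmod c)\<^sup>2) * cinner x x"
    unfolding complex_norm_square by (simp add: cinner_scaleC_left cinner_scaleC_right)
  then have "(norm (c *\<^sub>C x))\<^sup>2 = (cmod c * norm x)\<^sup>2"
    unfolding power_mult_distrib power2_norm_eq_inner[of "c *\<^sub>C x"] power2_norm_eq_inner[of x]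
    by (simp add: inner_eq_Re_cinner)
  then show ?thesis by (metis mult_nonneg_nonneg norm_ge_zero power2_eq_imp_eq)
qed

lemma orthonormal_basis_expand:
  assumes B: "orthonormal_basis U k w" and u: "u \<in> U"
  shows "u = (\<Sum>l<k. cinner u (w l) *\<^sub>C w l)"
proof -
  obtain c where c: "u = (\<Sum>l<k. c l *\<^sub>C w l)" using B u by (auto simp: orthonormal_basis_def)
  have "cinner u (w m) = c m" if "m < k" for m
  proof -
    have "cinner u (w m) = (\<Sum>l<k. c l * (if l = m then 1 else 0))"
      unfolding c cinner_sum_left using B that
      by (intro sum.cong) (auto simp: cinner_scaleC_left orthonormal_basis_def)
    then show ?thesis using that by (simp add: if_distrib cong: if_cong)
  qed
  then show ?thesis by (subst c) (intro sum.cong, auto)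
qed

lemma orthonormal_basis_cinner:
  "orthonormal_basis U k w \<Longrightarrow> l < k \<Longrightarrow> m < k \<Longrightarrow> cinner (w l) (w m) = (if l = m then 1 else 0)"
  by (simp add: orthonormal_basis_def)

text \<open>Pairing with a vector of \<open>U\<close> makes the projection disappear, so constant
  terms can be studied through inner products. The assumption \<open>sub\<close> provides that
  \<open>U\<close> contains the span of the \<open>w l\<close>, which
  \<open>orthonormal_basis\<close> leaves open.\<close>

lemma orth_proj_cinner:
  assumes B: "orthonormal_basis U k w" and sub: "\<And>c. (\<Sum>l<k. c l *\<^sub>C w l) \<in> U" and u: "u \<in> U"
  shows "cinner (orth_proj U v) u = cinner v u"
proof -
  define p where "p = (\<Sum>l<k. cinner v (w l) *\<^sub>C w l)"
  have pU: "p \<in> U" unfolding p_def by (rule sub)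
  have pw: "cinner (v - p) (w m) = 0" if "m < k" for m
  proof -
    have "cinner p (w m) = (\<Sum>l<k. cinner v (w l) * (if l = m then 1 else 0))"
      unfolding p_def cinner_sum_left using that
      by (intro sum.cong) (auto simp: cinner_scaleC_left orthonormal_basis_cinner[OF B])
    then show ?thesis using that by (simp add: if_distrib cinner_diff_left cong: if_cong)
  qed
  have orth: "cinner (v - p) x = 0" if "x \<in> U" for x
    using orthonormal_basis_expand[OF B that]
    by (metis (no_types, lifting) cinner_scaleC_right cinner_sum_right lessThan_iff mult_zero_right pw sum.neutral)
  have "orth_proj U v = p"
    unfolding orth_proj_def
  proof (rule the_equality)
    fix x assume x: "x \<in> U \<and> (\<forall>u\<in>U. cinner (v - x) u = 0)"
    have "cinner (x - p) y = 0" if "y \<in> U" for y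
      using x orth[OF that] that by (auto simp: cinner_diff_left)
    then have "cinner x y = cinner p y" if "y \<in> U" for y
      using that by (simp add: cinner_diff_left)
    then show "x = p"
      using orthonormal_basis_expand[OF B, of x] orthonormal_basis_expand[OF B pU] x B
      by (metis (no_types, lifting) lessThan_iff orthonormal_basis_def sum.cong)
  qed (use pU orth in auto)
  then show ?thesis using orth[OF u] by (simp add: cinner_diff_left)
qed

lemma unitary_repD:
  assumes "unitary_rep G \<rho>" "g \<in> G"
  shows "\<rho> g (u + v) = \<rho> g u + \<rho> g v" "\<rho> g (c *\<^sub>C v) = c *\<^sub>C \<rho> g v" "bij (\<rho> g)"
    "cinner (\<rho> g u) (\<rho> g v) = cinner u v" "h \<in> G \<Longrightarrow> \<rho> (g \<otimes>\<^sub>P h) v = \<rho> g (\<rho> h v)"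
  using assms by (auto simp: unitary_rep_def)

lemma unitary_rep_bounded_linear:
  assumes "unitary_rep G \<rho>" "g \<in> G"
  shows "bounded_linear (\<rho> g)"
proof (rule bounded_linear_intro[where K = 1])
  show "\<rho> g (a *\<^sub>R v) = a *\<^sub>R \<rho> g v" for a v
    using unitary_repD(2)[OF assms, of "of_real a" v] by (simp add: scaleC_of_real)
  show "norm (\<rho> g v) \<le> norm v * 1" for v
    using unitary_repD(4)[OF assms, of v v] by (simp add: norm_eq_sqrt_inner inner_eq_Re_cinner)
qed (rule unitary_repD(1)[OF assms])

context
  fixes G and \<rho> :: "psl \<Rightarrow> 'a::fd_complex_inner \<Rightarrow> 'a"
  assumes G: "subgroup G PSL2C" and \<rho>: "unitary_rep G \<rho>"
begin

lemma unitary_rep_one: "\<rho> \<one>\<^bsub>PSL2C\<^esub> v = v"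
proof -
  have one: "\<one>\<^bsub>PSL2C\<^esub> \<in> G" by (rule subgroup.one_closed[OF G])
  have "\<rho> \<one>\<^bsub>PSL2C\<^esub> (\<rho> \<one>\<^bsub>PSL2C\<^esub> v) = \<rho> \<one>\<^bsub>PSL2C\<^esub> v"
    using unitary_repD(5)[OF \<rho> one one] by simp
  then show ?thesis using unitary_repD(3)[OF \<rho> one] by (meson bij_is_inj injD)
qed

lemma unitary_rep_inv:
  assumes "g \<in> G"
  shows "\<rho> (psl_inv g) (\<rho> g v) = v" "\<rho> g (\<rho> (psl_inv g) v) = v"
  using unitary_repD(5)[OF \<rho>, of g "psl_inv g"] unitary_repD(5)[OF \<rho>, of "psl_inv g" g]
    subgroup.m_inv_closed[OF G assms] assms subgroup.mem_carrier[OF G assms]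
  by (simp_all add: unitary_rep_one flip: unitary_repD(5)[OF \<rho>])

lemma cadjoint_unitary_rep:
  assumes g: "g \<in> G"
  shows "cadjoint (\<rho> g) = \<rho> (psl_inv g)"
  unfolding cadjoint_def
proof (rule the_equality)
  have gi: "psl_inv g \<in> G" by (rule subgroup.m_inv_closed[OF G g])
  show *: "\<forall>x y. cinner (\<rho> g x) y = cinner x (\<rho> (psl_inv g) y)"
    using unitary_repD(4)[OF \<rho> gi] unitary_rep_inv[OF g] by metis
  fix f assume f: "\<forall>x y. cinner (\<rho> g x) y = cinner x (f y)"
  show "f = \<rho> (psl_inv g)"
    by (rule ext, rule cinner_ext) (use * f in metis)
qed

end

section \<open>The induced representation\<close>

lemma scaleC_vec_nth: "vec_nth (c *\<^sub>C v) i = c *\<^sub>C vec_nth v i"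
  by (simp add: scaleC_vec_def)

lemma cusp_representative_ex1:
  assumes "cusp_data_for G C" "cusp G \<zeta>"
  shows "\<exists>!a. a < num_cusps C \<and> (\<exists>g\<in>G. bact g (vertex C a) = \<zeta>)"
  by (rule assms(1)[unfolded cusp_data_for_def, THEN conjunct2, THEN conjunct1, THEN spec, THEN mp, OF assms(2)])

locale induced_setup =
  fixes \<Gamma> \<Gamma>1 :: "psl set" and chi :: "psl \<Rightarrow> 'v::fd_complex_inner \<Rightarrow> 'v" and \<alpha> :: "'n::finite \<Rightarrow> psl"
  assumes G: "subgroup \<Gamma> PSL2C" and N: "\<Gamma>1 \<lhd> subgrp \<Gamma>"
    and chi: "unitary_rep \<Gamma>1 chi" and reps: "coset_reps \<Gamma> \<Gamma>1 \<alpha>"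
begin

lemma group_G: "group (subgrp \<Gamma>)"
  by (rule subgroup.subgroup_is_group[OF G group_PSL2C])

lemma G1: "subgroup \<Gamma>1 PSL2C"
  by (rule PSL.incl_subgroup[OF G normal_imp_subgroup[OF N]])

lemma G1_sub: "x \<in> \<Gamma>1 \<Longrightarrow> x \<in> \<Gamma>"
  using subgroup.subset[OF normal_imp_subgroup[OF N]] by auto

lemma G_carrier [simp]: "x \<in> \<Gamma> \<Longrightarrow> x \<in> carrier PSL2C"
  by (rule subgroup.mem_carrier[OF G])

lemma G1_carrier [simp]: "x \<in> \<Gamma>1 \<Longrightarrow> x \<in> carrier PSL2C"
  by (rule subgroup.mem_carrier[OF G1])

lemma closed [simp]:
  "x \<in> \<Gamma> \<Longrightarrow> y \<in> \<Gamma> \<Longrightarrow> x \<otimes>\<^sub>P y \<in> \<Gamma>" "x \<in> \<Gamma> \<Longrightarrow> psl_inv x \<in> \<Gamma>" "\<one>\<^bsub>PSL2C\<^esub> \<in> \<Gamma>"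
  "x \<in> \<Gamma>1 \<Longrightarrow> y \<in> \<Gamma>1 \<Longrightarrow> x \<otimes>\<^sub>P y \<in> \<Gamma>1" "x \<in> \<Gamma>1 \<Longrightarrow> psl_inv x \<in> \<Gamma>1" "\<one>\<^bsub>PSL2C\<^esub> \<in> \<Gamma>1"
  using subgroup.m_closed[OF G] subgroup.m_inv_closed[OF G] subgroup.one_closed[OF G]
    subgroup.m_closed[OF G1] subgroup.m_inv_closed[OF G1] subgroup.one_closed[OF G1] by auto

lemma alpha_in [simp]: "\<alpha> i \<in> \<Gamma>"
  using reps by (auto simp: coset_reps_def)

lemma conj_closed:
  assumes "x \<in> \<Gamma>" "h \<in> \<Gamma>1"
  shows "x \<otimes>\<^sub>P h \<otimes>\<^sub>P psl_inv x \<in> \<Gamma>1" "psl_inv x \<otimes>\<^sub>P h \<otimes>\<^sub>P x \<in> \<Gamma>1"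
proof -
  have *: "x \<otimes>\<^sub>P h \<otimes>\<^sub>P psl_inv x \<in> \<Gamma>1" if "x \<in> \<Gamma>" for x
    using normal.inv_op_closed2[OF N _ assms(2), of x] that PSL.m_inv_consistent[OF G that] by simp
  show "x \<otimes>\<^sub>P h \<otimes>\<^sub>P psl_inv x \<in> \<Gamma>1" by (rule *[OF assms(1)])
  show "psl_inv x \<otimes>\<^sub>P h \<otimes>\<^sub>P x \<in> \<Gamma>1" using *[of "psl_inv x"] assms by simp
qed

lemma coset_decomp:
  assumes x: "x \<in> \<Gamma>"
  obtains h j where "h \<in> \<Gamma>1" "x = h \<otimes>\<^sub>P \<alpha> j"
proof -
  have "\<Gamma>1 #>\<^bsub>subgrp \<Gamma>\<^esub> x \<in> rcosets\<^bsub>subgrp \<Gamma>\<^esub> \<Gamma>1"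
    using x by (auto simp: RCOSETS_def)
  then obtain j where "\<Gamma>1 #>\<^bsub>subgrp \<Gamma>\<^esub> x = \<Gamma>1 #>\<^bsub>subgrp \<Gamma>\<^esub> \<alpha> j"
    using reps unfolding coset_reps_def bij_betw_def by (metis (no_types, lifting) imageE)
  moreover have "x \<in> \<Gamma>1 #>\<^bsub>subgrp \<Gamma>\<^esub> x"
    using x by (auto simp: r_coset_def intro!: bexI[of _ "\<one>\<^bsub>PSL2C\<^esub>"])
  ultimately show ?thesis using that by (auto simp: r_coset_def)
qed

lemma coset_decomp_unique:
  assumes h: "h \<in> \<Gamma>1" "h' \<in> \<Gamma>1" and eq: "h \<otimes>\<^sub>P \<alpha> i = h' \<otimes>\<^sub>P \<alpha> j"
  shows "i = j"
proof -
  have "\<Gamma>1 #>\<^bsub>subgrp \<Gamma>\<^esub> \<alpha> i = \<Gamma>1 #>\<^bsub>subgrp \<Gamma>\<^esub> (h \<otimes>\<^sub>P \<alpha> i)" if "h \<in> \<Gamma>1" for h i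
    by (rule group.repr_independence[OF group_G _ _ normal_imp_subgroup[OF N]])
      (use that in \<open>auto simp: r_coset_def\<close>)
  then have "\<Gamma>1 #>\<^bsub>subgrp \<Gamma>\<^esub> \<alpha> i = \<Gamma>1 #>\<^bsub>subgrp \<Gamma>\<^esub> \<alpha> j" using h eq by metis
  then show "i = j" using reps by (auto simp: coset_reps_def bij_betw_def inj_def)
qed

text \<open>A vector of \<open>V\<^sup>n\<close> is the restriction to the representatives of a function on \<open>\<Gamma>\<close> that is
  \<open>\<Gamma>1\<close>-equivariant on the left; \<open>extend\<close> is this function, and on such functions the induced representation
  is right translation.\<close>

definition extend :: "'v ^ 'n \<Rightarrow> psl \<Rightarrow> 'v" where
  "extend w x = (\<Sum>j\<in>UNIV. ext_zero \<Gamma>1 chi (x \<otimes>\<^sub>P psl_inv (\<alpha> j)) (vec_nth w j))"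

abbreviation "psi \<equiv> induced_rep \<Gamma>1 chi \<alpha>"

lemma psi_nth: "vec_nth (psi g w) i = extend w (\<alpha> i \<otimes>\<^sub>P g)"
  by (simp add: induced_rep_def extend_def)

lemma ext_rep:
  assumes h: "h \<in> \<Gamma>1"
  shows "extend w (h \<otimes>\<^sub>P \<alpha> j) = chi h (vec_nth w j)"
proof -
  have "extend w (h \<otimes>\<^sub>P \<alpha> j) = (\<Sum>i\<in>UNIV. if i = j then chi h (vec_nth w j) else 0)"
    unfolding extend_def
  proof (intro sum.cong refl)
    fix i
    have "i = j" if *: "h \<otimes>\<^sub>P \<alpha> j \<otimes>\<^sub>P psl_inv (\<alpha> i) \<in> \<Gamma>1"
      by (rule coset_decomp_unique[OF * h]) (use h in \<open>simp add: PSL_word\<close>)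
    then show "ext_zero \<Gamma>1 chi (h \<otimes>\<^sub>P \<alpha> j \<otimes>\<^sub>P psl_inv (\<alpha> i)) (vec_nth w i)
        = (if i = j then chi h (vec_nth w j) else 0)"
      using h by (auto simp: ext_zero_def PSL_word)
  qed
  then show ?thesis by simp
qed

lemma ext_alpha: "extend w (\<alpha> i) = vec_nth w i"
  using ext_rep[of "\<one>\<^bsub>PSL2C\<^esub>" w i] by (simp add: unitary_rep_one[OF G1 chi])

lemma ext_left:
  assumes "h \<in> \<Gamma>1" "x \<in> \<Gamma>"
  shows "extend w (h \<otimes>\<^sub>P x) = chi h (extend w x)"
proof -
  obtain k j where k: "k \<in> \<Gamma>1" "x = k \<otimes>\<^sub>P \<alpha> j" using coset_decomp[OF assms(2)] .
  have "extend w (h \<otimes>\<^sub>P k \<otimes>\<^sub>P \<alpha> j) = chi h (chi k (vec_nth w j))"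
    using assms k by (simp add: ext_rep unitary_repD(5)[OF chi])
  then show ?thesis using assms k by (simp add: ext_rep PSL.m_assoc)
qed

lemma ext_psi:
  assumes "g \<in> \<Gamma>" "x \<in> \<Gamma>"
  shows "extend (psi g w) x = extend w (x \<otimes>\<^sub>P g)"
proof -
  obtain k j where k: "k \<in> \<Gamma>1" "x = k \<otimes>\<^sub>P \<alpha> j" using coset_decomp[OF assms(2)] .
  have "extend (psi g w) x = chi k (extend w (\<alpha> j \<otimes>\<^sub>P g))" using k by (simp add: ext_rep psi_nth)
  also have "\<dots> = extend w (x \<otimes>\<^sub>P g)" using k assms by (simp add: ext_left PSL.m_assoc flip: ext_left)
  finally show ?thesis .
qed

lemma ext_zero_linear:
  assumes "g \<in> carrier PSL2C"
  shows "ext_zero \<Gamma>1 chi g (u + v) = ext_zero \<Gamma>1 chi g u + ext_zero \<Gamma>1 chi g v"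
    "ext_zero \<Gamma>1 chi g (c *\<^sub>C v) = c *\<^sub>C ext_zero \<Gamma>1 chi g v"
  by (simp_all add: ext_zero_def unitary_repD[OF chi])

lemma ext_add: "x \<in> \<Gamma> \<Longrightarrow> extend (u + v) x = extend u x + extend v x"
  by (simp add: extend_def ext_zero_linear sum.distrib)

lemma ext_scaleC: "x \<in> \<Gamma> \<Longrightarrow> extend (c *\<^sub>C v) x = c *\<^sub>C extend v x"
  by (simp add: extend_def ext_zero_linear scaleC_vec_nth scaleC_sum_right)

lemma ext_sum:
  assumes "x \<in> \<Gamma>"
  shows "extend (\<Sum>i\<in>I. f i) x = (\<Sum>i\<in>I. extend (f i) x)"
proof (induction I rule: infinite_finite_induct)
  have "extend 0 x = 0" using ext_scaleC[OF assms, of 0 0] by simp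
  then show "extend (\<Sum>i\<in>{}. f i) x = (\<Sum>i\<in>{}. extend (f i) x)" by simp
  then show "extend (\<Sum>i\<in>I. f i) x = (\<Sum>i\<in>I. extend (f i) x)" if "infinite I" for I using that by simp
qed (simp add: ext_add[OF assms])

text \<open>Right multiplication by \<open>g\<close> permutes the cosets of
  \<open>\<Gamma>1\<close>, and \<open>F\<close> depends only on the coset. It gives both the
  unitarity of the induced representation and the periodicity of sums over the
  representatives.\<close>

lemma coset_sum_shift:
  fixes F :: "psl \<Rightarrow> 'b::comm_monoid_add"
  assumes inv: "\<And>h x. h \<in> \<Gamma>1 \<Longrightarrow> x \<in> \<Gamma> \<Longrightarrow> F (h \<otimes>\<^sub>P x) = F x" and g: "g \<in> \<Gamma>"
  shows "(\<Sum>i\<in>UNIV. F (\<alpha> i \<otimes>\<^sub>P g)) = (\<Sum>i\<in>UNIV. F (\<alpha> i))"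
proof -
  have "\<exists>h j. h \<in> \<Gamma>1 \<and> \<alpha> i \<otimes>\<^sub>P g = h \<otimes>\<^sub>P \<alpha> j" for i
    using coset_decomp[of "\<alpha> i \<otimes>\<^sub>P g"] g by (metis alpha_in closed(1))
  then obtain h \<sigma> where h: "\<And>i. h i \<in> \<Gamma>1" "\<And>i. \<alpha> i \<otimes>\<^sub>P g = h i \<otimes>\<^sub>P \<alpha> (\<sigma> i)" by metis
  have "inj \<sigma>"
  proof (rule injI)
    fix i j assume "\<sigma> i = \<sigma> j"
    then have "psl_inv (h i) \<otimes>\<^sub>P (\<alpha> i \<otimes>\<^sub>P g) = psl_inv (h j) \<otimes>\<^sub>P (\<alpha> j \<otimes>\<^sub>P g)"
      unfolding h(2) using h(1) by (simp add: PSL_cancel)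
    then have "psl_inv (h i) \<otimes>\<^sub>P \<alpha> i \<otimes>\<^sub>P g = psl_inv (h j) \<otimes>\<^sub>P \<alpha> j \<otimes>\<^sub>P g"
      using h(1) g by (simp add: PSL.m_assoc)
    then have "psl_inv (h i) \<otimes>\<^sub>P \<alpha> i = psl_inv (h j) \<otimes>\<^sub>P \<alpha> j"
      using h(1) g by (simp add: PSL.r_cancel)
    then show "i = j" using h(1) coset_decomp_unique[of "psl_inv (h i)" "psl_inv (h j)" i j] by simp
  qed
  then have "bij \<sigma>" by (simp add: bij_def finite_UNIV_inj_surj)
  have "(\<Sum>i\<in>UNIV. F (\<alpha> i \<otimes>\<^sub>P g)) = (\<Sum>i\<in>UNIV. F (\<alpha> (\<sigma> i)))"
    using h by (simp add: inv)
  also have "\<dots> = (\<Sum>i\<in>UNIV. F (\<alpha> i))" by (rule sum.reindex_bij_betw[OF \<open>bij \<sigma>\<close>])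
  finally show ?thesis .
qed

text \<open>The inner product of \<open>V\<^sup>n\<close> is the sum over the cosets of the inner
  products of the values of \<open>extend\<close>. These are constant on cosets because
  \<open>chi\<close> is unitary, so a right translation only permutes the summands.\<close>

lemma unitary_psi: "unitary_rep \<Gamma> psi"
proof -
  have psi_mult: "psi (g \<otimes>\<^sub>P h) w = psi g (psi h w)" if "g \<in> \<Gamma>" "h \<in> \<Gamma>" for g h w
    using that by (simp add: vec_eq_iff psi_nth ext_psi PSL.m_assoc)
  have one: "psi \<one>\<^bsub>PSL2C\<^esub> w = w" for w
    by (simp add: vec_eq_iff psi_nth ext_alpha)
  have "bij (psi g)" if "g \<in> \<Gamma>" for g
  proof (rule o_bij)
    show "psi (psl_inv g) \<circ> psi g = id" "psi g \<circ> psi (psl_inv g) = id"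
      using that by (simp_all add: fun_eq_iff one flip: psi_mult)
  qed
  moreover have "cinner (psi g u) (psi g v) = cinner u v" if "g \<in> \<Gamma>" for g u v
    using coset_sum_shift[of "\<lambda>x. cinner (extend u x) (extend v x)" g] that
    by (simp add: cinner_vec_def psi_nth ext_alpha ext_left unitary_repD(4)[OF chi])
  ultimately show ?thesis
    unfolding unitary_rep_def
    by (auto simp: vec_eq_iff psi_nth ext_add ext_scaleC scaleC_vec_nth psi_mult fun_eq_iff)
qed

definition index :: nat where
  "index = order (subgrp \<Gamma> Mod \<Gamma>1)"

lemma index_pos: "index > 0"
proof -
  interpret Q: group "subgrp \<Gamma> Mod \<Gamma>1" by (rule normal.factorgroup_is_group[OF N])
  have "finite (carrier (subgrp \<Gamma> Mod \<Gamma>1))"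
    using reps by (auto simp: FactGroup_def coset_reps_def bij_betw_def dest: arg_cong[of _ _ finite])
  then show ?thesis by (simp add: index_def Q.order_gt_0_iff_finite)
qed

text \<open>In the quotient group every element to the power of the group order is trivial. This is
  what makes the two lattices at a boundary point commensurable, with the same factor
  \<open>index\<close> everywhere.\<close>

lemma pow_index:
  assumes x: "x \<in> \<Gamma>"
  shows "x [^]\<^bsub>PSL2C\<^esub> index \<in> \<Gamma>1"
proof -
  interpret Q: group "subgrp \<Gamma> Mod \<Gamma>1" by (rule normal.factorgroup_is_group[OF N])
  let ?c = "\<lambda>x. \<Gamma>1 #>\<^bsub>subgrp \<Gamma>\<^esub> x"
  have pow: "?c (x [^]\<^bsub>PSL2C\<^esub> k) = ?c x [^]\<^bsub>subgrp \<Gamma> Mod \<Gamma>1\<^esub> k \<and> x [^]\<^bsub>PSL2C\<^esub> k \<in> \<Gamma>" for k :: nat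
  proof (induction k)
    case (Suc k)
    then show ?case using normal.rcos_sum[OF N, of "x [^]\<^bsub>PSL2C\<^esub> k" x] x by simp
  qed (use subgroup.subset[OF G1] in \<open>simp add: PSL.coset_mult_one\<close>)
  have "?c x \<in> carrier (subgrp \<Gamma> Mod \<Gamma>1)" using x by (auto simp: FactGroup_def RCOSETS_def)
  then have "?c (x [^]\<^bsub>PSL2C\<^esub> index) = \<Gamma>1"
    using pow[of index] Q.pow_order_eq_1 by (simp add: index_def)
  moreover have "x [^]\<^bsub>PSL2C\<^esub> index \<in> ?c (x [^]\<^bsub>PSL2C\<^esub> index)"
    using pow[of index] by (auto simp: r_coset_def intro!: bexI[of _ "\<one>\<^bsub>PSL2C\<^esub>"])
  ultimately show ?thesis by simp
qed

lemma index_transl: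
  assumes "B \<in> carrier PSL2C" "b \<in> transl_set \<Gamma> B"
  shows "of_nat index * b \<in> transl_set \<Gamma>1 B"
  using pow_index[of "conj_transl B b"] assms by (simp add: transl_set_def conj_transl_pow)

lemma transl_set_mono: "transl_set \<Gamma>1 B \<subseteq> transl_set \<Gamma> B"
  by (auto simp: transl_set_def G1_sub)

end

section \<open>Cusps of a normal subgroup of finite index\<close>

locale induced_cusps = induced_setup +
  fixes C C1 :: cusp_data
  assumes C: "cusp_data_for \<Gamma> C" and C1: "cusp_data_for \<Gamma>1 C1"
    and compat: "compatible_charts \<Gamma> C C1"
begin

text \<open>The translations of \<open>\<Gamma>\<close> at this point contain the lattice of
  \<open>\<Gamma>1\<close>, and multiplication by \<open>index\<close> maps them into it; so they
  form a lattice too.\<close>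

lemma vertex1_cusp:
  assumes b: "b < num_cusps C1"
  shows "cusp \<Gamma> (vertex C1 b)"
proof -
  note D = cusp_data_forD[OF C1 b]
  let ?p = "scale C1 b" and ?q = "scale C1 b * modulus C1 b"
  note L = transl_set_chart[OF G1 C1 b] cusp_lattice_basis[OF C1 b]
  obtain p' q' where "transl_set \<Gamma> (chart C1 b) = {of_int m * p' + of_int k * q' | m k. True}" "Im (cnj p' * q') \<noteq> 0"
  proof (rule finite_index_superlattice_basis[where A = "transl_set \<Gamma> (chart C1 b)" and p = ?p and q = ?q and n = index])
    show "\<exists>m k. of_nat index * x = of_int m * ?p + of_int k * ?q" if "x \<in> transl_set \<Gamma> (chart C1 b)" for x
      using index_transl[OF D(2) that] unfolding L by blast
    have "?p \<in> transl_set \<Gamma>1 (chart C1 b)"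
      unfolding L by (intro CollectI exI[of _ 1] exI[of _ 0]) simp
    then show "?p \<in> transl_set \<Gamma> (chart C1 b)" using transl_set_mono by blast
    have "?q \<in> transl_set \<Gamma>1 (chart C1 b)"
      unfolding L by (intro CollectI exI[of _ 1] exI[of _ 0]) simp
    then show "?q \<in> transl_set \<Gamma> (chart C1 b)" using transl_set_mono by blast
  qed (use transl_set_diff[OF D(2) G] index_pos L in auto)
  then show ?thesis unfolding D(3) by (rule cusp_if_transl_lattice[OF D(2) G])
qed

text \<open>The chart at \<open>a\<close>, preceded by the inverse of \<open>x\<close>, is a chart
  at the translated point, and in it \<open>\<Gamma>\<close> has the same lattice as at
  \<open>a\<close>. The translations of \<open>\<Gamma>1\<close> form a subgroup that contains the
  multiples by \<open>index\<close>.\<close>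

lemma cusp_translate:
  assumes a: "a < num_cusps C" and x: "x \<in> \<Gamma>"
  shows "cusp \<Gamma>1 (bact x (vertex C a))"
proof -
  note D = cusp_data_forD[OF C a]
  let ?B = "chart C a \<otimes>\<^sub>P psl_inv x"
  let ?p = "scale C a" and ?q = "scale C a * modulus C a"
  note L = transl_set_chart[OF G C a] cusp_lattice_basis[OF C a]
  have B: "?B \<in> carrier PSL2C" using D(2) x by simp
  have pt: "bact (psl_inv ?B) None = bact x (vertex C a)"
    using D(2) x by (simp add: D(3) PSL.inv_mult_group bact_mult)
  have ct: "conj_transl ?B b = x \<otimes>\<^sub>P conj_transl (chart C a) b \<otimes>\<^sub>P psl_inv x" for b
    using D(2) x by (simp add: conj_transl_def PSL_word)
  have "conj_transl (chart C a) b = psl_inv x \<otimes>\<^sub>P conj_transl ?B b \<otimes>\<^sub>P x" for b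
    using D(2) x by (simp add: conj_transl_def PSL_word)
  then have "transl_set \<Gamma> ?B = transl_set \<Gamma> (chart C a)"
    using x unfolding transl_set_def by (metis ct closed(1,2))
  note L' = this[unfolded L]
  obtain p' q' where "transl_set \<Gamma>1 ?B = {of_int m * p' + of_int k * q' | m k. True}" "Im (cnj p' * q') \<noteq> 0"
  proof (rule finite_index_sublattice_basis[where A = "transl_set \<Gamma>1 ?B" and p = ?p and q = ?q and n = index])
    show "\<exists>m k. y = of_int m * ?p + of_int k * ?q" if "y \<in> transl_set \<Gamma>1 ?B" for y
    proof -
      have "y \<in> transl_set \<Gamma> ?B" using transl_set_mono that by blast
      then show ?thesis unfolding L' by blast
    qed
    have "?p \<in> transl_set \<Gamma> ?B"
      unfolding L' by (intro CollectI exI[of _ 1] exI[of _ 0]) simp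
    then show "of_nat index * ?p \<in> transl_set \<Gamma>1 ?B" by (rule index_transl[OF B])
    have "?q \<in> transl_set \<Gamma> ?B"
      unfolding L' by (intro CollectI exI[of _ 1] exI[of _ 0]) simp
    then show "of_nat index * ?q \<in> transl_set \<Gamma>1 ?B" by (rule index_transl[OF B])
  qed (use transl_set_diff[OF B G1] index_pos L in auto)
  then have "cusp \<Gamma>1 (bact (psl_inv ?B) None)" by (rule cusp_if_transl_lattice[OF B G1])
  then show ?thesis by (simp add: pt)
qed

lemma below_ex1:
  assumes "b < num_cusps C1"
  shows "\<exists>!a. a < num_cusps C \<and> (\<exists>g\<in>\<Gamma>. bact g (vertex C a) = vertex C1 b)"
  by (rule cusp_representative_ex1[OF C vertex1_cusp[OF assms]])

definition below :: "nat \<Rightarrow> nat" where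
  "below b = (THE a. a < num_cusps C \<and> (\<exists>g\<in>\<Gamma>. bact g (vertex C a) = vertex C1 b))"

text \<open>The element \<open>\<gamma>\<^sub>b\<close> of the overview. Another choice differs from
  it on the left by an element of the stabilizer of the cusp below, which does not affect values of
  \<open>extend\<close> at vectors fixed by that stabilizer.\<close>

definition gam :: "nat \<Rightarrow> psl" where
  "gam b = (SOME g. g \<in> \<Gamma> \<and> bact g (vertex C1 b) = vertex C (below b))"

context
  fixes b assumes b: "b < num_cusps C1"
begin

lemma below_less: "below b < num_cusps C"
  using theI'[OF below_ex1[OF b]] by (simp add: below_def)

lemma below_eq:
  assumes "a < num_cusps C" "g \<in> \<Gamma>" "bact g (vertex C1 b) = vertex C a"
  shows "a = below b"
proof -
  have "bact (psl_inv g) (vertex C a) = vertex C1 b" using assms by (simp add: bact_inv_iff)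
  then have "\<exists>g\<in>\<Gamma>. bact g (vertex C a) = vertex C1 b" using assms(2) closed(2) by blast
  with assms(1) have "below b = a"
    unfolding below_def by (intro the1_equality[OF below_ex1[OF b]]) simp
  then show ?thesis by simp
qed

lemma gam: "gam b \<in> \<Gamma>" "bact (gam b) (vertex C1 b) = vertex C (below b)"
proof -
  obtain g where g: "g \<in> \<Gamma>" "bact g (vertex C (below b)) = vertex C1 b"
    using theI'[OF below_ex1[OF b]] by (auto simp: below_def)
  then have "bact (psl_inv g) (vertex C1 b) = vertex C (below b)" by (simp add: bact_inv_iff)
  then have "psl_inv g \<in> \<Gamma> \<and> bact (psl_inv g) (vertex C1 b) = vertex C (below b)" using g by simp
  then have "gam b \<in> \<Gamma> \<and> bact (gam b) (vertex C1 b) = vertex C (below b)" unfolding gam_def by (rule someI)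
  then show "gam b \<in> \<Gamma>" "bact (gam b) (vertex C1 b) = vertex C (below b)" by auto
qed

lemma gam_inv: "bact (psl_inv (gam b)) (vertex C (below b)) = vertex C1 b"
  using gam by (simp add: bact_inv_iff)

lemma stab_conj_gam:
  assumes "h \<in> stab \<Gamma>1 (vertex C1 b)"
  shows "gam b \<otimes>\<^sub>P h \<otimes>\<^sub>P psl_inv (gam b) \<in> stab \<Gamma> (vertex C (below b))"
  using assms gam by (auto simp: stab_def bact_mult G1_sub gam_inv)

lemma stab_conj_gam':
  assumes "\<delta> \<in> stab \<Gamma> (vertex C (below b))" "psl_inv (gam b) \<otimes>\<^sub>P \<delta> \<otimes>\<^sub>P gam b \<in> \<Gamma>1"
  shows "psl_inv (gam b) \<otimes>\<^sub>P \<delta> \<otimes>\<^sub>P gam b \<in> stab \<Gamma>1 (vertex C1 b)"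
  using assms gam by (auto simp: stab_def bact_mult bact_inv_iff)

lemma compat_height:
  assumes P: "P \<in> H3"
  shows "snd (act (chart C1 b) P) = snd (act (chart C (below b) \<otimes>\<^sub>P gam b) P)"
  using compat below_less b gam P unfolding compatible_charts_def by blast

text \<open>By compatibility the transition map between the two charts preserves all heights, so
  \<open>height_preserving_affine\<close> makes it a Euclidean motion.\<close>

lemma chart_change:
  obtains u c where "cmod u = 1"
    "\<And>z r. r > 0 \<Longrightarrow> act (psl_inv (gam b) \<otimes>\<^sub>P psl_inv (chart C (below b))) (z, r) = act (psl_inv (chart C1 b)) (u * z + c, r)"
proof -
  note D = cusp_data_forD(2)[OF C below_less] and D1 = cusp_data_forD(2)[OF C1 b]
  let ?T = "chart C1 b \<otimes>\<^sub>P (psl_inv (gam b) \<otimes>\<^sub>P psl_inv (chart C (below b)))"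
  have T: "?T \<in> carrier PSL2C" using D D1 gam by simp
  have "snd (act ?T P) = snd P" if P: "P \<in> H3" for P
  proof -
    let ?Q = "act (psl_inv (gam b) \<otimes>\<^sub>P psl_inv (chart C (below b))) P"
    have Q: "?Q \<in> H3" using P D gam by simp
    have "snd (act ?T P) = snd (act (chart C1 b) ?Q)"
      using P D D1 gam by (subst act_mult) auto
    also have "\<dots> = snd (act (chart C (below b) \<otimes>\<^sub>P gam b) ?Q)" by (rule compat_height[OF Q])
    also have "\<dots> = snd (act (chart C (below b) \<otimes>\<^sub>P gam b \<otimes>\<^sub>P (psl_inv (gam b) \<otimes>\<^sub>P psl_inv (chart C (below b)))) P)"
      using P D gam by (subst act_mult[symmetric]) auto
    also have "\<dots> = snd P" using D gam by (simp add: PSL_word)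
    finally show ?thesis .
  qed
  then obtain u c where u: "cmod u = 1" "\<And>z r. r > 0 \<Longrightarrow> act ?T (z, r) = (u * z + c, r)"
    using height_preserving_affine[OF T] by blast
  have "act (psl_inv (gam b) \<otimes>\<^sub>P psl_inv (chart C (below b))) (z, r) = act (psl_inv (chart C1 b)) (u * z + c, r)"
    if r: "r > 0" for z r
  proof -
    have "psl_inv (gam b) \<otimes>\<^sub>P psl_inv (chart C (below b)) = psl_inv (chart C1 b) \<otimes>\<^sub>P ?T"
      using D D1 gam by (simp add: PSL_cancel)
    then have "act (psl_inv (gam b) \<otimes>\<^sub>P psl_inv (chart C (below b))) (z, r) = act (psl_inv (chart C1 b)) (act ?T (z, r))"
      using r D1 T by (simp add: H3_def flip: act_mult)
    then show ?thesis using u(2)[OF r] by simp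
  qed
  then show ?thesis using u(1) that by blast
qed

end

text \<open>The point \<open>x\<close> sends the vertex of \<open>a\<close> to is a cusp of
  \<open>\<Gamma>1\<close>, hence the image of some representative \<open>b\<close> under some
  \<open>h\<close> in \<open>\<Gamma>1\<close>. What remains of \<open>x\<close> after
  \<open>h\<close> and the inverse of \<open>gam b\<close> fixes the vertex.\<close>

lemma double_coset:
  assumes a: "a < num_cusps C" and x: "x \<in> \<Gamma>"
  obtains b h \<delta> where "b < num_cusps C1" "below b = a" "h \<in> \<Gamma>1" "\<delta> \<in> stab \<Gamma> (vertex C a)"
    "x = h \<otimes>\<^sub>P psl_inv (gam b) \<otimes>\<^sub>P \<delta>"
proof -
  obtain b g where b: "b < num_cusps C1" and g: "g \<in> \<Gamma>1" "bact g (vertex C1 b) = bact x (vertex C a)"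
    using cusp_representative_ex1[OF C1 cusp_translate[OF assms]] by blast
  note gG = G1_sub[OF g(1)]
  have "bact (psl_inv x \<otimes>\<^sub>P g) (vertex C1 b) = vertex C a"
    using x gG g(2) by (simp add: bact_mult bact_inv_iff)
  then have ov: "below b = a" using below_eq[OF b a] x gG by (metis closed(1,2))
  note gm = gam[OF b]
  let ?d = "gam b \<otimes>\<^sub>P psl_inv g \<otimes>\<^sub>P x"
  have "bact (psl_inv g) (bact x (vertex C a)) = vertex C1 b" using gG g(2) by (simp add: bact_inv_iff)
  then have "?d \<in> stab \<Gamma> (vertex C a)"
    using x gG gm ov by (simp add: stab_def bact_mult)
  moreover have "x = g \<otimes>\<^sub>P psl_inv (gam b) \<otimes>\<^sub>P ?d" using x gG gm by (simp add: PSL_word)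
  ultimately show ?thesis using that b ov g(1) by blast
qed

text \<open>Such a product sends the vertex of the cusp below to a point of the
  \<open>\<Gamma>1\<close>-class of \<open>b\<close>, so it determines this class, and
  representatives of different classes are inequivalent.\<close>

lemma double_coset_unique:
  assumes b: "b < num_cusps C1" "b' < num_cusps C1" and h: "h \<in> \<Gamma>1" "h' \<in> \<Gamma>1"
    and d: "\<delta> \<in> stab \<Gamma> (vertex C (below b))" "\<delta>' \<in> stab \<Gamma> (vertex C (below b'))"
    and eq: "below b = below b'" "h \<otimes>\<^sub>P psl_inv (gam b) \<otimes>\<^sub>P \<delta> = h' \<otimes>\<^sub>P psl_inv (gam b') \<otimes>\<^sub>P \<delta>'"
  shows "b = b'"
proof -
  have *: "bact (h \<otimes>\<^sub>P psl_inv (gam b) \<otimes>\<^sub>P \<delta>) (vertex C (below b)) = bact h (vertex C1 b)"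
    if "b < num_cusps C1" "h \<in> \<Gamma>1" "\<delta> \<in> stab \<Gamma> (vertex C (below b))" for b h \<delta>
    using that gam[OF that(1)] by (simp add: stab_def bact_mult gam_inv)
  have "bact h (vertex C1 b) = bact h' (vertex C1 b')"
    using *[OF b(1) h(1) d(1)] *[OF b(2) h(2) d(2)] eq by simp
  then have "bact (psl_inv h \<otimes>\<^sub>P h') (vertex C1 b') = vertex C1 b"
    using h by (simp add: bact_mult bact_inv_iff)
  then have "\<exists>g\<in>\<Gamma>1. bact g (vertex C1 b') = vertex C1 b" using h by (metis closed(4,5))
  moreover have "\<exists>g\<in>\<Gamma>1. bact g (vertex C1 b) = vertex C1 b" using closed(6) bact_one by blast
  ultimately show ?thesis
    using cusp_representative_ex1[OF C1 cusp_data_forD(1)[OF C1 b(1)]] b by blast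
qed

section \<open>Fixed vectors of the induced representation and their components\<close>

abbreviation "FS a \<equiv> fixed_space \<Gamma> C psi a"
abbreviation "FS1 b \<equiv> fixed_space \<Gamma>1 C1 chi b"

lemma ext_fixed:
  assumes w: "w \<in> FS a" and d: "\<delta> \<in> stab \<Gamma> (vertex C a)" and x: "x \<in> \<Gamma>"
  shows "extend w (x \<otimes>\<^sub>P \<delta>) = extend w x"
proof -
  have "psi \<delta> w = w" using w d by (simp add: fixed_space_def)
  then show ?thesis using ext_psi[OF _ x, of \<delta> w] d by (simp add: stab_def)
qed

definition component :: "nat \<Rightarrow> 'a ^ 'b \<Rightarrow> 'a" where
  "component b w = extend w (psl_inv (gam b))"

text \<open>Moved to the right of the inverse of \<open>gam b\<close>, an element of the stabilizer
  in \<open>\<Gamma>1\<close> becomes an element of the stabilizer of the cusp below, and that one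
  fixes \<open>w\<close>.\<close>

lemma component_fixed:
  assumes b: "b < num_cusps C1" and w: "w \<in> FS (below b)"
  shows "component b w \<in> FS1 b"
  unfolding fixed_space_def
proof (intro CollectI ballI)
  fix h assume h: "h \<in> stab \<Gamma>1 (vertex C1 b)"
  then have h1: "h \<in> \<Gamma>1" by (simp add: stab_def)
  note gm = gam[OF b]
  have "chi h (component b w) = extend w (h \<otimes>\<^sub>P psl_inv (gam b))"
    unfolding component_def using gm h1 by (simp add: ext_left)
  also have "h \<otimes>\<^sub>P psl_inv (gam b) = psl_inv (gam b) \<otimes>\<^sub>P (gam b \<otimes>\<^sub>P h \<otimes>\<^sub>P psl_inv (gam b))"
    using gm h1 by (simp add: PSL_word)
  also have "extend w \<dots> = component b w"
    unfolding component_def by (rule ext_fixed[OF w stab_conj_gam[OF b h]]) (use gm in simp)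
  finally show "chi h (component b w) = component b w" .
qed

text \<open>The lift is the function \<open>L\<close> supported on the double coset of
  \<open>b\<close>, with the value \<open>chi h v\<close> at the product of \<open>h\<close>, the
  inverse of \<open>gam b\<close>, and an element of the stabilizer. It is equivariant on the left
  and invariant under the stabilizer on the right. The other double cosets over the same cusp are
  disjoint from this one, which gives the zeros.\<close>

lemma lift_exists:
  assumes b: "b < num_cusps C1" and v: "v \<in> FS1 b"
  obtains w where "w \<in> FS (below b)"
    "\<And>b'. b' < num_cusps C1 \<Longrightarrow> below b' = below b \<Longrightarrow> component b' w = (if b' = b then v else 0)"
proof -
  note gm = gam[OF b]
  let ?S = "stab \<Gamma> (vertex C (below b))"
  have S_closed: "\<delta> \<otimes>\<^sub>P \<delta>' \<in> ?S" "psl_inv \<delta> \<in> ?S" if "\<delta> \<in> ?S" "\<delta>' \<in> ?S" for \<delta> \<delta>'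
    using that by (auto simp: stab_def bact_mult bact_inv_iff)
  define P where "P x h \<longleftrightarrow> h \<in> \<Gamma>1 \<and> (\<exists>\<delta>\<in>?S. x = h \<otimes>\<^sub>P psl_inv (gam b) \<otimes>\<^sub>P \<delta>)" for x h
  define L where "L x = (if \<exists>h. P x h then chi (SOME h. P x h) v else 0)" for x
  have well: "chi h v = chi h' v" if hh: "P x h" "P x h'" for x h h'
  proof -
    obtain \<delta> \<delta>' where d: "\<delta> \<in> ?S" "\<delta>' \<in> ?S" "x = h \<otimes>\<^sub>P psl_inv (gam b) \<otimes>\<^sub>P \<delta>" "x = h' \<otimes>\<^sub>P psl_inv (gam b) \<otimes>\<^sub>P \<delta>'"
      and h: "h \<in> \<Gamma>1" "h' \<in> \<Gamma>1" using hh by (auto simp: P_def)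
    have dG: "\<delta> \<in> \<Gamma>" "\<delta>' \<in> \<Gamma>" using d by (auto simp: stab_def)
    \<comment> \<open>Two decompositions of the same element differ by \<open>?k\<close>, which is
      both in \<open>\<Gamma>1\<close> and conjugate by \<open>gam b\<close> into the stabilizer
      below. So it stabilizes the cusp \<open>b\<close> in \<open>\<Gamma>1\<close> and fixes
      \<open>v\<close>.\<close>
    let ?k = "psl_inv h' \<otimes>\<^sub>P h"
    have "?k = psl_inv h' \<otimes>\<^sub>P (h \<otimes>\<^sub>P psl_inv (gam b) \<otimes>\<^sub>P \<delta>) \<otimes>\<^sub>P psl_inv \<delta> \<otimes>\<^sub>P gam b"
      using h dG gm by (simp add: PSL_word)
    also have "\<dots> = psl_inv (gam b) \<otimes>\<^sub>P (\<delta>' \<otimes>\<^sub>P psl_inv \<delta>) \<otimes>\<^sub>P gam b"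
      unfolding d(3)[symmetric] unfolding d(4) using h dG gm by (simp add: PSL_word)
    finally have k: "?k = psl_inv (gam b) \<otimes>\<^sub>P (\<delta>' \<otimes>\<^sub>P psl_inv \<delta>) \<otimes>\<^sub>P gam b" .
    have "?k \<in> \<Gamma>1" using h by simp
    then have "?k \<in> stab \<Gamma>1 (vertex C1 b)"
      unfolding k using S_closed d by (intro stab_conj_gam'[OF b]) auto
    then have "chi ?k v = v" using v by (simp add: fixed_space_def)
    then have "chi h' (chi ?k v) = chi h' v" by simp
    then have "chi (h' \<otimes>\<^sub>P ?k) v = chi h' v" using h by (simp add: unitary_repD(5)[OF chi])
    then show ?thesis using h by (simp add: PSL_word)
  qed
  have L_eq: "L x = chi h v" if "P x h" for x h
    using that someI[of "P x" h] well unfolding L_def by (metis (mono_tags, lifting))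
  have P_left: "P (k \<otimes>\<^sub>P x) (k \<otimes>\<^sub>P h)" if "P x h" "k \<in> \<Gamma>1" for k x h
    using that gm unfolding P_def
    by (auto simp: PSL.m_assoc stab_def intro!: bexI)
  have L_left: "L (k \<otimes>\<^sub>P x) = chi k (L x)" if k: "k \<in> \<Gamma>1" and x: "x \<in> \<Gamma>" for k x
  proof (cases "\<exists>h. P x h")
    case True
    then obtain h where h: "P x h" by blast
    then have "L (k \<otimes>\<^sub>P x) = chi (k \<otimes>\<^sub>P h) v" using P_left[OF h k] L_eq by blast
    also have "\<dots> = chi k (chi h v)" using h k by (simp add: P_def unitary_repD(5)[OF chi])
    finally show ?thesis using L_eq[OF h] by simp
  next
    case False
    have "\<not> P (k \<otimes>\<^sub>P x) h" for h
      using P_left[of "k \<otimes>\<^sub>P x" h "psl_inv k"] False k x by (auto simp: PSL_cancel)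
    moreover have "chi k 0 = 0" using unitary_repD(2)[OF chi k, of 0 0] by simp
    ultimately show ?thesis using False by (simp add: L_def)
  qed
  have P_right: "P (x \<otimes>\<^sub>P \<delta>) h" if P: "P x h" "\<delta> \<in> ?S" for x h \<delta>
  proof -
    obtain \<delta>' where d: "h \<in> \<Gamma>1" "\<delta>' \<in> ?S" "x = h \<otimes>\<^sub>P psl_inv (gam b) \<otimes>\<^sub>P \<delta>'" using P(1) by (auto simp: P_def)
    have "\<delta> \<in> \<Gamma>" "\<delta>' \<in> \<Gamma>" using d P(2) by (auto simp: stab_def)
    then have "x \<otimes>\<^sub>P \<delta> = h \<otimes>\<^sub>P psl_inv (gam b) \<otimes>\<^sub>P (\<delta>' \<otimes>\<^sub>P \<delta>)"
      unfolding d(3) using d(1) gm by (simp add: PSL.m_assoc)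
    then show ?thesis using d(1) S_closed(1)[OF d(2) P(2)] by (auto simp: P_def)
  qed
  have L_right: "L (x \<otimes>\<^sub>P \<delta>) = L x" if d: "\<delta> \<in> ?S" and x: "x \<in> \<Gamma>" for x \<delta>
  proof (cases "\<exists>h. P x h")
    case True
    then show ?thesis using P_right[OF _ d] L_eq by metis
  next
    case False
    have "\<delta> \<in> \<Gamma>" using d by (simp add: stab_def)
    then have "x \<otimes>\<^sub>P \<delta> \<otimes>\<^sub>P psl_inv \<delta> = x" using x by (simp add: PSL_word)
    then have "\<not> P (x \<otimes>\<^sub>P \<delta>) h" for h
      using P_right[of "x \<otimes>\<^sub>P \<delta>" h "psl_inv \<delta>"] False S_closed(2)[OF d d] by auto
    then show ?thesis using False by (simp add: L_def)
  qed
  define w where "w = (\<chi> i. L (\<alpha> i))"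
  have ext_w: "extend w x = L x" if x: "x \<in> \<Gamma>" for x
  proof -
    obtain k j where k: "k \<in> \<Gamma>1" "x = k \<otimes>\<^sub>P \<alpha> j" using coset_decomp[OF x] .
    then show ?thesis by (simp add: ext_rep w_def L_left)
  qed
  have "w \<in> FS (below b)"
    unfolding fixed_space_def
  proof (intro CollectI ballI)
    fix \<delta> assume d: "\<delta> \<in> ?S"
    then have "\<delta> \<in> \<Gamma>" by (simp add: stab_def)
    then show "psi \<delta> w = w" by (simp add: vec_eq_iff psi_nth ext_w L_right[OF d]) (simp add: w_def)
  qed
  moreover have "component b' w = (if b' = b then v else 0)" if b': "b' < num_cusps C1" "below b' = below b" for b'
  proof (cases "b' = b")
    case True
    have "\<one>\<^bsub>PSL2C\<^esub> \<in> ?S" by (simp add: stab_def)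
    then have "P (psl_inv (gam b)) \<one>\<^bsub>PSL2C\<^esub>" using gm by (auto simp: P_def intro!: bexI[of _ "\<one>\<^bsub>PSL2C\<^esub>"])
    then have "L (psl_inv (gam b)) = v" using L_eq unitary_rep_one[OF G1 chi] by metis
    then show ?thesis using True gm by (simp add: component_def ext_w)
  next
    case False
    have "\<not> P (psl_inv (gam b')) h" for h
    proof
      assume "P (psl_inv (gam b')) h"
      then obtain \<delta> where d: "h \<in> \<Gamma>1" "\<delta> \<in> ?S" "psl_inv (gam b') = h \<otimes>\<^sub>P psl_inv (gam b) \<otimes>\<^sub>P \<delta>" by (auto simp: P_def)
      have "\<delta> \<in> \<Gamma>" using d(2) by (simp add: stab_def)
      have "\<one>\<^bsub>PSL2C\<^esub> \<in> stab \<Gamma> (vertex C (below b'))" by (simp add: stab_def)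
      from double_coset_unique[OF b'(1) b closed(6) d(1) this d(2) b'(2)]
      have "psl_inv (gam b') = h \<otimes>\<^sub>P psl_inv (gam b) \<otimes>\<^sub>P \<delta> \<Longrightarrow> b' = b"
        using d(1) \<open>\<delta> \<in> \<Gamma>\<close> gm gam[OF b'(1)] by simp
      with d(3) show False using False by blast
    qed
    then show ?thesis using False gam[OF b'(1)] by (simp add: component_def ext_w L_def)
  qed
  ultimately show ?thesis using that by blast
qed

end

section \<open>Eisenstein series\<close>

definition eis_term ::
  "cusp_data \<Rightarrow> (psl \<Rightarrow> 'v::fd_complex_inner \<Rightarrow> 'v) \<Rightarrow> nat \<Rightarrow> 'v \<Rightarrow> complex \<Rightarrow> hpoint \<Rightarrow> psl \<Rightarrow> 'v" where
  "eis_term C \<rho> a w s P M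
    = (complex_of_real (snd (act (chart C a \<otimes>\<^sub>P M) P)) powr (1 + s)) *\<^sub>C \<rho> (psl_inv M) w"

abbreviation "stab_coset G C a \<equiv> r_coset (subgrp G) (stab G (vertex C a))"
abbreviation "stab_cosets G C a \<equiv> rcosets\<^bsub>subgrp G\<^esub> (stab G (vertex C a))"

text \<open>A chosen representative replaces the \<open>the_elem\<close> of the image in the
  definition of the series. For a vector fixed by the stabilizer and a point of \<open>H3\<close>
  the two agree, because the summand is constant on cosets.\<close>

definition eis_coset where
  "eis_coset G C \<rho> a w s P K = eis_term C \<rho> a w s P (SOME M. M \<in> K)"

context
  fixes G C and \<rho> :: "psl \<Rightarrow> 'v::fd_complex_inner \<Rightarrow> 'v" and a
  assumes G: "subgroup G PSL2C" and \<rho>: "unitary_rep G \<rho>" and C: "cusp_data_for G C" "a < num_cusps C"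
begin

lemma G_mem [simp]:
  "x \<in> G \<Longrightarrow> x \<in> carrier PSL2C" "x \<in> G \<Longrightarrow> y \<in> G \<Longrightarrow> x \<otimes>\<^sub>P y \<in> G" "x \<in> G \<Longrightarrow> psl_inv x \<in> G" "\<one>\<^bsub>PSL2C\<^esub> \<in> G"
  by (auto simp: subgroup.mem_carrier[OF G] subgroup.m_closed[OF G] subgroup.m_inv_closed[OF G] subgroup.one_closed[OF G])

lemma stab_mem: "\<delta> \<in> stab G \<zeta> \<Longrightarrow> \<delta> \<in> G"
  by (simp add: stab_def)

lemma stab_closed:
  "\<lbrakk>\<delta> \<in> stab G \<zeta>; \<delta>' \<in> stab G \<zeta>\<rbrakk> \<Longrightarrow> \<delta> \<otimes>\<^sub>P \<delta>' \<in> stab G \<zeta>" "\<delta> \<in> stab G \<zeta> \<Longrightarrow> psl_inv \<delta> \<in> stab G \<zeta>"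
  "\<one>\<^bsub>PSL2C\<^esub> \<in> stab G \<zeta>"
  by (auto simp: stab_def bact_mult bact_inv_iff)

lemma eis_term_left:
  assumes w: "w \<in> fixed_space G C \<rho> a" and d: "\<delta> \<in> stab G (vertex C a)" and M: "M \<in> G" and P: "P \<in> H3"
  shows "eis_term C \<rho> a w s P (\<delta> \<otimes>\<^sub>P M) = eis_term C \<rho> a w s P M"
proof -
  note B = cusp_data_forD(2)[OF C]
  have dG: "\<delta> \<in> G" using d by (rule stab_mem)
  have "snd (act (chart C a \<otimes>\<^sub>P (\<delta> \<otimes>\<^sub>P M)) P) = snd (act (chart C a \<otimes>\<^sub>P \<delta>) (act M P))"
    using B dG M P by (simp add: PSL.m_assoc flip: act_mult)
  also have "\<dots> = snd (act (chart C a \<otimes>\<^sub>P M) P)"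
    using B M P by (simp add: stab_height[OF C G d] act_mult)
  finally have "snd (act (chart C a \<otimes>\<^sub>P (\<delta> \<otimes>\<^sub>P M)) P) = snd (act (chart C a \<otimes>\<^sub>P M) P)" .
  moreover have "\<rho> (psl_inv (\<delta> \<otimes>\<^sub>P M)) w = \<rho> (psl_inv M) (\<rho> (psl_inv \<delta>) w)"
    using dG M by (simp add: PSL.inv_mult_group unitary_repD(5)[OF \<rho>])
  moreover have "\<rho> (psl_inv \<delta>) w = w" using w stab_closed(2)[OF d] by (simp add: fixed_space_def)
  ultimately show ?thesis by (simp add: eis_term_def)
qed

lemma stab_coset_mem: "K = stab_coset G C a M \<Longrightarrow> M' \<in> K \<Longrightarrow> \<exists>\<delta>\<in>stab G (vertex C a). M' = \<delta> \<otimes>\<^sub>P M"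
  by (auto simp: r_coset_def)

lemma stab_coset_self: "M \<in> G \<Longrightarrow> M \<in> stab_coset G C a M"
  using stab_closed(3) by (auto simp: r_coset_def intro!: bexI[of _ "\<one>\<^bsub>PSL2C\<^esub>"])

lemma stab_coset_eq:
  assumes "\<delta> \<in> stab G (vertex C a)" "M \<in> G"
  shows "stab_coset G C a (\<delta> \<otimes>\<^sub>P M) = stab_coset G C a M"
proof -
  have "\<exists>\<delta>'' \<in> stab G (vertex C a). \<delta>' \<otimes>\<^sub>P M = \<delta>'' \<otimes>\<^sub>P (\<delta> \<otimes>\<^sub>P M)" if "\<delta>' \<in> stab G (vertex C a)" for \<delta>'
    using that assms stab_closed stab_mem[OF that] stab_mem[OF assms(1)]
    by (intro bexI[of _ "\<delta>' \<otimes>\<^sub>P psl_inv \<delta>"]) (auto simp: PSL_word)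
  moreover have "\<exists>\<delta>'' \<in> stab G (vertex C a). \<delta>' \<otimes>\<^sub>P (\<delta> \<otimes>\<^sub>P M) = \<delta>'' \<otimes>\<^sub>P M" if "\<delta>' \<in> stab G (vertex C a)" for \<delta>'
    using that assms stab_closed stab_mem[OF that] stab_mem[OF assms(1)]
    by (intro bexI[of _ "\<delta>' \<otimes>\<^sub>P \<delta>"]) (auto simp: PSL_word)
  ultimately show ?thesis by (fastforce simp: r_coset_def)
qed

lemma stab_coset_eqD:
  assumes "stab_coset G C a M = stab_coset G C a M'" "M \<in> G" "M' \<in> G"
  obtains \<delta> where "\<delta> \<in> stab G (vertex C a)" "M = \<delta> \<otimes>\<^sub>P M'"
  using stab_coset_self[OF assms(2)] stab_coset_mem[OF assms(1)] by blast

lemma stab_cosets_cases: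
  assumes "K \<in> stab_cosets G C a"
  obtains M where "M \<in> G" "K = stab_coset G C a M"
  using assms by (auto simp: RCOSETS_def)

lemma stab_coset_in: "M \<in> G \<Longrightarrow> stab_coset G C a M \<in> stab_cosets G C a"
  by (auto simp: RCOSETS_def)

lemma some_in_coset:
  assumes "K \<in> stab_cosets G C a"
  shows "(SOME M. M \<in> K) \<in> G" "stab_coset G C a (SOME M. M \<in> K) = K"
proof -
  obtain M where M: "M \<in> G" "K = stab_coset G C a M" using stab_cosets_cases[OF assms] .
  then have "(SOME M. M \<in> K) \<in> K" using stab_coset_self by (metis someI)
  then obtain \<delta> where "\<delta> \<in> stab G (vertex C a)" "(SOME M. M \<in> K) = \<delta> \<otimes>\<^sub>P M" using stab_coset_mem[OF M(2)] by blast
  then show "(SOME M. M \<in> K) \<in> G" "stab_coset G C a (SOME M. M \<in> K) = K" using M stab_coset_eq stab_mem by auto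
qed

lemma eis_coset_eq:
  assumes w: "w \<in> fixed_space G C \<rho> a" and M: "M \<in> G" and P: "P \<in> H3"
  shows "eis_coset G C \<rho> a w s P (stab_coset G C a M) = eis_term C \<rho> a w s P M"
proof -
  let ?K = "stab_coset G C a M"
  have "(SOME M. M \<in> ?K) \<in> ?K" using stab_coset_self[OF M] by (metis someI)
  then obtain \<delta> where "\<delta> \<in> stab G (vertex C a)" "(SOME M. M \<in> ?K) = \<delta> \<otimes>\<^sub>P M" using stab_coset_mem by blast
  then show ?thesis unfolding eis_coset_def using eis_term_left[OF w _ M P] by simp
qed

lemma eisenstein_series_iff:
  assumes w: "w \<in> fixed_space G C \<rho> a"
  shows "eisenstein_series G C \<rho> a w E \<longleftrightarrow>
    (\<forall>P\<in>H3. \<forall>s. Re s > 1 \<longrightarrow> (eis_coset G C \<rho> a w s P has_sum E P s) (stab_cosets G C a))"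
proof -
  let ?t = "\<lambda>P s M. (complex_of_real (snd (act (chart C a \<otimes>\<^sub>P M) P)) powr (1 + s)) *\<^sub>C cadjoint (\<rho> M) w"
  have t: "?t P s M = eis_term C \<rho> a w s P M" if "M \<in> G" for P s M
    by (simp add: eis_term_def cadjoint_unitary_rep[OF G \<rho> that])
  have "the_elem (?t P s ` K) = eis_coset G C \<rho> a w s P K" if P: "P \<in> H3" and K: "K \<in> stab_cosets G C a" for P s K
  proof -
    obtain M where M: "M \<in> G" "K = stab_coset G C a M" using stab_cosets_cases[OF K] .
    have "?t P s M' = eis_term C \<rho> a w s P M" if M': "M' \<in> K" for M'
    proof -
      obtain \<delta> where d: "\<delta> \<in> stab G (vertex C a)" "M' = \<delta> \<otimes>\<^sub>P M" using stab_coset_mem[OF M(2) M'] by blast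
      then show ?thesis using M t[of M'] eis_term_left[OF w d(1) M(1) P] stab_mem[OF d(1)] by simp
    qed
    then have "?t P s ` K = {eis_term C \<rho> a w s P M}" using M stab_coset_self by fastforce
    then show ?thesis using M eis_coset_eq[OF w M(1) P] by simp
  qed
  then have "((\<lambda>K. the_elem (?t P s ` K)) has_sum E P s) (stab_cosets G C a)
      \<longleftrightarrow> (eis_coset G C \<rho> a w s P has_sum E P s) (stab_cosets G C a)" if "P \<in> H3" for P s
    using that by (intro has_sum_cong)
  then show ?thesis unfolding eisenstein_series_def by blast
qed

lemma eisenstein_has_sum:
  assumes w: "w \<in> fixed_space G C \<rho> a" and E: "eisenstein_series G C \<rho> a w E"
    and P: "P \<in> H3" and s: "Re s > 1"
  shows "(eis_coset G C \<rho> a w s P has_sum E P s) (stab_cosets G C a)"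
  using E P s eisenstein_series_iff[OF w] by blast

lemma fixed_space_sum:
  assumes "\<And>l. l \<in> L \<Longrightarrow> w l \<in> fixed_space G C \<rho> a"
  shows "(\<Sum>l\<in>L. c l *\<^sub>C w l) \<in> fixed_space G C \<rho> a"
proof -
  have "\<rho> g (\<Sum>l\<in>L. c l *\<^sub>C w l) = (\<Sum>l\<in>L. c l *\<^sub>C w l)" if g: "g \<in> stab G (vertex C a)" for g
  proof -
    have gG: "g \<in> G" using g by (rule stab_mem)
    have "\<rho> g (\<Sum>l\<in>L. c l *\<^sub>C w l) = (\<Sum>l\<in>L. c l *\<^sub>C \<rho> g (w l))"
      by (simp add: linear_sum[OF bounded_linear.linear[OF unitary_rep_bounded_linear[OF \<rho> gG]]] unitary_repD(2)[OF \<rho> gG])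
    also have "\<dots> = (\<Sum>l\<in>L. c l *\<^sub>C w l)"
      using assms g by (intro sum.cong) (auto simp: fixed_space_def)
    finally show ?thesis .
  qed
  then show ?thesis by (simp add: fixed_space_def)
qed

lemma bounded_linear_scaleC: "bounded_linear (\<lambda>x :: 'b::fd_complex_inner. c *\<^sub>C x)"
proof (rule bounded_linear_intro[where K = "cmod c"])
  show "c *\<^sub>C (a *\<^sub>R x) = a *\<^sub>R (c *\<^sub>C x)" for a and x :: 'b
    by (simp add: scaleC_scaleC mult.commute flip: scaleC_of_real)
qed (simp_all add: scaleC_add_right norm_scaleC mult.commute)

lemma eisenstein_series_sum:
  assumes w: "\<And>l. l \<in> L \<Longrightarrow> w l \<in> fixed_space G C \<rho> a" and L: "finite L"
    and E: "\<And>l. l \<in> L \<Longrightarrow> eisenstein_series G C \<rho> a (w l) (E l)"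
  shows "eisenstein_series G C \<rho> a (\<Sum>l\<in>L. c l *\<^sub>C w l) (\<lambda>P s. \<Sum>l\<in>L. c l *\<^sub>C E l P s)"
proof (rule eisenstein_series_iff[THEN iffD2], rule fixed_space_sum, erule w, intro ballI allI impI)
  fix P s assume P: "P \<in> H3" and s: "Re s > 1"
  have "((\<lambda>K. \<Sum>l\<in>L. c l *\<^sub>C eis_coset G C \<rho> a (w l) s P K) has_sum (\<Sum>l\<in>L. c l *\<^sub>C E l P s)) (stab_cosets G C a)"
    using L w E
    by (induction L rule: finite_induct)
      (auto intro!: has_sum_add has_sum_bounded_linear[OF bounded_linear_scaleC] eisenstein_has_sum P s)
  moreover have "(\<Sum>l\<in>L. c l *\<^sub>C eis_coset G C \<rho> a (w l) s P K) = eis_coset G C \<rho> a (\<Sum>l\<in>L. c l *\<^sub>C w l) s P K"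
    if K: "K \<in> stab_cosets G C a" for K
  proof -
    let ?M = "psl_inv (SOME M. M \<in> K)"
    have M: "?M \<in> G" using some_in_coset(1)[OF K] by simp
    have "\<rho> ?M (\<Sum>l\<in>L. c l *\<^sub>C w l) = (\<Sum>l\<in>L. c l *\<^sub>C \<rho> ?M (w l))"
      by (simp add: linear_sum[OF bounded_linear.linear[OF unitary_rep_bounded_linear[OF \<rho> M]]] unitary_repD(2)[OF \<rho> M])
    then show ?thesis
      by (simp add: eis_coset_def eis_term_def scaleC_sum_right scaleC_scaleC mult.commute)
  qed
  ultimately show "(eis_coset G C \<rho> a (\<Sum>l\<in>L. c l *\<^sub>C w l) s P has_sum (\<Sum>l\<in>L. c l *\<^sub>C E l P s)) (stab_cosets G C a)"
    by (rule has_sum_cong[THEN iffD1, rotated])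
qed

text \<open>Right multiplication by \<open>g\<close> permutes the cosets of the stabilizer.
  Reindexing the series in this way moves \<open>g\<close> from the point to a factor
  \<open>\<rho> g\<close> in front of the sum.\<close>

lemma eisenstein_automorphic:
  assumes w: "w \<in> fixed_space G C \<rho> a" and E: "eisenstein_series G C \<rho> a w E"
    and P: "P \<in> H3" and s: "Re s > 1" and g: "g \<in> G"
  shows "E (act g P) s = \<rho> g (E P s)"
proof -
  note B = cusp_data_forD(2)[OF C]
  let ?R = "stab_cosets G C a"
  let ?f = "\<lambda>K. stab_coset G C a ((SOME M. M \<in> K) \<otimes>\<^sub>P g)"
  have gP: "act g P \<in> H3" using g P by simp
  have f: "?f (stab_coset G C a M) = stab_coset G C a (M \<otimes>\<^sub>P g)" if M: "M \<in> G" for M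
  proof -
    have "(SOME M'. M' \<in> stab_coset G C a M) \<in> stab_coset G C a M"
      using stab_coset_self[OF M] by (metis someI)
    then obtain \<delta> where "\<delta> \<in> stab G (vertex C a)" "(SOME M'. M' \<in> stab_coset G C a M) = \<delta> \<otimes>\<^sub>P M"
      using stab_coset_mem by blast
    then show ?thesis using M g stab_coset_eq[of \<delta> "M \<otimes>\<^sub>P g"] by (simp add: PSL.m_assoc stab_mem)
  qed
  have "bij_betw ?f ?R ?R"
  proof (rule bij_betw_imageI)
    show "inj_on ?f ?R"
    proof (rule inj_onI)
      fix K K' assume K: "K \<in> ?R" "K' \<in> ?R" "?f K = ?f K'"
      obtain M where M: "M \<in> G" "K = stab_coset G C a M" using stab_cosets_cases[OF K(1)] .
      obtain M' where M': "M' \<in> G" "K' = stab_coset G C a M'" using stab_cosets_cases[OF K(2)] .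
      have "stab_coset G C a (M \<otimes>\<^sub>P g) = stab_coset G C a (M' \<otimes>\<^sub>P g)"
        using K(3) M M' f by simp
      then obtain \<delta> where d: "\<delta> \<in> stab G (vertex C a)" "M \<otimes>\<^sub>P g = \<delta> \<otimes>\<^sub>P (M' \<otimes>\<^sub>P g)"
        by (rule stab_coset_eqD) (use M M' g in auto)
      then have "M \<otimes>\<^sub>P g = \<delta> \<otimes>\<^sub>P M' \<otimes>\<^sub>P g" using M' g stab_mem[OF d(1)] by (simp add: PSL.m_assoc)
      then have "M = \<delta> \<otimes>\<^sub>P M'" using M M' stab_mem[OF d(1)] g by (simp add: PSL.r_cancel)
      then show "K = K'" using M M' d stab_coset_eq by simp
    qed
    show "?f ` ?R = ?R"
    proof (intro equalityI subsetI)
      fix K assume "K \<in> ?f ` ?R"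
      then show "K \<in> ?R" using some_in_coset(1) g stab_coset_in by auto
    next
      fix K assume "K \<in> ?R"
      then obtain M where M: "M \<in> G" "K = stab_coset G C a M" using stab_cosets_cases by blast
      have eq: "?f (stab_coset G C a (M \<otimes>\<^sub>P psl_inv g)) = K" using M f[of "M \<otimes>\<^sub>P psl_inv g"] g by (simp add: PSL_word)
      have "stab_coset G C a (M \<otimes>\<^sub>P psl_inv g) \<in> ?R" by (rule stab_coset_in) (use M g in simp)
      then show "K \<in> ?f ` ?R" by (rule image_eqI[where f = ?f and x = "stab_coset G C a (M \<otimes>\<^sub>P psl_inv g)", OF eq[symmetric]])
    qed
  qed
  then have "((\<lambda>K. \<rho> g (eis_coset G C \<rho> a w s P (?f K))) has_sum \<rho> g (E P s)) ?R"
    using has_sum_bounded_linear[OF unitary_rep_bounded_linear[OF \<rho> g] eisenstein_has_sum[OF w E P s]]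
    by (subst has_sum_reindex_bij_betw)
  moreover have "\<rho> g (eis_coset G C \<rho> a w s P (?f K)) = eis_coset G C \<rho> a w s (act g P) K" if "K \<in> ?R" for K
  proof -
    obtain M where M: "M \<in> G" "K = stab_coset G C a M" using stab_cosets_cases[OF \<open>K \<in> ?R\<close>] .
    have "\<rho> g (\<rho> (psl_inv (M \<otimes>\<^sub>P g)) w) = \<rho> (psl_inv M) w"
      using M g by (simp add: PSL_word flip: unitary_repD(5)[OF \<rho>])
    moreover have "snd (act (chart C a \<otimes>\<^sub>P (M \<otimes>\<^sub>P g)) P) = snd (act (chart C a \<otimes>\<^sub>P M) (act g P))"
      using B M g P by (simp add: PSL.m_assoc flip: act_mult)
    ultimately have "\<rho> g (eis_term C \<rho> a w s P (M \<otimes>\<^sub>P g)) = eis_term C \<rho> a w s (act g P) M"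
      by (simp add: eis_term_def unitary_repD(2)[OF \<rho> g])
    then show ?thesis 
      unfolding M(2) f[OF M(1)] eis_coset_eq[OF w M(1) gP] eis_coset_eq[OF w G_mem(2)[OF M(1) g] P] .
  qed
  ultimately have "(eis_coset G C \<rho> a w s (act g P) has_sum \<rho> g (E P s)) ?R"
    by (rule has_sum_cong[THEN iffD1, rotated])
  with eisenstein_has_sum[OF w E gP s] show ?thesis by (rule has_sum_unique)
qed

end

text \<open>With \<open>c\<close>, \<open>d\<close> the lower row, the heights are \<open>r\<close>
  divided by \<open>D z = |c z + d|^2 + |c|^2 r^2\<close>. From
  \<open>|c z0 + d| \<le> |c z + d| + |c|\<close> the square costs a factor 2, and the extra
  \<open>2 |c|^2\<close> is at most \<open>2 / r^2\<close> times \<open>D z\<close>. The point is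
  that the constant does not depend on \<open>g\<close>.\<close>

lemma height_harnack:
  assumes g: "g \<in> carrier PSL2C" and r: "r > 0" and d: "cmod (z - z0) \<le> 1"
  shows "snd (act g (z, r)) \<le> (2 + 2 / r\<^sup>2) * snd (act g (z0, r))"
proof -
  obtain A where A: "g = psl_class A" "Determinants.det A = 1" using g by (rule PSL2C_E)
  define c d where e: "c = entry A 2 1" "d = entry A 2 2"
  define D where "D z = (cmod (c * z + d))\<^sup>2 + (cmod c)\<^sup>2 * r\<^sup>2" for z
  have D: "D z > 0" for z
    using herm_diag_pos[of "(z, r)" c d] row_nonzero[OF A(2)] r by (simp add: herm_diag D_def e)
  have "cmod (c * z0 + d) \<le> cmod (c * z + d) + cmod c"
  proof -
    have "c * z0 + d = (c * z + d) - c * (z - z0)" by (simp add: algebra_simps)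
    then have "cmod (c * z0 + d) \<le> cmod (c * z + d) + cmod (c * (z - z0))"
      by (metis norm_triangle_ineq4)
    also have "cmod (c * (z - z0)) \<le> cmod c" using assms(3) by (simp add: norm_mult mult_left_le)
    finally show ?thesis by simp
  qed
  then have "(cmod (c * z0 + d))\<^sup>2 \<le> (cmod (c * z + d) + cmod c)\<^sup>2"
    by (intro power_mono) auto
  also have "\<dots> \<le> 2 * (cmod (c * z + d))\<^sup>2 + 2 * (cmod c)\<^sup>2"
    using sum_squares_bound[of "cmod (c * z + d)" "cmod c"] by (simp add: power2_sum)
  finally have "D z0 \<le> 2 * (cmod (c * z + d))\<^sup>2 + 2 * (cmod c)\<^sup>2 + (cmod c)\<^sup>2 * r\<^sup>2" by (simp add: D_def)
  also have "\<dots> \<le> (2 + 2 / r\<^sup>2) * D z"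
  proof -
    have "(2 + 2 / r\<^sup>2) * D z = 2 * (cmod (c * z + d))\<^sup>2 + 2 * (cmod c)\<^sup>2 + (cmod c)\<^sup>2 * r\<^sup>2
        + ((cmod c)\<^sup>2 * r\<^sup>2 + 2 / r\<^sup>2 * (cmod (c * z + d))\<^sup>2)"
      using r by (simp add: D_def field_simps)
    then show ?thesis by simp
  qed
  finally have "D z0 \<le> (2 + 2 / r\<^sup>2) * D z" .
  then have "r / D z \<le> (2 + 2 / r\<^sup>2) * (r / D z0)"
    using D[of z] D[of z0] r by (simp add: divide_simps mult.commute mult_left_mono)
  then show ?thesis by (simp add: A mat_act_def Let_def D_def e)
qed

lemma height_continuous:
  assumes g: "g \<in> carrier PSL2C" and r: "r > 0"
  shows "continuous_on UNIV (\<lambda>z. snd (act g (z, r)))"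
proof -
  obtain A where A: "g = psl_class A" "Determinants.det A = 1" using g by (rule PSL2C_E)
  have "(cmod (entry A 2 1 * z + entry A 2 2))\<^sup>2 + (cmod (entry A 2 1))\<^sup>2 * r\<^sup>2 > 0" for z
    using herm_diag_pos[of "(z, r)"] row_nonzero[OF A(2)] r by (simp add: herm_diag)
  then have "continuous_on UNIV (\<lambda>z. r / ((cmod (entry A 2 1 * z + entry A 2 2))\<^sup>2 + (cmod (entry A 2 1))\<^sup>2 * r\<^sup>2))"
    by (intro continuous_intros) (metis less_irrefl)
  then show ?thesis by (simp add: A mat_act_def Let_def)
qed

text \<open>By the Harnack inequality, absolute convergence at one point gives uniform convergence on a
  neighbourhood.\<close>

lemma eisenstein_cinner_continuous:
  fixes \<rho> :: "psl \<Rightarrow> 'v::fd_complex_inner \<Rightarrow> 'v"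
  assumes G: "subgroup G PSL2C" and \<rho>: "unitary_rep G \<rho>" and C: "cusp_data_for G C" "a < num_cusps C"
    and w: "w \<in> fixed_space G C \<rho> a" and E: "eisenstein_series G C \<rho> a w E"
    and s: "Re s > 1" and g: "g \<in> carrier PSL2C" and r: "r > 0"
  shows "continuous_on UNIV (\<lambda>z. cinner (E (act g (z, r)) s) v)"
proof -
  note B = cusp_data_forD(2)[OF C]
  let ?R = "stab_cosets G C a"
  define F where "F K z = cinner (eis_coset G C \<rho> a w s (act g (z, r)) K) v" for K z
  have H3: "act g (z, r) \<in> H3" if "g \<in> carrier PSL2C" for g z
    by (rule act_H3[OF that]) (use r in \<open>simp add: H3_def\<close>)
  have sum: "((\<lambda>K. F K z) has_sum cinner (E (act g (z, r)) s) v) ?R" for z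
    unfolding F_def
    by (rule has_sum_bounded_linear[OF bounded_linear_cinner_left])
      (rule eisenstein_has_sum[OF G \<rho> C w E H3[OF g] s])
  \<comment> \<open>Each term is a constant times a power of one height function, so a single
    Harnack constant bounds all terms of the series at once.\<close>
  have F: "\<exists>h c. h \<in> carrier PSL2C \<and> (\<forall>z. F K z = (complex_of_real (snd (act h (z, r))) powr (1 + s)) * c)"
    if K: "K \<in> ?R" for K
  proof -
    obtain M where M: "M \<in> G" "K = stab_coset G C a M" using stab_cosets_cases[OF G \<rho> C K] .
    have Mc: "M \<in> carrier PSL2C" by (rule subgroup.mem_carrier[OF G M(1)])
    have "F K z = (complex_of_real (snd (act (chart C a \<otimes>\<^sub>P M \<otimes>\<^sub>P g) (z, r))) powr (1 + s)) * cinner (\<rho> (psl_inv M) w) v" for z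
      unfolding F_def M(2) eis_coset_eq[OF G \<rho> C w M(1) H3[OF g]] eis_term_def cinner_scaleC_left
      using B Mc g r by (simp add: act_mult H3_def)
    then show ?thesis using B Mc g by blast
  qed
  have cont: "continuous_on UNIV (F K)" if K: "K \<in> ?R" for K
  proof -
    obtain h c where h: "h \<in> carrier PSL2C" "\<And>z. F K z = (complex_of_real (snd (act h (z, r))) powr (1 + s)) * c"
      using F[OF K] by blast
    have pos: "snd (act h (z, r)) > 0" for z using H3[OF h(1), of z] by (simp add: H3_def)
    have "continuous_on UNIV (\<lambda>z. (complex_of_real (snd (act h (z, r))) powr (1 + s)) * c)"
      using pos by (intro continuous_on_mult continuous_on_powr_complex continuous_on_of_real continuous_on_const height_continuous[OF h(1) r])
        (auto simp: less_imp_le, metis less_irrefl)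
    then show ?thesis by (simp add: h(2)[abs_def] cong: continuous_on_cong)
  qed
  define \<kappa> where "\<kappa> = 2 + 2 / r\<^sup>2"
  have bound: "cmod (F K z) \<le> \<kappa> powr (1 + Re s) * cmod (F K z0)" if K: "K \<in> ?R" and z: "z \<in> ball z0 1" for K z z0
  proof -
    obtain h c where h: "h \<in> carrier PSL2C" "\<And>z. F K z = (complex_of_real (snd (act h (z, r))) powr (1 + s)) * c"
      using F[OF K] by blast
    have pos: "snd (act h (z, r)) > 0" for z using H3[OF h(1), of z] by (simp add: H3_def)
    have norm: "cmod (F K z) = snd (act h (z, r)) powr (1 + Re s) * cmod c" for z
      using pos[of z] by (simp add: h(2) norm_mult norm_powr_real_powr)
    have "cmod (z - z0) \<le> 1" using z by (simp add: dist_norm norm_minus_commute)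
    from height_harnack[OF h(1) r this] have "snd (act h (z, r)) powr (1 + Re s) \<le> (\<kappa> * snd (act h (z0, r))) powr (1 + Re s)"
      using s pos[of z] by (intro powr_mono2) (auto simp: \<kappa>_def)
    also have "\<dots> = \<kappa> powr (1 + Re s) * snd (act h (z0, r)) powr (1 + Re s)"
      using pos[of z0] by (simp add: powr_mult \<kappa>_def)
    finally show ?thesis unfolding norm by (simp add: mult.assoc[symmetric] mult_right_mono)
  qed
  have "continuous_on (ball z0 1) (\<lambda>z. cinner (E (act g (z, r)) s) v)" for z0
  proof (rule uniform_limit_theorem)
    \<comment> \<open>For complex terms, summability over an index set is absolute. The inner
      product with \<open>v\<close> has made the terms complex.\<close>
    have "(\<lambda>K. cmod (F K z0)) summable_on ?R"
      using sum[of z0] summable_on_iff_abs_summable_on_complex[of "\<lambda>K. F K z0" ?R] unfolding summable_on_def by blast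
    then have "(\<lambda>K. \<kappa> powr (1 + Re s) * cmod (F K z0)) summable_on ?R"
      by (rule summable_on_cmult_right)
    then show "uniform_limit (ball z0 1) (\<lambda>Y z. \<Sum>K\<in>Y. F K z) (\<lambda>z. cinner (E (act g (z, r)) s) v) (finite_subsets_at_top ?R)"
      by (intro Weierstrass_m_test_general'[OF bound sum])
    show "\<forall>\<^sub>F Y in finite_subsets_at_top ?R. continuous_on (ball z0 1) (\<lambda>z. \<Sum>K\<in>Y. F K z)"
      by (rule eventually_finite_subsets_at_top_weakI)
        (intro continuous_on_sum continuous_on_subset[OF cont], auto)
  qed (rule finite_subsets_at_top_neq_bot)
  then have "continuous_on (\<Union>z0. ball z0 1) (\<lambda>z. cinner (E (act g (z, r)) s) v)"
    by (intro continuous_on_open_UN) auto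
  moreover have "(\<Union>z0. ball z0 1) = (UNIV :: complex set)" by (auto intro!: exI[of _ "_ :: complex"] centre_in_ball[THEN iffD2])
  ultimately show ?thesis by simp
qed

section \<open>Eisenstein series of the induced representation\<close>

context induced_cusps
begin

definition fibre :: "nat \<Rightarrow> nat set" where
  "fibre a = {b. b < num_cusps C1 \<and> below b = a}"

lemma finite_fibre [simp]: "finite (fibre a)"
  by (simp add: fibre_def)

lemma fibreD: "b \<in> fibre a \<Longrightarrow> b < num_cusps C1" "b \<in> fibre a \<Longrightarrow> below b = a"
  by (auto simp: fibre_def)

text \<open>Compatibility of the charts makes the two heights equal. In the vector factor
  \<open>\<alpha> i\<close> cancels, and equivariance of \<open>extend\<close> leaves
  \<open>chi\<close> of the inverse of \<open>M\<close> applied to the component.\<close>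

lemma eis_term_component:
  assumes b: "b < num_cusps C1" and M: "M \<in> \<Gamma>1" and P: "P \<in> H3"
  shows "vec_nth (eis_term C psi (below b) w s P (gam b \<otimes>\<^sub>P M \<otimes>\<^sub>P \<alpha> i)) i
    = eis_term C1 chi b (component b w) s (act (\<alpha> i) P) M"
proof -
  note gm = gam[OF b] and B = cusp_data_forD(2)[OF C below_less[OF b]] and B1 = cusp_data_forD(2)[OF C1 b]
  have MG: "M \<in> \<Gamma>" by (rule G1_sub[OF M])
  have Q: "act M (act (\<alpha> i) P) \<in> H3" using MG P by simp
  have "snd (act (chart C (below b) \<otimes>\<^sub>P (gam b \<otimes>\<^sub>P M \<otimes>\<^sub>P \<alpha> i)) P)
      = snd (act (chart C (below b) \<otimes>\<^sub>P gam b) (act M (act (\<alpha> i) P)))"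
    using B gm MG P by (simp add: PSL.m_assoc flip: act_mult)
  also have "\<dots> = snd (act (chart C1 b) (act M (act (\<alpha> i) P)))" by (rule compat_height[OF b Q, symmetric])
  also have "\<dots> = snd (act (chart C1 b \<otimes>\<^sub>P M) (act (\<alpha> i) P))"
    using B1 MG P by (simp add: act_mult)
  finally have height: "snd (act (chart C (below b) \<otimes>\<^sub>P (gam b \<otimes>\<^sub>P M \<otimes>\<^sub>P \<alpha> i)) P)
      = snd (act (chart C1 b \<otimes>\<^sub>P M) (act (\<alpha> i) P))" .
  have "vec_nth (psi (psl_inv (gam b \<otimes>\<^sub>P M \<otimes>\<^sub>P \<alpha> i)) w) i = extend w (\<alpha> i \<otimes>\<^sub>P psl_inv (gam b \<otimes>\<^sub>P M \<otimes>\<^sub>P \<alpha> i))"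
    by (rule psi_nth)
  also have "\<alpha> i \<otimes>\<^sub>P psl_inv (gam b \<otimes>\<^sub>P M \<otimes>\<^sub>P \<alpha> i) = psl_inv M \<otimes>\<^sub>P psl_inv (gam b)"
    using gm MG by (simp add: PSL_word)
  also have "extend w \<dots> = chi (psl_inv M) (component b w)"
    using gm M by (simp add: ext_left component_def)
  finally show ?thesis by (simp add: eis_term_def height scaleC_vec_nth)
qed

text \<open>The cosets of the stabilizer of a cusp of \<open>\<Gamma>\<close> are sorted by the \<open>\<Gamma>1\<close>-classes of cusps
  above it, since \<open>\<Gamma>\<close> is the disjoint union of the double cosets of the inverses of the \<open>gam b\<close>.\<close>

lemma eisenstein_induced:
  assumes a: "a < num_cusps C" and w: "w \<in> FS a" and E: "eisenstein_series \<Gamma> C psi a w E"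
    and E1: "\<And>b. b \<in> fibre a \<Longrightarrow> eisenstein_series \<Gamma>1 C1 chi b (component b w) (E1 b)"
    and P: "P \<in> H3" and s: "Re s > 1"
  shows "vec_nth (E P s) i = (\<Sum>b\<in>fibre a. E1 b (act (\<alpha> i) P) s)"
proof -
  let ?R = "stab_cosets \<Gamma> C a" and ?R1 = "\<lambda>b. stab_cosets \<Gamma>1 C1 b"
  define rep where "rep K = (SOME M. M \<in> K)" for K :: "psl set"
  \<comment> \<open>A coset of \<open>M\<close> at the cusp \<open>b\<close> of
    \<open>\<Gamma>1\<close> goes to the coset of the product of \<open>gam b\<close>,
    \<open>M\<close> and \<open>\<alpha> i\<close>. The factor \<open>\<alpha> i\<close> depends on
    the component of \<open>E\<close> under consideration and makes
    \<open>eis_term_component\<close> match the summands.\<close>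
  define f where "f p = stab_coset \<Gamma> C a (gam (fst p) \<otimes>\<^sub>P rep (snd p) \<otimes>\<^sub>P \<alpha> i)" for p :: "nat \<times> psl set"
  note stab_G = stab_coset_eq[OF G unitary_psi C a]
  have rep: "rep K \<in> \<Gamma>1" "stab_coset \<Gamma>1 C1 b (rep K) = K" if "b \<in> fibre a" "K \<in> ?R1 b" for b K
    using some_in_coset[OF G1 chi C1 fibreD(1)[OF that(1)] that(2)] by (simp_all only: rep_def)
  have rep_G: "rep K \<in> \<Gamma>" if "b \<in> fibre a" "K \<in> ?R1 b" for b K
    by (rule G1_sub[OF rep(1)[OF that]])
  have gm: "gam b \<in> \<Gamma>" if "b \<in> fibre a" for b by (rule gam(1)[OF fibreD(1)[OF that]])
  have "bij_betw f (Sigma (fibre a) ?R1) ?R"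
  proof (rule bij_betw_imageI)
    show "inj_on f (Sigma (fibre a) ?R1)"
    proof (rule inj_onI)
      fix p p' assume p: "p \<in> Sigma (fibre a) ?R1" "p' \<in> Sigma (fibre a) ?R1" "f p = f p'"
      obtain b K where bK: "p = (b, K)" "b \<in> fibre a" "K \<in> ?R1 b" using p(1) by auto
      obtain b' K' where bK': "p' = (b', K')" "b' \<in> fibre a" "K' \<in> ?R1 b'" using p(2) by auto
      note g = gm[OF bK(2)] gm[OF bK'(2)] and r = rep_G[OF bK(2,3)] rep_G[OF bK'(2,3)]
        and r1 = rep(1)[OF bK(2,3)] rep(1)[OF bK'(2,3)] and bl = fibreD[OF bK(2)] fibreD[OF bK'(2)]
      have "stab_coset \<Gamma> C a (gam b \<otimes>\<^sub>P rep K \<otimes>\<^sub>P \<alpha> i) = stab_coset \<Gamma> C a (gam b' \<otimes>\<^sub>P rep K' \<otimes>\<^sub>P \<alpha> i)"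
        using p(3) by (simp only: f_def bK(1) bK'(1) fst_conv snd_conv)
      then obtain \<delta> where d: "\<delta> \<in> stab \<Gamma> (vertex C a)"
        "gam b \<otimes>\<^sub>P rep K \<otimes>\<^sub>P \<alpha> i = \<delta> \<otimes>\<^sub>P (gam b' \<otimes>\<^sub>P rep K' \<otimes>\<^sub>P \<alpha> i)"
        by (rule stab_coset_eqD[OF G unitary_psi C a]) (use g r in auto)
      have dG: "\<delta> \<in> \<Gamma>" using d(1) by (simp add: stab_def)
      have "gam b \<otimes>\<^sub>P rep K \<otimes>\<^sub>P \<alpha> i = \<delta> \<otimes>\<^sub>P gam b' \<otimes>\<^sub>P rep K' \<otimes>\<^sub>P \<alpha> i"
        using d(2) g r dG by (simp add: PSL.m_assoc)
      then have eq: "gam b \<otimes>\<^sub>P rep K = \<delta> \<otimes>\<^sub>P gam b' \<otimes>\<^sub>P rep K'"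
        using g r dG by (simp add: PSL.r_cancel)
      have dinv: "psl_inv \<delta> \<in> stab \<Gamma> (vertex C (below b'))" and one: "\<one>\<^bsub>PSL2C\<^esub> \<in> stab \<Gamma> (vertex C (below b))"
        using d(1) bl by (auto simp: stab_def bact_inv_iff)
      \<comment> \<open>The cosets in the series have the stabilizer on the left, the double cosets
        have it on the right. Inversion passes from one to the other, here and in the proof of
        surjectivity.\<close>
      have "psl_inv (gam b \<otimes>\<^sub>P rep K) = psl_inv (\<delta> \<otimes>\<^sub>P gam b' \<otimes>\<^sub>P rep K')" by (simp only: eq)
      then have "psl_inv (rep K) \<otimes>\<^sub>P psl_inv (gam b) \<otimes>\<^sub>P \<one>\<^bsub>PSL2C\<^esub> = psl_inv (rep K') \<otimes>\<^sub>P psl_inv (gam b') \<otimes>\<^sub>P psl_inv \<delta>"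
        using g r dG by (simp add: PSL.inv_mult_group PSL.m_assoc)
      from double_coset_unique[OF bl(1,3) _ _ one dinv _ this] r1 bl have bb: "b = b'" by simp
      have k: "rep K \<otimes>\<^sub>P psl_inv (rep K') = psl_inv (gam b) \<otimes>\<^sub>P \<delta> \<otimes>\<^sub>P gam b"
      proof -
        have "psl_inv (gam b) \<otimes>\<^sub>P (gam b \<otimes>\<^sub>P rep K) \<otimes>\<^sub>P psl_inv (rep K') = psl_inv (gam b) \<otimes>\<^sub>P (\<delta> \<otimes>\<^sub>P gam b' \<otimes>\<^sub>P rep K') \<otimes>\<^sub>P psl_inv (rep K')"
          by (simp only: eq)
        then show ?thesis using g r dG bb by (simp add: PSL_word)
      qed
      have "rep K \<otimes>\<^sub>P psl_inv (rep K') \<in> stab \<Gamma>1 (vertex C1 b)"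
        unfolding k by (rule stab_conj_gam'[OF bl(1)]) (use d bl r1 in \<open>simp_all flip: k\<close>)
      then have "stab_coset \<Gamma>1 C1 b (rep K \<otimes>\<^sub>P psl_inv (rep K') \<otimes>\<^sub>P rep K') = stab_coset \<Gamma>1 C1 b (rep K')"
        by (rule stab_coset_eq[OF G1 chi C1 bl(1)]) (rule r1)
      moreover have "rep K \<otimes>\<^sub>P psl_inv (rep K') \<otimes>\<^sub>P rep K' = rep K" using r by (simp add: PSL_word)
      ultimately have "K = K'" using rep(2)[OF bK(2,3)] rep(2)[OF bK'(2,3)] bb by metis
      then show "p = p'" using bb bK bK' by simp
    qed
    show "f ` Sigma (fibre a) ?R1 = ?R"
    proof (intro equalityI subsetI)
      fix K assume "K \<in> f ` Sigma (fibre a) ?R1"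
      then obtain b K' where bK: "b \<in> fibre a" "K' \<in> ?R1 b" "K = f (b, K')" by auto
      show "K \<in> ?R"
        unfolding bK(3) f_def fst_conv snd_conv
        by (rule stab_coset_in[OF G unitary_psi C a]) (use gm[OF bK(1)] rep_G[OF bK(1,2)] in simp)
    next
      fix K assume "K \<in> ?R"
      then obtain M where M: "M \<in> \<Gamma>" "K = stab_coset \<Gamma> C a M" using stab_cosets_cases[OF G unitary_psi C a] by metis
      have "\<alpha> i \<otimes>\<^sub>P psl_inv M \<in> \<Gamma>" using M by simp
      then obtain b h \<delta> where b: "b < num_cusps C1" "below b = a" and h: "h \<in> \<Gamma>1" and d: "\<delta> \<in> stab \<Gamma> (vertex C a)"
        and eq: "\<alpha> i \<otimes>\<^sub>P psl_inv M = h \<otimes>\<^sub>P psl_inv (gam b) \<otimes>\<^sub>P \<delta>" using double_coset[OF a] by metis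
      have bf: "b \<in> fibre a" using b by (simp add: fibre_def)
      have dG: "\<delta> \<in> \<Gamma>" using d by (simp add: stab_def)
      have hG: "h \<in> \<Gamma>" by (rule G1_sub[OF h])
      note g = gm[OF bf]
      have "psl_inv (\<alpha> i \<otimes>\<^sub>P psl_inv M) = psl_inv (h \<otimes>\<^sub>P psl_inv (gam b) \<otimes>\<^sub>P \<delta>)" by (simp only: eq)
      then have "M \<otimes>\<^sub>P psl_inv (\<alpha> i) = psl_inv \<delta> \<otimes>\<^sub>P (gam b \<otimes>\<^sub>P psl_inv h)"
        using M g hG dG by (simp add: PSL.inv_mult_group)
      then have "M \<otimes>\<^sub>P psl_inv (\<alpha> i) \<otimes>\<^sub>P \<alpha> i = psl_inv \<delta> \<otimes>\<^sub>P (gam b \<otimes>\<^sub>P psl_inv h) \<otimes>\<^sub>P \<alpha> i" by (simp only:)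
      then have M_eq: "M = psl_inv \<delta> \<otimes>\<^sub>P (gam b \<otimes>\<^sub>P psl_inv h \<otimes>\<^sub>P \<alpha> i)"
        using M g hG dG by (simp add: PSL_word)
      let ?K1 = "stab_coset \<Gamma>1 C1 b (psl_inv h)"
      have K1: "?K1 \<in> ?R1 b" by (rule stab_coset_in[OF G1 chi C1 b(1)]) (use h in simp)
      have "stab_coset \<Gamma>1 C1 b (rep ?K1) = ?K1" by (rule rep(2)[OF bf K1])
      then obtain k where k: "k \<in> stab \<Gamma>1 (vertex C1 b)" "rep ?K1 = k \<otimes>\<^sub>P psl_inv h"
        by (rule stab_coset_eqD[OF G1 chi C1 b(1)]) (use rep(1)[OF bf K1] h in auto)
      have kG: "k \<in> \<Gamma>" using k(1) G1_sub by (simp add: stab_def)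
      have "f (b, ?K1) = stab_coset \<Gamma> C a (gam b \<otimes>\<^sub>P (k \<otimes>\<^sub>P psl_inv h) \<otimes>\<^sub>P \<alpha> i)"
        by (simp only: f_def fst_conv snd_conv k(2))
      also have "gam b \<otimes>\<^sub>P (k \<otimes>\<^sub>P psl_inv h) \<otimes>\<^sub>P \<alpha> i
          = (gam b \<otimes>\<^sub>P k \<otimes>\<^sub>P psl_inv (gam b)) \<otimes>\<^sub>P (gam b \<otimes>\<^sub>P psl_inv h \<otimes>\<^sub>P \<alpha> i)"
        using g kG hG by (simp add: PSL_word)
      also have "stab_coset \<Gamma> C a \<dots> = stab_coset \<Gamma> C a (gam b \<otimes>\<^sub>P psl_inv h \<otimes>\<^sub>P \<alpha> i)"
        by (rule stab_G) (use stab_conj_gam[OF b(1) k(1)] b(2) g hG in auto)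
      also have "\<dots> = K"
        unfolding M(2) M_eq
        by (rule stab_G[symmetric]) (use stab_closed(2)[OF G unitary_psi C a d] g hG in auto)
      finally have "f (b, ?K1) = K" .
      have "(b, ?K1) \<in> Sigma (fibre a) ?R1" by (rule SigmaI) (rule bf, rule K1)
      from image_eqI[where f = f and x = "(b, ?K1)", OF \<open>f (b, ?K1) = K\<close>[symmetric] this]
      show "K \<in> f ` Sigma (fibre a) ?R1" .
    qed
  qed
  note bij = this
  let ?t = "\<lambda>K. vec_nth (eis_coset \<Gamma> C psi a w s P K) i"
  have "(?t has_sum vec_nth (E P s) i) ?R"
    by (rule has_sum_bounded_linear[OF bounded_linear_vec_nth])
      (rule eisenstein_has_sum[OF G unitary_psi C a w E P s])
  then have total: "((\<lambda>p. ?t (f p)) has_sum vec_nth (E P s) i) (Sigma (fibre a) ?R1)"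
    using has_sum_reindex_bij_betw[OF bij, of ?t] by blast
  have Q: "act (\<alpha> i) P \<in> H3" using P by simp
  have slice: "((\<lambda>K. ?t (f (b, K))) has_sum E1 b (act (\<alpha> i) P) s) (?R1 b)" if b: "b \<in> fibre a" for b
  proof -
    note bl = fibreD[OF b]
    have v: "component b w \<in> FS1 b" by (rule component_fixed[OF bl(1)]) (use w bl in simp)
    have "eis_coset \<Gamma>1 C1 chi b (component b w) s (act (\<alpha> i) P) K = ?t (f (b, K))" if K: "K \<in> ?R1 b" for K
    proof -
      have "?t (f (b, K)) = vec_nth (eis_term C psi a w s P (gam b \<otimes>\<^sub>P rep K \<otimes>\<^sub>P \<alpha> i)) i"
        unfolding f_def fst_conv snd_conv
        by (subst eis_coset_eq[OF G unitary_psi C a w _ P]) (use gm[OF b] rep_G[OF b K] in auto)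
      also have "\<dots> = eis_term C1 chi b (component b w) s (act (\<alpha> i) P) (rep K)"
        using eis_term_component[OF bl(1) rep(1)[OF b K] P] bl(2) by simp
      finally show ?thesis by (simp add: eis_coset_def rep_def)
    qed
    then show ?thesis
      using eisenstein_has_sum[OF G1 chi C1 bl(1) v E1[OF b] Q s] by (rule has_sum_cong[THEN iffD1])
  qed
  have "((\<lambda>b. E1 b (act (\<alpha> i) P) s) has_sum vec_nth (E P s) i) (fibre a)"
    by (rule has_sum_SigmaD[OF total slice])
  moreover have "((\<lambda>b. E1 b (act (\<alpha> i) P) s) has_sum (\<Sum>b\<in>fibre a. E1 b (act (\<alpha> i) P) s)) (fibre a)"
    by (rule has_sum_finite) simp
  ultimately show ?thesis by (rule has_sum_unique)
qed

end

section \<open>Constant terms\<close>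

text \<open>Since \<open>w m\<close> lies in the fixed space, the pairing absorbs the projection,
  and \<open>integral_parallelogram\<close> cancels the area. This leaves a scalar mean that can be
  moved between lattices.\<close>

lemma constant_term_cinner:
  fixes F :: "complex \<Rightarrow> 'v::fd_complex_inner"
  assumes G: "subgroup G PSL2C" and \<rho>: "unitary_rep G \<rho>" and C: "cusp_data_for G C" "b < num_cusps C"
    and B: "orthonormal_basis (fixed_space G C \<rho> b) k w" and m: "m < k"
    and cont: "continuous_on UNIV (\<lambda>z. cinner (F z) (w m))"
    and int: "(\<lambda>z. orth_proj (fixed_space G C \<rho> b) (F z)) integrable_on lattice_cell C b"
  shows "cusp_mean C b (\<lambda>z. cinner (F z) (w m))
    = cinner ((1 / lattice_area C b) *\<^sub>R integral (lattice_cell C b) (\<lambda>z. orth_proj (fixed_space G C \<rho> b) (F z))) (w m)"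
proof -
  let ?U = "fixed_space G C \<rho> b" and ?p = "scale C b" and ?q = "scale C b * modulus C b"
  have wU: "w l \<in> ?U" if "l < k" for l using B that by (simp add: orthonormal_basis_def)
  have proj: "cinner (orth_proj ?U v) (w m) = cinner v (w m)" for v
    by (rule orth_proj_cinner[OF B _ wU[OF m]]) (rule fixed_space_sum[OF G \<rho> C], simp add: wU)
  have cell: "lattice_cell C b = {x *\<^sub>R ?p + y *\<^sub>R ?q | x y. x \<in> {0..1} \<and> y \<in> {0..1}}"
    by (simp add: lattice_cell_def scaleR_conv_of_real algebra_simps)
  note area = integral_parallelogram[OF cont cusp_lattice_basis(2)[OF C], folded cell lattice_area_def]
  have "cinner (integral (lattice_cell C b) (\<lambda>z. orth_proj ?U (F z))) (w m)
      = integral (lattice_cell C b) ((\<lambda>x. cinner x (w m)) \<circ> (\<lambda>z. orth_proj ?U (F z)))"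
    by (rule integral_linear[OF int bounded_linear_cinner_left, symmetric])
  also have "\<dots> = lattice_area C b *\<^sub>R torus_mean ?p ?q (\<lambda>z. cinner (F z) (w m))"
    by (simp only: o_def proj area(1))
  finally show ?thesis using area(2) by (simp add: cinner_scaleR_left scaleR_conv_of_real)
qed

context induced_cusps
begin

text \<open>The number of cosets of \<open>\<Gamma>1\<close> in the double coset of
  \<open>b\<close>. It is the multiplicity of the component at \<open>b\<close> in inner products of
  fixed vectors in \<open>V\<^sup>n\<close>.\<close>

definition coset_count :: "nat \<Rightarrow> nat" where
  "coset_count b = card {i. \<exists>h\<in>\<Gamma>1. \<exists>\<delta>\<in>stab \<Gamma> (vertex C (below b)). \<alpha> i = h \<otimes>\<^sub>P psl_inv (gam b) \<otimes>\<^sub>P \<delta>}"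

text \<open>The summands on the left are permuted by the translations in \<open>\<Gamma>\<close>, and each of them is invariant
  under a sublattice; so the mean may be taken term by term over the sublattice, where it only depends on
  the double coset.\<close>

lemma mean_induced:
  fixes e :: "hpoint \<Rightarrow> 'a"
  assumes a: "a < num_cusps C" and w: "w \<in> FS a" and r: "r > 0"
    and aut: "\<And>h P. h \<in> \<Gamma>1 \<Longrightarrow> P \<in> H3 \<Longrightarrow> e (act h P) = chi h (e P)"
    and cont: "\<And>g v. g \<in> carrier PSL2C \<Longrightarrow> continuous_on UNIV (\<lambda>z. cinner (e (act g (z, r))) v)"
  shows "cusp_mean C a
      (\<lambda>z. \<Sum>i\<in>UNIV. cinner (e (act (\<alpha> i \<otimes>\<^sub>P psl_inv (chart C a)) (z, r))) (vec_nth w i))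
    = (\<Sum>b\<in>fibre a. of_nat (coset_count b) * cusp_mean C1 b
        (\<lambda>z. cinner (e (act (psl_inv (chart C1 b)) (z, r))) (component b w)))"
proof -
  note D = cusp_data_forD[OF C a]
  let ?B = "chart C a"
  define p q where "p = scale C a" and "q = scale C a * modulus C a"
  have L: "cusp_lattice C a = {of_int m * p + of_int k * q | m k. True}" and basis: "Im (cnj p * q) \<noteq> 0"
    using cusp_lattice_basis[OF C a] by (simp_all add: p_def q_def)
  have "p \<in> cusp_lattice C a" unfolding L by (intro CollectI exI[of _ 1] exI[of _ 0]) simp
  moreover have "q \<in> cusp_lattice C a" unfolding L by (intro CollectI exI[of _ 1] exI[of _ 0]) simp
  ultimately have pq: "p \<in> cusp_lattice C a" "q \<in> cusp_lattice C a" .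
  have H3: "(z, r) \<in> H3" for z using r by (simp add: H3_def)
  \<comment> \<open>The summand is defined for every \<open>x\<close> in \<open>\<Gamma>\<close>,
    not only for the representatives, so that it can be moved within a double coset to the inverse
    of \<open>gam b\<close>.\<close>
  define g where "g x z = cinner (e (act (x \<otimes>\<^sub>P psl_inv ?B) (z, r))) (extend w x)" for x z
  have g_left: "g (h \<otimes>\<^sub>P x) z = g x z" if h: "h \<in> \<Gamma>1" and x: "x \<in> \<Gamma>" for h x z
  proof -
    have "act (h \<otimes>\<^sub>P x \<otimes>\<^sub>P psl_inv ?B) (z, r) = act h (act (x \<otimes>\<^sub>P psl_inv ?B) (z, r))"
      using D(2) h x H3 by (simp add: PSL.m_assoc flip: act_mult)
    then show ?thesis using D(2) h x H3
      by (simp add: g_def ext_left aut unitary_repD(4)[OF chi])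
  qed
  have g_right: "\<exists>u c. u \<noteq> 0 \<and> (\<forall>x\<in>\<Gamma>. \<forall>z. g (x \<otimes>\<^sub>P \<delta>) z = g x (u * z + c))" if d: "\<delta> \<in> stab \<Gamma> (vertex C a)" for \<delta>
  proof -
    have dG: "\<delta> \<in> \<Gamma>" using d by (simp add: stab_def)
    obtain u c where u: "cmod u = 1" "\<And>z r. act (?B \<otimes>\<^sub>P \<delta> \<otimes>\<^sub>P psl_inv ?B) (z, r) = (u * z + c, r)"
      using stab_affine[OF C a G d] by metis
    have "g (x \<otimes>\<^sub>P \<delta>) z = g x (u * z + c)" if x: "x \<in> \<Gamma>" for x z
    proof -
      have "x \<otimes>\<^sub>P \<delta> \<otimes>\<^sub>P psl_inv ?B = (x \<otimes>\<^sub>P psl_inv ?B) \<otimes>\<^sub>P (?B \<otimes>\<^sub>P \<delta> \<otimes>\<^sub>P psl_inv ?B)"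
        using D(2) x dG by (simp add: PSL_word)
      then have "act (x \<otimes>\<^sub>P \<delta> \<otimes>\<^sub>P psl_inv ?B) (z, r) = act (x \<otimes>\<^sub>P psl_inv ?B) (act (?B \<otimes>\<^sub>P \<delta> \<otimes>\<^sub>P psl_inv ?B) (z, r))"
        using D(2) x dG act_mult[of "x \<otimes>\<^sub>P psl_inv ?B" "?B \<otimes>\<^sub>P \<delta> \<otimes>\<^sub>P psl_inv ?B" "(z, r)"] H3 by simp
      then show ?thesis by (simp add: g_def u ext_fixed[OF w d x])
    qed
    moreover have "u \<noteq> 0" using u(1) by auto
    ultimately show ?thesis by blast
  qed
  have transl_stab: "conj_transl ?B t \<in> stab \<Gamma> (vertex C a)" if "t \<in> cusp_lattice C a" for t
    using that bact_conj_transl[OF D(2)] unfolding transl_set_chart[OF G C a, symmetric]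
    by (simp add: stab_def transl_set_def D(3))
  have g_transl: "g (x \<otimes>\<^sub>P conj_transl ?B t) z = g x (z + t)" if t: "t \<in> cusp_lattice C a" and x: "x \<in> \<Gamma>" for t x z
  proof -
    have "x \<otimes>\<^sub>P conj_transl ?B t \<otimes>\<^sub>P psl_inv ?B = (x \<otimes>\<^sub>P psl_inv ?B) \<otimes>\<^sub>P transl t"
      using D(2) x by (simp add: conj_transl_def PSL_word)
    then have "act (x \<otimes>\<^sub>P conj_transl ?B t \<otimes>\<^sub>P psl_inv ?B) (z, r) = act (x \<otimes>\<^sub>P psl_inv ?B) (z + t, r)"
      using D(2) x H3 by (simp add: act_mult) (simp add: transl_def act_translation[unfolded act_psl_class])
    then show ?thesis by (simp add: g_def ext_fixed[OF w transl_stab[OF t] x])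
  qed
  define N where "N = (of_nat index :: complex)"
  have N: "N \<noteq> 0" using index_pos by (simp add: N_def)
  have g_per: "g x (z + N * t) = g x z" if t: "t \<in> cusp_lattice C a" and x: "x \<in> \<Gamma>" for t x z
  proof -
    let ?k = "conj_transl ?B (N * t)"
    have Nt: "N * t \<in> transl_set \<Gamma>1 ?B"
      using index_transl[OF D(2)] t unfolding transl_set_chart[OF G C a] N_def by blast
    then have k: "?k \<in> \<Gamma>1" by (simp add: transl_set_def)
    have "N * t \<in> cusp_lattice C a"
      using Nt transl_set_mono unfolding transl_set_chart[OF G C a, symmetric] by blast
    from g_transl[OF this x] have "g x (z + N * t) = g (x \<otimes>\<^sub>P ?k) z" by simp
    \<comment> \<open>Normality: moved to the left of \<open>x\<close>, the translation stays in
      \<open>\<Gamma>1\<close> and is absorbed by equivariance. Hence one sublattice serves all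
      cosets.\<close>
    also have "x \<otimes>\<^sub>P ?k = (x \<otimes>\<^sub>P ?k \<otimes>\<^sub>P psl_inv x) \<otimes>\<^sub>P x" using x k by (simp add: PSL_word)
    also have "g \<dots> z = g x z" by (rule g_left[OF conj_closed(1)[OF x k] x])
    finally show ?thesis .
  qed
  have cont_g: "continuous_on UNIV (g x)" if "x \<in> \<Gamma>" for x
    unfolding g_def by (rule cont) (use that D(2) in simp)
  have basis_N: "Im (cnj (N * p) * (N * q)) \<noteq> 0"
  proof -
    have "cnj (N * p) * (N * q) = of_real ((real index)\<^sup>2) * (cnj p * q)"
      by (simp add: N_def power2_eq_square)
    then have "Im (cnj (N * p) * (N * q)) = (real index)\<^sup>2 * Im (cnj p * q)" by (simp only: Im_of_real_mult)
    then show ?thesis using basis index_pos by simp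
  qed
  define m where "m x = torus_mean (N * p) (N * q) (g x)" for x
  define F where "F z = (\<Sum>i\<in>UNIV. g (\<alpha> i) z)" for z
  have F_per: "F (z + t) = F z" if t: "t \<in> cusp_lattice C a" for z t
  proof -
    have "F (z + t) = (\<Sum>i\<in>UNIV. g (\<alpha> i \<otimes>\<^sub>P conj_transl ?B t) z)" by (simp add: F_def g_transl[OF t])
    also have "\<dots> = F z"
      unfolding F_def by (rule coset_sum_shift) (use g_left transl_stab[OF t] in \<open>auto simp: stab_def\<close>)
    finally show ?thesis .
  qed
  have cont_F: "continuous_on UNIV F" unfolding F_def by (intro continuous_on_sum cont_g) simp
  have "torus_mean p q F = torus_mean (N * p) (N * q) F"
  proof (rule torus_mean_unique[OF cont_F])
    show "F (z + N * p) = F z" "F (z + N * q) = F z" for z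
      using pq by (simp_all add: F_def g_per)
  qed (use pq F_per basis basis_N in auto)
  also have "\<dots> = (\<Sum>i\<in>UNIV. m (\<alpha> i))"
    unfolding F_def m_def by (rule torus_mean_sum) (simp_all add: cont_g)
  finally have mean_F: "torus_mean p q F = (\<Sum>i\<in>UNIV. m (\<alpha> i))" .
  have m_left: "m (h \<otimes>\<^sub>P x) = m x" if "h \<in> \<Gamma>1" "x \<in> \<Gamma>" for h x
  proof -
    have "g (h \<otimes>\<^sub>P x) = g x" using g_left[OF that] by (simp add: fun_eq_iff)
    then show ?thesis by (simp add: m_def)
  qed
  have m_right: "m (x \<otimes>\<^sub>P \<delta>) = m x" if d: "\<delta> \<in> stab \<Gamma> (vertex C a)" and x: "x \<in> \<Gamma>" for x \<delta>
  proof -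
    obtain u c where u: "u \<noteq> 0" "\<And>z. g (x \<otimes>\<^sub>P \<delta>) z = g x (u * z + c)" using g_right[OF d] x by blast
    have xd: "x \<otimes>\<^sub>P \<delta> \<in> \<Gamma>" using x d by (simp add: stab_def)
    have "m (x \<otimes>\<^sub>P \<delta>) = torus_mean (N * p) (N * q) (\<lambda>z. g x (u * z + c))"
      unfolding m_def u(2)[symmetric] ..
    also have "\<dots> = m x"
      unfolding m_def
      by (rule torus_mean_affine[OF cont_g[OF x] u(1)])
        (use g_per[OF pq(1)] g_per[OF pq(2)] xd x basis_N in \<open>simp_all flip: u(2)\<close>)
    finally show ?thesis .
  qed
  define I where "I b = {i. \<exists>h\<in>\<Gamma>1. \<exists>\<delta>\<in>stab \<Gamma> (vertex C (below b)). \<alpha> i = h \<otimes>\<^sub>P psl_inv (gam b) \<otimes>\<^sub>P \<delta>}" for b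
  have UN: "(\<Union>b\<in>fibre a. I b) = UNIV"
  proof (intro equalityI subsetI UNIV_I)
    fix i
    obtain b h \<delta> where "b < num_cusps C1" "below b = a" "h \<in> \<Gamma>1" "\<delta> \<in> stab \<Gamma> (vertex C a)"
      "\<alpha> i = h \<otimes>\<^sub>P psl_inv (gam b) \<otimes>\<^sub>P \<delta>" using double_coset[OF a alpha_in] by metis
    then show "i \<in> (\<Union>b\<in>fibre a. I b)" by (auto simp: I_def fibre_def)
  qed
  have disj: "I b \<inter> I b' = {}" if b: "b \<in> fibre a" "b' \<in> fibre a" "b \<noteq> b'" for b b'
  proof (rule ccontr)
    assume "I b \<inter> I b' \<noteq> {}"
    then obtain i h h' \<delta> \<delta>' where *: "h \<in> \<Gamma>1" "h' \<in> \<Gamma>1" "\<delta> \<in> stab \<Gamma> (vertex C (below b))" "\<delta>' \<in> stab \<Gamma> (vertex C (below b'))"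
      "\<alpha> i = h \<otimes>\<^sub>P psl_inv (gam b) \<otimes>\<^sub>P \<delta>" "\<alpha> i = h' \<otimes>\<^sub>P psl_inv (gam b') \<otimes>\<^sub>P \<delta>'" unfolding I_def by blast
    have "b = b'"
      by (rule double_coset_unique[OF fibreD(1)[OF b(1)] fibreD(1)[OF b(2)] *(1-4)])
        (use fibreD(2)[OF b(1)] fibreD(2)[OF b(2)] *(5,6) in simp_all)
    with b(3) show False by simp
  qed
  have m_I: "m (\<alpha> i) = m (psl_inv (gam b))" if b: "b \<in> fibre a" and i: "i \<in> I b" for b i
  proof -
    obtain h \<delta> where *: "h \<in> \<Gamma>1" "\<delta> \<in> stab \<Gamma> (vertex C a)" "\<alpha> i = h \<otimes>\<^sub>P psl_inv (gam b) \<otimes>\<^sub>P \<delta>"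
      using i fibreD(2)[OF b] by (auto simp: I_def)
    have gb: "psl_inv (gam b) \<in> \<Gamma>" using gam(1)[OF fibreD(1)[OF b]] by simp
    have "h \<otimes>\<^sub>P psl_inv (gam b) \<in> \<Gamma>" using gb G1_sub[OF *(1)] by simp
    then show ?thesis unfolding *(3) using m_right[OF *(2)] m_left[OF *(1) gb] by simp
  qed
  \<comment> \<open>At the inverse of \<open>gam b\<close> the summand becomes a function in the
    chart of \<open>b\<close>, composed with the transition map between the charts. This function is
    periodic for the full lattice of \<open>\<Gamma>1\<close> at \<open>b\<close>, so the mean
    passes from the multiples by \<open>N\<close> to that lattice.\<close>
  have m_gam: "m (psl_inv (gam b)) = cusp_mean C1 b
        (\<lambda>z. cinner (e (act (psl_inv (chart C1 b)) (z, r))) (component b w))" if b: "b \<in> fibre a" for b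
  proof -
    note bl = fibreD[OF b]
    note D1 = cusp_data_forD[OF C1 bl(1)]
    let ?B1 = "chart C1 b"
    have gb: "psl_inv (gam b) \<in> \<Gamma>" using gam(1)[OF bl(1)] by simp
    define H where "H z = cinner (e (act (psl_inv ?B1) (z, r))) (component b w)" for z
    have cont_H: "continuous_on UNIV H" unfolding H_def by (rule cont) (use D1(2) in simp)
    obtain u c where u: "cmod u = 1"
      "\<And>z r. r > 0 \<Longrightarrow> act (psl_inv (gam b) \<otimes>\<^sub>P psl_inv (chart C (below b))) (z, r) = act (psl_inv ?B1) (u * z + c, r)"
      using chart_change[OF bl(1)] by metis
    have gH: "g (psl_inv (gam b)) z = H (u * z + c)" for z
      using u(2)[OF r, of z] bl(2) by (simp add: g_def H_def component_def)
    have H_per: "H (z + t) = H z" if t: "t \<in> cusp_lattice C1 b" for t z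
    proof -
      let ?k = "conj_transl ?B1 t"
      have k: "?k \<in> \<Gamma>1" using t unfolding transl_set_chart[OF G1 C1 bl(1), symmetric] by (simp add: transl_set_def)
      have "?k \<in> stab \<Gamma>1 (vertex C1 b)" using k bact_conj_transl[OF D1(2)] by (simp add: stab_def D1(3))
      then have fixed: "chi ?k (component b w) = component b w"
        using component_fixed[OF bl(1)] w bl(2) by (auto simp: fixed_space_def)
      have "act (psl_inv ?B1) (z + t, r) = act (psl_inv ?B1 \<otimes>\<^sub>P transl t) (z, r)"
        using D1(2) H3 by (simp add: act_mult) (simp add: transl_def act_translation[unfolded act_psl_class])
      also have "psl_inv ?B1 \<otimes>\<^sub>P transl t = ?k \<otimes>\<^sub>P psl_inv ?B1"
        using D1(2) by (simp add: conj_transl_def PSL_word)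
      also have "act \<dots> (z, r) = act ?k (act (psl_inv ?B1) (z, r))"
        using D1(2) k H3 by (simp add: act_mult)
      finally have "H (z + t) = cinner (chi ?k (e (act (psl_inv ?B1) (z, r)))) (chi ?k (component b w))"
        using D1(2) k H3 by (simp add: H_def aut fixed)
      then show ?thesis by (simp add: unitary_repD(4)[OF chi k] H_def)
    qed
    let ?p = "scale C1 b" and ?q = "scale C1 b * modulus C1 b"
    have "?p \<in> cusp_lattice C1 b"
      unfolding cusp_lattice_basis(1)[OF C1 bl(1)] by (intro CollectI exI[of _ 1] exI[of _ 0]) simp
    moreover have "?q \<in> cusp_lattice C1 b"
      unfolding cusp_lattice_basis(1)[OF C1 bl(1)] by (intro CollectI exI[of _ 1] exI[of _ 0]) simp
    ultimately have pq1: "?p \<in> cusp_lattice C1 b" "?q \<in> cusp_lattice C1 b" .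
    have "m (psl_inv (gam b)) = torus_mean (N * p) (N * q) (\<lambda>z. H (u * z + c))"
      unfolding m_def gH[symmetric] ..
    also have "\<dots> = torus_mean ?p ?q H"
    proof (rule torus_mean_affine[OF cont_H])
      show "u \<noteq> 0" using u(1) by auto
      show "H (u * (z + N * p) + c) = H (u * z + c)" "H (u * (z + N * q) + c) = H (u * z + c)" for z
        using g_per[OF pq(1) gb, of z] g_per[OF pq(2) gb, of z] by (simp_all only: gH)
    qed (use H_per pq1 basis_N cusp_lattice_basis(2)[OF C1 bl(1)] in auto)
    finally show ?thesis by (simp only: H_def[abs_def])
  qed
  have "torus_mean p q F = (\<Sum>b\<in>fibre a. \<Sum>i\<in>I b. m (\<alpha> i))"
    unfolding mean_F UN[symmetric] by (rule sum.UNION_disjoint) (use disj in auto)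
  also have "\<dots> = (\<Sum>b\<in>fibre a. of_nat (coset_count b) * m (psl_inv (gam b)))"
    by (intro sum.cong refl) (simp add: m_I coset_count_def I_def[symmetric])
  also have "\<dots> = (\<Sum>b\<in>fibre a. of_nat (coset_count b) * cusp_mean C1 b
        (\<lambda>z. cinner (e (act (psl_inv (chart C1 b)) (z, r))) (component b w)))"
    by (intro sum.cong refl) (simp add: m_gam)
  finally show ?thesis
    by (simp add: F_def[abs_def] g_def ext_alpha p_def q_def)
qed

end

section \<open>Scattering determinants\<close>

text \<open>The right inverse \<open>B\<close> and the left inverse \<open>D\<close> coincide, so
  \<open>B * A\<close> is an identity matrix as well. The traces of \<open>A * B\<close> and
  \<open>B * A\<close> are equal, which gives \<open>n = m\<close> in characteristic 0; only then
  can the determinants of the factors be multiplied.\<close>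

lemma det_similar_inverses:
  fixes A :: "complex Matrix.mat"
  assumes A: "A \<in> carrier_mat n m" and B: "B \<in> carrier_mat m n" and D: "D \<in> carrier_mat m n"
    and S: "S \<in> carrier_mat m m" and AB: "A * B = 1\<^sub>m n" and DA: "D * A = 1\<^sub>m m"
  shows "Determinant.det (A * S * B) = Determinant.det S"
proof -
  have "B = (D * A) * B" using B by (simp add: DA)
  also have "\<dots> = D" using A B D by (simp add: assoc_mult_mat[OF D A B] AB)
  finally have BA: "B * A = 1\<^sub>m m" using DA by simp
  have "(\<Sum>i<n. (A * B) $$ (i, i)) = (\<Sum>i<n. \<Sum>j<m. A $$ (i, j) * B $$ (j, i))"
    using A B by (intro sum.cong refl) (simp add: scalar_prod_def atLeast0LessThan)
  also have "\<dots> = (\<Sum>j<m. \<Sum>i<n. B $$ (j, i) * A $$ (i, j))"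
    by (subst sum.swap) (simp add: mult.commute)
  also have "\<dots> = (\<Sum>j<m. (B * A) $$ (j, j))"
    using A B by (intro sum.cong refl) (simp add: scalar_prod_def atLeast0LessThan)
  finally have "of_nat n = (of_nat m :: complex)" by (simp add: AB BA)
  then have nm: "n = m" by simp
  have "Determinant.det A * Determinant.det B = 1"
    using det_mult[of A n B] A B AB nm by simp
  moreover have "Determinant.det (A * S * B) = Determinant.det A * Determinant.det S * Determinant.det B"
    using A B S nm det_mult[of "A * S" m B] det_mult[of A m S] by simp
  ultimately show ?thesis by (simp add: mult.commute mult.left_commute)
qed

lemma sum_scattering_index:
  "(\<Sum>j<length (scattering_index C k). f (scattering_index C k ! j)) = (\<Sum>a<num_cusps C. \<Sum>l<k a. f (a, l))"
proof -
  have "sum_list (map f (concat (map (\<lambda>a. map (Pair a) [0..<k a]) [0..<n]))) = (\<Sum>a<n. \<Sum>l<k a. f (a, l))" for n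
    by (induction n) (simp_all add: o_def interv_sum_list_conv_sum_set_nat atLeast0LessThan)
  then have "sum_list (map f (scattering_index C k)) = (\<Sum>a<num_cusps C. \<Sum>l<k a. f (a, l))"
    by (simp add: scattering_index_def)
  then show ?thesis by (simp add: sum_list_sum_nth atLeast0LessThan)
qed

lemma scattering_index_nth:
  assumes "j < length (scattering_index C k)"
  shows "fst (scattering_index C k ! j) < num_cusps C"
    "snd (scattering_index C k ! j) < k (fst (scattering_index C k ! j))"
proof -
  have "scattering_index C k ! j \<in> set (scattering_index C k)" using assms by simp
  then show "fst (scattering_index C k ! j) < num_cusps C"
    "snd (scattering_index C k ! j) < k (fst (scattering_index C k ! j))"
    by (auto simp: scattering_index_def)
qed

lemma distinct_scattering_index: "distinct (scattering_index C k)"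
proof -
  have "distinct (concat (map (\<lambda>a. map (Pair a) [0..<k a]) [0..<n]))" for n
    by (induction n) (auto simp: distinct_map inj_on_def)
  then show ?thesis by (simp add: scattering_index_def)
qed

abbreviation "constant_term_eq G C \<rho> k w S a l b E r s \<equiv>
  (let f = (\<lambda>z. orth_proj (fixed_space G C \<rho> b) (E (act (psl_inv (chart C b)) (z, r)) s))
   in f integrable_on lattice_cell C b \<and>
      (1 / lattice_area C b) *\<^sub>R integral (lattice_cell C b) f
      = (if a = b then (complex_of_real r powr (1 + s)) *\<^sub>C w a l else 0)
        + (complex_of_real r powr (1 - s)) *\<^sub>C (\<Sum>m<k b. S a l b m s *\<^sub>C w b m))"

text \<open>Pairing with \<open>w b m\<close> singles out one matrix entry by orthonormality, in a
  form in which the vector spaces of the two groups no longer matter.\<close>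

lemma scattering_constant_term:
  fixes \<rho> :: "psl \<Rightarrow> 'v::fd_complex_inner \<Rightarrow> 'v"
  assumes G: "subgroup G PSL2C" and \<rho>: "unitary_rep G \<rho>" and C: "cusp_data_for G C"
    and ON: "\<And>a. a < num_cusps C \<Longrightarrow> orthonormal_basis (fixed_space G C \<rho> a) (k a) (w a)"
    and E: "eisenstein_series G C \<rho> a (w a l) E"
    and al: "a < num_cusps C" "l < k a" and bm: "b < num_cusps C" "m < k b" and r: "r > 0" and s: "Re s > 1"
    and CT: "constant_term_eq G C \<rho> k w S a l b E r s"
  shows "cusp_mean C b (\<lambda>z. cinner (E (act (psl_inv (chart C b)) (z, r)) s) (w b m))
    = (if (a, l) = (b, m) then complex_of_real r powr (1 + s) else 0) + complex_of_real r powr (1 - s) * S a l b m s"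
proof -
  have w: "w a l \<in> fixed_space G C \<rho> a" using ON[OF al(1)] al(2) by (simp add: orthonormal_basis_def)
  have cont: "continuous_on UNIV (\<lambda>z. cinner (E (act (psl_inv (chart C b)) (z, r)) s) (w b m))"
    by (rule eisenstein_cinner_continuous[OF G \<rho> C al(1) w E s _ r]) (simp add: cusp_data_forD(2)[OF C bm(1)])
  have "(\<Sum>m'<k b. S a l b m' s * cinner (w b m') (w b m)) = (\<Sum>m'<k b. S a l b m' s * (if m' = m then 1 else 0))"
    by (intro sum.cong refl) (simp add: orthonormal_basis_cinner[OF ON[OF bm(1)]] bm(2))
  also have "\<dots> = S a l b m s" using bm(2) by (simp add: if_distrib cong: if_cong)
  finally have sum: "(\<Sum>m'<k b. S a l b m' s * cinner (w b m') (w b m)) = S a l b m s" .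
  have delta: "cinner (if a = b then (complex_of_real r powr (1 + s)) *\<^sub>C w a l else 0) (w b m)
      = (if (a, l) = (b, m) then complex_of_real r powr (1 + s) else 0)"
    using al(2) bm(2) orthonormal_basis_cinner[OF ON[OF bm(1)], of l m]
    by (cases "a = b") (auto simp: cinner_scaleC_left)
  note CT' = CT[unfolded Let_def]
  show ?thesis
    unfolding constant_term_cinner[OF G \<rho> C bm(1) ON[OF bm(1)] bm(2) cont conjunct1[OF CT']] conjunct2[OF CT']
    by (simp only: cinner_add_left delta cinner_scaleC_left cinner_sum_left sum)
qed

text \<open>Two values of \<open>r\<close> suffice. At \<open>r = 1\<close> both powers are 1; at
  \<open>r = 2\<close> their absolute values differ because \<open>Re s > 0\<close>, so the linear
  system is nonsingular.\<close>

lemma powr_coefficients_unique: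
  assumes s: "Re s > 1"
    and eq: "\<And>r. r > 0 \<Longrightarrow> complex_of_real r powr (1 + s) * a + complex_of_real r powr (1 - s) * b
      = complex_of_real r powr (1 + s) * c + complex_of_real r powr (1 - s) * d"
  shows "a = c" "b = d"
proof -
  define u v where "u = complex_of_real 2 powr (1 + s)" and "v = complex_of_real 2 powr (1 - s)"
  have 1: "a + b = c + d" using eq[of 1] by simp
  have 2: "u * a + v * b = u * c + v * d" using eq[of 2] by (simp add: u_def v_def)
  have "cmod u = 2 powr (1 + Re s)" "cmod v = 2 powr (1 - Re s)"
    unfolding u_def v_def by (subst norm_powr_real_powr; simp)+
  moreover have "(2::real) powr (1 - Re s) < 2 powr (1 + Re s)" using s by (intro powr_less_mono) auto
  ultimately have "u \<noteq> v" by (metis less_irrefl)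
  moreover have "(u - v) * (a - c) = 0"
  proof -
    have "b = c + d - a" using 1 by (simp add: algebra_simps)
    with 2 show ?thesis by (simp add: algebra_simps)
  qed
  ultimately show "a = c" by simp
  with 1 show "b = d" by simp
qed

section \<open>Constant terms of the two groups compared\<close>

context induced_cusps
begin

text \<open>The components of both vectors are expanded in the bases \<open>w1\<close>. Those of
  \<open>v\<close> enter linearly through the Eisenstein series, those of \<open>v'\<close> through
  the second argument of \<open>cinner\<close>, whence the conjugate; the count comes from
  \<open>mean_induced\<close>.\<close>

lemma scattering_relation:
  fixes w :: "nat \<Rightarrow> nat \<Rightarrow> 'a ^ 'b"
  assumes ON1: "\<And>b. b < num_cusps C1 \<Longrightarrow> orthonormal_basis (FS1 b) (k1 b) (w1 b)"
    and E1: "\<And>b l. b < num_cusps C1 \<Longrightarrow> l < k1 b \<Longrightarrow> eisenstein_series \<Gamma>1 C1 chi b (w1 b l) (E1 b l)"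
    and a: "a < num_cusps C" "v \<in> FS a" and E: "eisenstein_series \<Gamma> C psi a v E"
    and a': "a' < num_cusps C" "v' \<in> FS a'"
    and r: "r > 0" and s: "Re s > 1"
  shows "cusp_mean C a' (\<lambda>z. cinner (E (act (psl_inv (chart C a')) (z, r)) s) v')
    = (\<Sum>b'\<in>fibre a'. \<Sum>m<k1 b'. \<Sum>b\<in>fibre a. \<Sum>l<k1 b.
        of_nat (coset_count b') * cnj (cinner (component b' v') (w1 b' m)) * (cinner (component b v) (w1 b l) *
        cusp_mean C1 b'
          (\<lambda>z. cinner (E1 b l (act (psl_inv (chart C1 b')) (z, r)) s) (w1 b' m))))"
proof -
  define c where "c b l = cinner (component b v) (w1 b l)" for b l
  \<comment> \<open>The single function \<open>e\<close> encodes all components: the one of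
    \<open>E\<close> with index \<open>i\<close> is \<open>e\<close> at the image of the point under
    \<open>\<alpha> i\<close>. This is the form that \<open>mean_induced\<close> expects.\<close>
  define e where "e Q = (\<Sum>b\<in>fibre a. \<Sum>l<k1 b. c b l *\<^sub>C E1 b l Q s)" for Q
  have w1: "w1 b l \<in> FS1 b" if "b < num_cusps C1" "l < k1 b" for b l
    using ON1[OF that(1)] that(2) by (simp add: orthonormal_basis_def)
  have cont1: "continuous_on UNIV (\<lambda>z. cinner (E1 b l (act g (z, r)) s) y)"
    if "b < num_cusps C1" "l < k1 b" "g \<in> carrier PSL2C" for b l g y
    by (rule eisenstein_cinner_continuous[OF G1 chi C1 that(1) w1[OF that(1,2)] E1[OF that(1,2)] s that(3) r])
  have E1_sum: "eisenstein_series \<Gamma>1 C1 chi b (component b v) (\<lambda>P s. \<Sum>l<k1 b. c b l *\<^sub>C E1 b l P s)"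
    if b: "b \<in> fibre a" for b
  proof -
    note bl = fibreD[OF b]
    have "component b v \<in> FS1 b" by (rule component_fixed[OF bl(1)]) (use a bl in simp)
    then have "component b v = (\<Sum>l<k1 b. c b l *\<^sub>C w1 b l)"
      unfolding c_def by (rule orthonormal_basis_expand[OF ON1[OF bl(1)]])
    moreover have "eisenstein_series \<Gamma>1 C1 chi b (\<Sum>l<k1 b. c b l *\<^sub>C w1 b l) (\<lambda>P s. \<Sum>l<k1 b. c b l *\<^sub>C E1 b l P s)"
      by (rule eisenstein_series_sum[OF G1 chi C1 bl(1)]) (use w1 E1 bl in auto)
    ultimately show ?thesis by simp
  qed
  have E_e: "vec_nth (E P s) i = e (act (\<alpha> i) P)" if "P \<in> H3" for P i
    unfolding e_def
    by (rule eisenstein_induced[OF a E _ that s, where ?E1.0 = "\<lambda>b P s. \<Sum>l<k1 b. c b l *\<^sub>C E1 b l P s"])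
      (rule E1_sum)
  have aut: "e (act h P) = chi h (e P)" if h: "h \<in> \<Gamma>1" and P: "P \<in> H3" for h P
  proof -
    have lin: "linear (chi h)" by (rule bounded_linear.linear[OF unitary_rep_bounded_linear[OF chi h]])
    have "E1 b l (act h P) s = chi h (E1 b l P s)" if "b \<in> fibre a" "l < k1 b" for b l
      by (rule eisenstein_automorphic[OF G1 chi C1 _ w1 E1 P s h]) (use that in \<open>auto simp: fibre_def\<close>)
    then show ?thesis
      by (simp add: e_def linear_sum[OF lin] unitary_repD(2)[OF chi h])
  qed
  have cont: "continuous_on UNIV (\<lambda>z. cinner (e (act g (z, r))) y)" if g: "g \<in> carrier PSL2C" for g y
    unfolding e_def cinner_sum_left cinner_scaleC_left
    by (intro continuous_on_sum continuous_on_mult continuous_on_const cont1 g) (auto simp: fibre_def)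
  have H3: "(z, r) \<in> H3" for z using r by (simp add: H3_def)
  note B = cusp_data_forD(2)[OF C a'(1)]
  have "cinner (E (act (psl_inv (chart C a')) (z, r)) s) v'
      = (\<Sum>i\<in>UNIV. cinner (e (act (\<alpha> i \<otimes>\<^sub>P psl_inv (chart C a')) (z, r))) (vec_nth v' i))" for z
    using B H3 by (simp add: cinner_vec_def E_e act_mult)
  then have "cusp_mean C a' (\<lambda>z. cinner (E (act (psl_inv (chart C a')) (z, r)) s) v')
    = (\<Sum>b'\<in>fibre a'. of_nat (coset_count b') * cusp_mean C1 b'
        (\<lambda>z. cinner (e (act (psl_inv (chart C1 b')) (z, r))) (component b' v')))"
    using mean_induced[OF a' r aut cont] by simp
  also have "\<dots> = (\<Sum>b'\<in>fibre a'. \<Sum>m<k1 b'. \<Sum>b\<in>fibre a. \<Sum>l<k1 b.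
        of_nat (coset_count b') * cnj (cinner (component b' v') (w1 b' m)) * (c b l *
        cusp_mean C1 b'
          (\<lambda>z. cinner (E1 b l (act (psl_inv (chart C1 b')) (z, r)) s) (w1 b' m))))"
  proof (intro sum.cong refl)
    fix b' assume b': "b' \<in> fibre a'"
    note bl = fibreD[OF b']
    let ?p = "scale C1 b'" and ?q = "scale C1 b' * modulus C1 b'"
    define x where "x m = cinner (component b' v') (w1 b' m)" for m
    have g: "psl_inv (chart C1 b') \<in> carrier PSL2C" using cusp_data_forD(2)[OF C1 bl(1)] by simp
    have "component b' v' \<in> FS1 b'" by (rule component_fixed[OF bl(1)]) (use a' bl in simp)
    then have exp: "component b' v' = (\<Sum>m<k1 b'. x m *\<^sub>C w1 b' m)"
      unfolding x_def by (rule orthonormal_basis_expand[OF ON1[OF bl(1)]])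
    have "torus_mean ?p ?q (\<lambda>z. cinner (e (act (psl_inv (chart C1 b')) (z, r))) (component b' v'))
      = torus_mean ?p ?q (\<lambda>z. \<Sum>m<k1 b'. \<Sum>b\<in>fibre a. \<Sum>l<k1 b.
          cnj (x m) * (c b l * cinner (E1 b l (act (psl_inv (chart C1 b')) (z, r)) s) (w1 b' m)))"
      by (simp only: exp cinner_sum_right cinner_scaleC_right)
        (simp only: e_def cinner_sum_left cinner_scaleC_left sum_distrib_left)
    also have "\<dots> = (\<Sum>m<k1 b'. torus_mean ?p ?q (\<lambda>z. \<Sum>b\<in>fibre a. \<Sum>l<k1 b.
          cnj (x m) * (c b l * cinner (E1 b l (act (psl_inv (chart C1 b')) (z, r)) s) (w1 b' m))))"
      by (intro torus_mean_sum continuous_on_sum continuous_on_mult continuous_on_const cont1 g) (auto simp: fibre_def)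
    also have "\<dots> = (\<Sum>m<k1 b'. \<Sum>b\<in>fibre a. torus_mean ?p ?q (\<lambda>z. \<Sum>l<k1 b.
          cnj (x m) * (c b l * cinner (E1 b l (act (psl_inv (chart C1 b')) (z, r)) s) (w1 b' m))))"
      by (intro sum.cong refl torus_mean_sum continuous_on_sum continuous_on_mult continuous_on_const cont1 g) (auto simp: fibre_def)
    also have "\<dots> = (\<Sum>m<k1 b'. \<Sum>b\<in>fibre a. \<Sum>l<k1 b. torus_mean ?p ?q (\<lambda>z.
          cnj (x m) * (c b l * cinner (E1 b l (act (psl_inv (chart C1 b')) (z, r)) s) (w1 b' m))))"
      by (intro sum.cong refl torus_mean_sum continuous_on_mult continuous_on_const cont1 g) (auto simp: fibre_def)
    finally show "of_nat (coset_count b') * torus_mean ?p ?q (\<lambda>z. cinner (e (act (psl_inv (chart C1 b')) (z, r))) (component b' v'))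
      = (\<Sum>m<k1 b'. \<Sum>b\<in>fibre a. \<Sum>l<k1 b. of_nat (coset_count b') * cnj (cinner (component b' v') (w1 b' m)) * (c b l *
        torus_mean ?p ?q (\<lambda>z. cinner (E1 b l (act (psl_inv (chart C1 b')) (z, r)) s) (w1 b' m))))"
      by (simp add: torus_mean_mult sum_distrib_left x_def mult.assoc)
  qed
  finally show ?thesis by (simp add: c_def)
qed

end

lemma orthonormal_basis_component:
  assumes B: "orthonormal_basis U k w" and w: "w' \<in> U"
    and lin: "\<And>c. f (\<Sum>l<k. c l *\<^sub>C w l) = (\<Sum>l<k. c l * f (w l))"
  shows "(\<Sum>l<k. cinner w' (w l) * f (w l)) = f w'"
  using lin[of "\<lambda>l. cinner w' (w l)"] orthonormal_basis_expand[OF B w] by simp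

lemma double_sum_linear:
  fixes u v :: complex
  shows "(\<Sum>b\<in>B. \<Sum>m\<in>M b. (u * f b m + v * g b m) * h b m)
    = u * (\<Sum>b\<in>B. \<Sum>m\<in>M b. f b m * h b m) + v * (\<Sum>b\<in>B. \<Sum>m\<in>M b. g b m * h b m)"
  by (simp add: distrib_right sum.distrib sum_distrib_left mult.assoc)

lemma mat_mult_entry:
  assumes "A \<in> carrier_mat n m" "B \<in> carrier_mat m p" "i < n" "j < p"
  shows "(A * B) $$ (i, j) = (\<Sum>t<m. A $$ (i, t) * B $$ (t, j))"
  using assms by (simp add: scalar_prod_def atLeast0LessThan)

lemma scattering_matrixE:
  assumes "scattering_matrix G C \<rho> k w S"
  obtains E where
    "\<forall>a<num_cusps C. orthonormal_basis (fixed_space G C \<rho> a) (k a) (w a)"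
    "\<forall>a<num_cusps C. \<forall>l<k a. eisenstein_series G C \<rho> a (w a l) (E a l)"
    "\<forall>a<num_cusps C. \<forall>l<k a. \<forall>b<num_cusps C. \<forall>r>0. \<forall>s. Re s > 1 \<longrightarrow>
             constant_term_eq G C \<rho> k w S a l b (E a l) r s"
  using assms unfolding scattering_matrix_def by (elim conjE exE, intro that) assumption+

section \<open>The matrix identity on the half-plane of convergence\<close>

context induced_cusps
begin

lemma scattering_det_eq:
  fixes w :: "nat \<Rightarrow> nat \<Rightarrow> 'a ^ 'b"
  assumes SM1: "scattering_matrix \<Gamma>1 C1 chi k1 w1 S1" and SM: "scattering_matrix \<Gamma> C psi k w S" and s: "Re s > 1"
  shows "scattering_det C1 k1 S1 s = scattering_det C k S s"
proof -
  obtain E1 where SM1':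
    "\<forall>a<num_cusps C1. orthonormal_basis (FS1 a) (k1 a) (w1 a)"
    "\<forall>a<num_cusps C1. \<forall>l<k1 a. eisenstein_series \<Gamma>1 C1 chi a (w1 a l) (E1 a l)"
    "\<forall>a<num_cusps C1. \<forall>l<k1 a. \<forall>b<num_cusps C1. \<forall>r>0. \<forall>s. Re s > 1 \<longrightarrow>
             constant_term_eq \<Gamma>1 C1 chi k1 w1 S1 a l b (E1 a l) r s"
    by (rule scattering_matrixE[OF SM1])
  obtain E where SM':
    "\<forall>a<num_cusps C. orthonormal_basis (FS a) (k a) (w a)"
    "\<forall>a<num_cusps C. \<forall>l<k a. eisenstein_series \<Gamma> C psi a (w a l) (E a l)"
    "\<forall>a<num_cusps C. \<forall>l<k a. \<forall>b<num_cusps C. \<forall>r>0. \<forall>s. Re s > 1 \<longrightarrow>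
             constant_term_eq \<Gamma> C psi k w S a l b (E a l) r s"
    by (rule scattering_matrixE[OF SM])
  note ON1 = SM1'(1)[rule_format] and E1 = SM1'(2)[rule_format] and CT1 = SM1'(3)
  note ON = SM'(1)[rule_format] and E = SM'(2)[rule_format] and CT = SM'(3)
  have ct1: "cusp_mean C1 b' (\<lambda>z. cinner (E1 b l (act (psl_inv (chart C1 b')) (z, r)) s) (w1 b' m))
      = (if (b, l) = (b', m) then complex_of_real r powr (1 + s) else 0) + complex_of_real r powr (1 - s) * S1 b l b' m s"
    if "b < num_cusps C1" "l < k1 b" "b' < num_cusps C1" "m < k1 b'" "r > 0" for b l b' m r
    by (rule scattering_constant_term[where ?w = w1 and ?k = k1 and ?S = S1,
          OF G1 chi C1 ON1 E1[OF that(1,2)] that s CT1[rule_format, OF that(1,2,3,5) s]])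
  have ct: "cusp_mean C b (\<lambda>z. cinner (E a l (act (psl_inv (chart C b)) (z, r)) s) (w b m))
      = (if (a, l) = (b, m) then complex_of_real r powr (1 + s) else 0) + complex_of_real r powr (1 - s) * S a l b m s"
    if "a < num_cusps C" "l < k a" "b < num_cusps C" "m < k b" "r > 0" for a l b m r
    by (rule scattering_constant_term[where ?w = w and ?k = k and ?S = S,
          OF G unitary_psi C ON E[OF that(1,2)] that s CT[rule_format, OF that(1,2,3,5) s]])
  have wF: "w a l \<in> FS a" if "a < num_cusps C" "l < k a" for a l
    using ON[OF that(1)] that(2) by (simp add: orthonormal_basis_def)
  have w1F: "w1 b l \<in> FS1 b" if "b < num_cusps C1" "l < k1 b" for b l
    using ON1[OF that(1)] that(2) by (simp add: orthonormal_basis_def)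
  \<comment> \<open>\<open>c\<close> and \<open>x\<close> are the entries of the matrices
    \<open>A\<close> and \<open>B\<close> of the overview. They are 0 unless the cusp of
    \<open>\<Gamma>1\<close> lies above that of \<open>\<Gamma>\<close>, so that sums over fibres
    become sums over all cusps.\<close>
  define c where "c a l b m = (if below b = a then cinner (component b (w a l)) (w1 b m) else 0)" for a l b m
  define x where "x b m a l = (if below b = a then of_nat (coset_count b) * cnj (cinner (component b (w a l)) (w1 b m)) else 0)"
    for b m a l
  have fibre_sum: "(\<Sum>b\<in>fibre a. g b) = (\<Sum>b<num_cusps C1. if below b = a then g b else 0)" for a and g :: "nat \<Rightarrow> complex"
    unfolding fibre_def by (subst sum.inter_filter[symmetric]) (auto intro!: sum.cong)
  define p1 p2 where "p1 r = complex_of_real r powr (1 + s)" and "p2 r = complex_of_real r powr (1 - s)" for r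
  have relation: "(if (a, l) = (a', l') then p1 r else 0) + p2 r * S a l a' l' s
      = (\<Sum>b'<num_cusps C1. \<Sum>m'<k1 b'. (\<Sum>b<num_cusps C1. \<Sum>m<k1 b.
          c a l b m * ((if (b, m) = (b', m') then p1 r else 0) + p2 r * S1 b m b' m' s)) * x b' m' a' l')"
    if al: "a < num_cusps C" "l < k a" and al': "a' < num_cusps C" "l' < k a'" and r: "r > 0" for a l a' l' r
  proof -
    have "(if (a, l) = (a', l') then p1 r else 0) + p2 r * S a l a' l' s
      = cusp_mean C a' (\<lambda>z. cinner (E a l (act (psl_inv (chart C a')) (z, r)) s) (w a' l'))"
      unfolding p1_def p2_def by (rule ct[symmetric]) (use al al' r s in auto)
    also have "\<dots> = (\<Sum>b'\<in>fibre a'. \<Sum>m'<k1 b'. \<Sum>b\<in>fibre a. \<Sum>m<k1 b.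
        of_nat (coset_count b') * cnj (cinner (component b' (w a' l')) (w1 b' m')) * (cinner (component b (w a l)) (w1 b m) *
        cusp_mean C1 b'
          (\<lambda>z. cinner (E1 b m (act (psl_inv (chart C1 b')) (z, r)) s) (w1 b' m'))))"
      by (rule scattering_relation[OF ON1 E1 al(1) wF[OF al] E[OF al] al'(1) wF[OF al'] r s])
    also have "\<dots> = (\<Sum>b'\<in>fibre a'. \<Sum>m'<k1 b'. \<Sum>b\<in>fibre a. \<Sum>m<k1 b.
        of_nat (coset_count b') * cnj (cinner (component b' (w a' l')) (w1 b' m')) * (cinner (component b (w a l)) (w1 b m) *
        ((if (b, m) = (b', m') then p1 r else 0) + p2 r * S1 b m b' m' s)))"
    proof (intro sum.cong refl)
      fix b' m' b m assume *: "b' \<in> fibre a'" "m' \<in> {..<k1 b'}" "b \<in> fibre a" "m \<in> {..<k1 b}"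
      have "cusp_mean C1 b'
          (\<lambda>z. cinner (E1 b m (act (psl_inv (chart C1 b')) (z, r)) s) (w1 b' m'))
        = (if (b, m) = (b', m') then p1 r else 0) + p2 r * S1 b m b' m' s"
        unfolding p1_def p2_def by (rule ct1) (use * r s in \<open>auto simp: fibre_def\<close>)
      then show "of_nat (coset_count b') * cnj (cinner (component b' (w a' l')) (w1 b' m')) * (cinner (component b (w a l)) (w1 b m) *
          cusp_mean C1 b'
          (\<lambda>z. cinner (E1 b m (act (psl_inv (chart C1 b')) (z, r)) s) (w1 b' m')))
        = of_nat (coset_count b') * cnj (cinner (component b' (w a' l')) (w1 b' m')) * (cinner (component b (w a l)) (w1 b m) *
          ((if (b, m) = (b', m') then p1 r else 0) + p2 r * S1 b m b' m' s))"
        by (simp only:)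
    qed
    also have "\<dots> = (\<Sum>b'<num_cusps C1. \<Sum>m'<k1 b'. (\<Sum>b<num_cusps C1. \<Sum>m<k1 b.
          c a l b m * ((if (b, m) = (b', m') then p1 r else 0) + p2 r * S1 b m b' m' s)) * x b' m' a' l')"
      unfolding fibre_sum sum_distrib_right
      by (intro sum.cong refl) (auto simp: c_def x_def mult_ac intro!: sum.cong)
    finally show ?thesis .
  qed
  let ?I = "scattering_index C k" and ?I1 = "scattering_index C1 k1"
  let ?n = "length ?I" and ?n1 = "length ?I1"
  define cm where "cm = Matrix.mat ?n ?n1 (\<lambda>(i, j). c (fst (?I ! i)) (snd (?I ! i)) (fst (?I1 ! j)) (snd (?I1 ! j)))"
  define xm where "xm = Matrix.mat ?n1 ?n (\<lambda>(i, j). x (fst (?I1 ! i)) (snd (?I1 ! i)) (fst (?I ! j)) (snd (?I ! j)))"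
  define sm where "sm = Matrix.mat ?n ?n (\<lambda>(i, j). S (fst (?I ! i)) (snd (?I ! i)) (fst (?I ! j)) (snd (?I ! j)) s)"
  define sm1 where "sm1 = Matrix.mat ?n1 ?n1 (\<lambda>(i, j). S1 (fst (?I1 ! i)) (snd (?I1 ! i)) (fst (?I1 ! j)) (snd (?I1 ! j)) s)"
  have carrier: "cm \<in> carrier_mat ?n ?n1" "xm \<in> carrier_mat ?n1 ?n" "sm \<in> carrier_mat ?n ?n" "sm1 \<in> carrier_mat ?n1 ?n1"
    by (simp_all add: cm_def xm_def sm_def sm1_def)
  have eq_iff: "?I ! i = ?I ! j \<longleftrightarrow> i = j" if "i < ?n" "j < ?n" for i j
    using nth_eq_iff_index_eq[OF distinct_scattering_index that] .
  have eq_iff1: "?I1 ! i = ?I1 ! j \<longleftrightarrow> i = j" if "i < ?n1" "j < ?n1" for i j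
    using nth_eq_iff_index_eq[OF distinct_scattering_index that] .
  have entries: "(cm * xm) $$ (i, j) = (if i = j then 1 else 0) \<and> (cm * sm1 * xm) $$ (i, j) = sm $$ (i, j)"
    if i: "i < ?n" and j: "j < ?n" for i j
  proof -
    define a l a' l' where "a = fst (?I ! i)" and "l = snd (?I ! i)" and "a' = fst (?I ! j)" and "l' = snd (?I ! j)"
    note defs = this
    have al: "a < num_cusps C" "l < k a" "a' < num_cusps C" "l' < k a'"
      using scattering_index_nth[OF i] scattering_index_nth[OF j] by (simp_all add: defs)
    have ij: "(a, l) = (a', l') \<longleftrightarrow> i = j" using eq_iff[OF i j] by (simp add: defs)
    have cx: "(cm * xm) $$ (i, j) = (\<Sum>b'<num_cusps C1. \<Sum>m'<k1 b'. c a l b' m' * x b' m' a' l')"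
    proof -
      have "(cm * xm) $$ (i, j) = (\<Sum>t<?n1. (\<lambda>t. c a l (fst t) (snd t) * x (fst t) (snd t) a' l') (?I1 ! t))"
        using i j by (simp add: cm_def xm_def scalar_prod_def atLeast0LessThan defs)
      also have "\<dots> = (\<Sum>b'<num_cusps C1. \<Sum>m'<k1 b'. (\<lambda>t. c a l (fst t) (snd t) * x (fst t) (snd t) a' l') (b', m'))"
        by (rule sum_scattering_index)
      finally show ?thesis by simp
    qed
    have csx: "(cm * sm1 * xm) $$ (i, j) = (\<Sum>b'<num_cusps C1. \<Sum>m'<k1 b'. (\<Sum>b<num_cusps C1. \<Sum>m<k1 b. c a l b m * S1 b m b' m' s) * x b' m' a' l')"
    proof -
      have "(cm * sm1) $$ (i, t) = (\<lambda>t. \<Sum>b<num_cusps C1. \<Sum>m<k1 b. c a l b m * S1 b m (fst t) (snd t) s) (?I1 ! t)" if t: "t < ?n1" for t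
      proof -
        have "(cm * sm1) $$ (i, t) = (\<Sum>u<?n1. (\<lambda>u. c a l (fst u) (snd u) * S1 (fst u) (snd u) (fst (?I1 ! t)) (snd (?I1 ! t)) s) (?I1 ! u))"
          using i t by (simp add: cm_def sm1_def scalar_prod_def atLeast0LessThan defs)
        also have "\<dots> = (\<Sum>b<num_cusps C1. \<Sum>m<k1 b. (\<lambda>u. c a l (fst u) (snd u) * S1 (fst u) (snd u) (fst (?I1 ! t)) (snd (?I1 ! t)) s) (b, m))"
          by (rule sum_scattering_index)
        finally show ?thesis by simp
      qed
      then have "(cm * sm1 * xm) $$ (i, j) = (\<Sum>t<?n1. (\<lambda>t. (\<Sum>b<num_cusps C1. \<Sum>m<k1 b. c a l b m * S1 b m (fst t) (snd t) s) * x (fst t) (snd t) a' l') (?I1 ! t))"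
        unfolding mat_mult_entry[OF mult_carrier_mat[OF carrier(1,4)] carrier(2) i j]
        using j by (intro sum.cong refl) (simp add: xm_def defs)
      also have "\<dots> = (\<Sum>b'<num_cusps C1. \<Sum>m'<k1 b'. (\<lambda>t. (\<Sum>b<num_cusps C1. \<Sum>m<k1 b. c a l b m * S1 b m (fst t) (snd t) s) * x (fst t) (snd t) a' l') (b', m'))"
        by (rule sum_scattering_index)
      finally show ?thesis by simp
    qed
    have "p1 r * (if i = j then 1 else 0) + p2 r * S a l a' l' s = p1 r * (cm * xm) $$ (i, j) + p2 r * (cm * sm1 * xm) $$ (i, j)"
      if r: "r > 0" for r
    proof -
      \<comment> \<open>Only the diagonal carries \<open>p1 r\<close>, so the double sum collapses
        there to one entry of \<open>c\<close>; this separates the two powers of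
        \<open>r\<close>.\<close>
      have inner: "(\<Sum>b<num_cusps C1. \<Sum>m<k1 b. c a l b m * ((if (b, m) = (b', m') then p1 r else 0) + p2 r * S1 b m b' m' s))
        = p1 r * c a l b' m' + p2 r * (\<Sum>b<num_cusps C1. \<Sum>m<k1 b. c a l b m * S1 b m b' m' s)"
        if "b' < num_cusps C1" "m' < k1 b'" for b' m'
      proof -
        have "(\<Sum>b<num_cusps C1. \<Sum>m<k1 b. c a l b m * (if (b, m) = (b', m') then p1 r else 0))
            = (\<Sum>b<num_cusps C1. if b = b' then \<Sum>m<k1 b. if m = m' then c a l b m * p1 r else 0 else 0)"
        proof (intro sum.cong refl)
          fix b
          show "(\<Sum>m<k1 b. c a l b m * (if (b, m) = (b', m') then p1 r else 0))
            = (if b = b' then \<Sum>m<k1 b. if m = m' then c a l b m * p1 r else 0 else 0)"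
          proof (cases "b = b'")
            case True
            show ?thesis unfolding if_P[OF True] by (rule sum.cong) (auto simp: True)
          qed simp
        qed
        also have "\<dots> = (\<Sum>m<k1 b'. if m = m' then c a l b' m * p1 r else 0)"
          by (subst sum.delta) (use that in auto)
        also have "\<dots> = p1 r * c a l b' m'"
          by (subst sum.delta) (use that in auto)
        finally show ?thesis
          by (simp add: distrib_left sum.distrib sum_distrib_left mult.left_commute)
      qed
      have "p1 r * (if i = j then 1 else 0) + p2 r * S a l a' l' s = (if (a, l) = (a', l') then p1 r else 0) + p2 r * S a l a' l' s"
        using ij by auto
      also have "\<dots> = (\<Sum>b'<num_cusps C1. \<Sum>m'<k1 b'. (p1 r * c a l b' m' + p2 r * (\<Sum>b<num_cusps C1. \<Sum>m<k1 b. c a l b m * S1 b m b' m' s)) * x b' m' a' l')"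
        unfolding relation[OF al r] by (intro sum.cong refl) (simp only: inner lessThan_iff)
      also have "\<dots> = p1 r * (cm * xm) $$ (i, j) + p2 r * (cm * sm1 * xm) $$ (i, j)"
        unfolding cx csx by (rule double_sum_linear)
      finally show ?thesis .
    qed
    from powr_coefficients_unique[OF s this[unfolded p1_def p2_def]]
    have "(if i = j then 1 else 0) = (cm * xm) $$ (i, j)" "S a l a' l' s = (cm * sm1 * xm) $$ (i, j)" by blast+
    then show ?thesis using i j by (simp add: sm_def defs)
  qed
  have cx: "cm * xm = 1\<^sub>m ?n"
    by (rule eq_matI) (use entries carrier in auto)
  have csx: "cm * sm1 * xm = sm"
    by (rule eq_matI) (use entries carrier in auto)
  have "\<exists>v. v \<in> FS (below b) \<and> (\<forall>b'<num_cusps C1. below b' = below b \<longrightarrow> component b' v = (if b' = b then w1 b m else 0))"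
    if "b < num_cusps C1" "m < k1 b" for b m
    using lift_exists[OF that(1) w1F[OF that]] by metis
  then obtain v where v: "\<And>b m. b < num_cusps C1 \<Longrightarrow> m < k1 b \<Longrightarrow> v b m \<in> FS (below b)"
    "\<And>b m b'. b < num_cusps C1 \<Longrightarrow> m < k1 b \<Longrightarrow> b' < num_cusps C1 \<Longrightarrow> below b' = below b
      \<Longrightarrow> component b' (v b m) = (if b' = b then w1 b m else 0)"
    by metis
  \<comment> \<open>Row \<open>(b, m)\<close> contains the coordinates in the basis \<open>w\<close>
    of a lift of \<open>w1 b m\<close>. As \<open>c\<close> takes components, and the components of
    the lift are \<open>w1 b m\<close> at \<open>b\<close> and 0 at the other cusps of the fibre,
    \<open>dm * cm\<close> is the identity.\<close>
  define d where "d b m a l = (if below b = a then cinner (v b m) (w a l) else 0)" for b m a l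
  define dm where "dm = Matrix.mat ?n1 ?n (\<lambda>(i, j). d (fst (?I1 ! i)) (snd (?I1 ! i)) (fst (?I ! j)) (snd (?I ! j)))"
  have dm: "dm \<in> carrier_mat ?n1 ?n" by (simp add: dm_def)
  have dc: "dm * cm = 1\<^sub>m ?n1"
  proof (rule eq_matI)
    fix i j assume ij: "i < dim_row (1\<^sub>m ?n1)" "j < dim_col (1\<^sub>m ?n1)"
    then have i: "i < ?n1" and j: "j < ?n1" by simp_all
    define b m b' m' where "b = fst (?I1 ! i)" and "m = snd (?I1 ! i)" and "b' = fst (?I1 ! j)" and "m' = snd (?I1 ! j)"
    note defs = this
    have bm: "b < num_cusps C1" "m < k1 b" "b' < num_cusps C1" "m' < k1 b'"
      using scattering_index_nth[OF i] scattering_index_nth[OF j] by (simp_all add: defs)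
    have ij': "(b, m) = (b', m') \<longleftrightarrow> i = j" using eq_iff1[OF i j] by (simp add: defs)
    have "(dm * cm) $$ (i, j) = (\<Sum>t<?n. (\<lambda>t. d b m (fst t) (snd t) * c (fst t) (snd t) b' m') (?I ! t))"
      using i j by (simp add: dm_def cm_def scalar_prod_def atLeast0LessThan defs)
    also have "\<dots> = (\<Sum>a<num_cusps C. \<Sum>l<k a. (\<lambda>t. d b m (fst t) (snd t) * c (fst t) (snd t) b' m') (a, l))"
      by (rule sum_scattering_index)
    also have "\<dots> = (\<Sum>a<num_cusps C. \<Sum>l<k a. d b m a l * c a l b' m')" by simp
    also have "\<dots> = (\<Sum>a<num_cusps C. if a = below b then \<Sum>l<k a. d b m a l * c a l b' m' else 0)"
      by (intro sum.cong refl) (auto simp: d_def)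
    also have "\<dots> = (\<Sum>l<k (below b). d b m (below b) l * c (below b) l b' m')"
      using below_less[OF bm(1)] by simp
    also have "\<dots> = (if i = j then 1 else 0)"
    proof (cases "below b' = below b")
      case True
      have g: "psl_inv (gam b') \<in> \<Gamma>" using gam(1)[OF bm(3)] by simp
      have "(\<Sum>l<k (below b). cinner (v b m) (w (below b) l) * cinner (component b' (w (below b) l)) (w1 b' m'))
          = cinner (component b' (v b m)) (w1 b' m')"
        by (rule orthonormal_basis_component[OF ON[OF below_less[OF bm(1)]] v(1)[OF bm(1,2)], where f = "\<lambda>y. cinner (component b' y) (w1 b' m')"])
          (simp add: component_def ext_sum[OF g] ext_scaleC[OF g] cinner_sum_left cinner_scaleC_left)
      also have "\<dots> = (if b' = b then cinner (w1 b m) (w1 b' m') else 0)"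
        using v(2)[OF bm(1,2,3) True] by simp
      also have "\<dots> = (if i = j then 1 else 0)"
      proof (cases "b' = b")
        case True
        then have "cinner (w1 b m) (w1 b' m') = (if m = m' then 1 else 0)"
          using orthonormal_basis_cinner[OF ON1[OF bm(1)] bm(2)] bm(4) by simp
        then show ?thesis using ij' True by auto
      next
        case False
        then show ?thesis using ij' by auto
      qed
      finally show ?thesis by (simp add: d_def c_def True)
    next
      case False
      then have "i \<noteq> j" by (auto simp: defs)
      then show ?thesis using False by (simp add: c_def)
    qed
    finally show "(dm * cm) $$ (i, j) = 1\<^sub>m ?n1 $$ (i, j)" using i j by simp
  qed (simp_all add: dm_def cm_def)
  have "Determinant.det sm = Determinant.det sm1"
    unfolding csx[symmetric] by (rule det_similar_inverses[OF carrier(1,2) dm carrier(4) cx dc])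
  then show ?thesis by (simp add: scattering_det_def Let_def sm_def sm1_def)
qed

end

section \<open>From the half-plane to the whole plane\<close>

lemma scattering_det_meromorphic:
  assumes "scattering_matrix G C \<rho> k w S"
  shows "scattering_det C k S meromorphic_on UNIV"
proof -
  let ?I = "scattering_index C k"
  have permutes_less: "p i < n" if "p permutes {0..<n}" "i < n" for p and i n :: nat
    using permutes_in_image[OF that(1), of i] that(2) by auto
  have "(\<lambda>s. S (fst (?I ! i)) (snd (?I ! i)) (fst (?I ! j)) (snd (?I ! j)) s) meromorphic_on UNIV"
    if "i < length ?I" "j < length ?I" for i j
    using assms scattering_index_nth[OF that(1)] scattering_index_nth[OF that(2)]
    unfolding scattering_matrix_def by blast
  moreover have "scattering_det C k S = (\<lambda>s. \<Sum>p | p permutes {0..<length ?I}. signof p *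
      (\<Prod>i = 0..<length ?I. S (fst (?I ! i)) (snd (?I ! i)) (fst (?I ! p i)) (snd (?I ! p i)) s))"
    by (auto simp: fun_eq_iff scattering_det_def Let_def Determinant.det_def permutes_less intro!: sum.cong prod.cong)
  ultimately show ?thesis
    by (auto intro!: meromorphic_intros simp: permutes_less)
qed

text \<open>A meromorphic function on the connected plane is 0 outside a sparse set or nonzero
  outside one, and vanishing on \<open>U\<close> excludes the latter for the difference. As
  \<open>remove_sings\<close> depends only on punctured neighbourhoods, the sparse exceptions
  disappear.\<close>

lemma remove_sings_eq_if_eq_on_open:
  fixes f g :: "complex \<Rightarrow> complex"
  assumes f: "f meromorphic_on UNIV" and g: "g meromorphic_on UNIV"
    and U: "open U" "U \<noteq> {}" "\<And>z. z \<in> U \<Longrightarrow> f z = g z"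
  shows "remove_sings f = remove_sings g"
proof -
  obtain z0 where z0: "z0 \<in> U" using U(2) by blast
  have mero: "(\<lambda>z. f z - g z) meromorphic_on UNIV" by (intro meromorphic_intros f g)
  have "eventually (\<lambda>z. f z - g z = 0) (at z0)"
    using eventually_at_in_open'[OF U(1) z0] by eventually_elim (simp add: U(3))
  then have "\<not> eventually (\<lambda>z. f z - g z \<noteq> 0) (at z0)"
    using eventually_conj[of "\<lambda>z. f z - g z = 0" "at z0" "\<lambda>z. f z - g z \<noteq> 0"] by auto
  then have "\<not> eventually (\<lambda>z. f z - g z \<noteq> 0) (cosparse UNIV)"
    by (auto simp: eventually_cosparse_open_eq)
  then have "eventually (\<lambda>z. f z - g z = 0) (cosparse UNIV)"
    using meromorphic_imp_constant_or_avoid[OF mero open_UNIV connected_UNIV, of 0] by blast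
  then have "eventually (\<lambda>z. f z = g z) (at z)" for z
    by (auto simp: eventually_cosparse_open_eq)
  then show ?thesis by (intro ext remove_sings_cong) auto
qed

theorem theorem5p1:
  fixes \<Gamma> \<Gamma>1 :: "psl set"
    and chi :: "psl \<Rightarrow> 'v::fd_complex_inner \<Rightarrow> 'v"
    and \<alpha> :: "'n::finite \<Rightarrow> psl"
    and C C1 :: cusp_data
    and k k1 :: "nat \<Rightarrow> nat"
    and w :: "nat \<Rightarrow> nat \<Rightarrow> 'v ^ 'n" and w1 :: "nat \<Rightarrow> nat \<Rightarrow> 'v"
    and S S1 :: "nat \<Rightarrow> nat \<Rightarrow> nat \<Rightarrow> nat \<Rightarrow> complex \<Rightarrow> complex"
    and s :: complex
  assumes "cofinite_kleinian \<Gamma>"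
    and "\<Gamma>1 \<lhd> subgrp \<Gamma>"
    and "unitary_rep \<Gamma>1 chi"
    and "coset_reps \<Gamma> \<Gamma>1 \<alpha>"
    and "cusp_data_for \<Gamma> C" and "cusp_data_for \<Gamma>1 C1"
    and "compatible_charts \<Gamma> C C1"
    and "scattering_matrix \<Gamma>1 C1 chi k1 w1 S1"
    and "scattering_matrix \<Gamma> C (induced_rep \<Gamma>1 chi \<alpha>) k w S"
    and "\<not> is_pole (scattering_phi C1 k1 S1) s" and "\<not> is_pole (scattering_phi C k S) s"
  shows "scattering_phi C1 k1 S1 s = scattering_phi C k S s"
proof -
  have "subgroup \<Gamma> PSL2C" using assms(1) by (simp add: cofinite_kleinian_def kleinian_def)
  then interpret induced_cusps \<Gamma> \<Gamma>1 chi \<alpha> C C1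
    by (intro induced_cusps.intro induced_setup.intro induced_cusps_axioms.intro assms)
  have "remove_sings (scattering_det C1 k1 S1) = remove_sings (scattering_det C k S)"
  proof (rule remove_sings_eq_if_eq_on_open)
    show "open {s. Re s > 1}" by (rule open_halfspace_Re_gt)
    show "{s. Re s > 1} \<noteq> {}" by (auto intro: exI[of _ 2])
  qed (use assms scattering_det_meromorphic scattering_det_eq in auto)
  then show ?thesis by (simp add: scattering_phi_def)
qed

end
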